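(* Let $n\ge 1$, let $\Omega\subseteq[-\infty,+\infty]^n$, let $\mathbb{F}$ be any field, and let $X(-)$ and $X'(-)$ be persistence spaces indexed by $\Omega$. (I) Let $\mathcal{P}(-)$ be either any persistence hyperdigraph on $X(-)$ (where $X(-)$ is arbitrary), or any persistence hypergraph on $X(-)$, where in this second case $X(-)$ is equipped with a persistence topological embedding into $\mathbb{R}$. Then all of the following inclusions hold (so they form a commutative diagram of inclusions with two rows and three columns): $$\mathrm{Cr}^{H\mathbb{F}}(\mathcal{P}(-))\subseteq \mathrm{CACr}^{H\mathbb{F}}(\mathcal{P}(-))\subseteq \mathrm{AACr}^{H\mathbb{F}}(\mathcal{P}(-)),$$ $$\mathrm{Cr}^{H}(\mathcal{P}(-))\subseteq \mathrm{CACr}^{H}(\mathcal{P}(-))\subseteq \mathrm{AACr}^{H}(\mathcal{P}(-)),$$ $$\mathrm{Cr}^{H\mathbb{F}}(\mathcal{P}(-))\subseteq \mathrm{Cr}^{H}(\mathcal{P}(-)),\quad \mathrm{CACr}^{H\mathbb{F}}(\mathcal{P}(-))\subseteq \mathrm{CACr}^{H}(\mathcal{P}(-)),\quad \mathrm{AACr}^{H\mathbb{F}}(\mathcal{P}(-))\subseteq \mathrm{AACr}^{H}(\mathcal{P}(-)).$$ (II) Let $f:\mathcal{P}(-)\to\mathcal{P}'(-)$ be either any persistence morphism from a persistence hyperdigraph on $X(-)$ to a persistence hyperdigraph on $X'(-)$ (with $X(-)$, $X'(-)$ arbitrary), or any persistence injective morphism from a persistence hypergraph on $X(-)$ to a persistence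 hypergraph on $X'(-)$, where in this second case each of $X(-)$ and $X'(-)$ is equipped with a persistence topological embedding into $\mathbb{R}$. Then all of the following inclusions hold (so they form a commutative square of inclusions): $$\mathrm{CACr}^{H\mathbb{F}}(\mathcal{P}(-))\subseteq \mathrm{CACr}^{H}(\mathcal{P}(-)),$$ $$\mathrm{CACr}^{H\mathbb{F}}(\mathcal{P}'(-))\cup \mathrm{Cr}^{H\mathbb{F}}(f)\subseteq \mathrm{CACr}^{H}(\mathcal{P}'(-))\cup \mathrm{Cr}^{H}(f),$$ $$\mathrm{CACr}^{H\mathbb{F}}(\mathcal{P}(-))\subseteq \mathrm{CACr}^{H\mathbb{F}}(\mathcal{P}'(-))\cup \mathrm{Cr}^{H\mathbb{F}}(f),$$ $$\mathrm{CACr}^{H}(\mathcal{P}(-))\subseteq \mathrm{CACr}^{H}(\mathcal{P}'(-))\cup \mathrm{Cr}^{H}(f).$$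
   Context: Index set. $\Omega\subseteq[-\infty,+\infty]^n$ carries the subspace topology and the coordinatewise order: $\mathbf{s}\le\mathbf{t}$ iff $s_i\le t_i$ for all $i$. Persistence space. A persistence space $X(-)$ is a family of triangulable topological spaces $X(\mathbf{t})$, $\mathbf{t}\in\Omega$, with maps $\varphi(\mathbf{s},\mathbf{t}):X(\mathbf{s})\to X(\mathbf{t})$ for $\mathbf{s}\le\mathbf{t}$ such that $\varphi(\mathbf{t},\mathbf{t})=\mathrm{id}$ and $\varphi(\mathbf{s},\mathbf{t})\circ\varphi(\mathbf{r},\mathbf{s})=\varphi(\mathbf{r},\mathbf{t})$ for $\mathbf{r}\le\mathbf{s}\le\mathbf{t}$. The structure maps of $X'(-)$ are denoted $\varphi'(\mathbf{s},\mathbf{t})$. A persistence topological embedding of $X(-)$ into $\mathbb{R}$ is a family of topological embeddings $e(\mathbf{t}):X(\mathbf{t})\to\mathbb{R}$ with $e(\mathbf{t})\circ\varphi(\mathbf{s},\mathbf{t})=e(\mathbf{s})$ for all $\mathbf{s}\le\mathbf{t}$; it induces a total order $\prec$ on each $X(\mathbf{t})$. Hyperdigraphs. A directed $k$-hyperedge on a space $X$ is a sequence $(v_0,\dots,v_k)$ of $k+1$ distinct points of $X$ ($k\ge0$). A hyperdigraph on $X$ is a set of directed hyperedges on $X$. It is a directed simplicial complex if it is closed under taking nonempty subsequences. The chain complex $C_\bullet(\vec{\mathcal K};\mathbb{Z})$ of a directed simplicial complex $\vec{\mathcal K}$ is the graded free abelian group on its elements, with $\partial_k(v_0,\dots,v_k)=\sum_{i=0}^k(-1)^i(v_0,\dots,\widehat{v_i},\dots,v_k)$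 for $k\geq 1$ and $\partial_0=0$. A morphism $\varphi:\vec{\mathcal H}\to\vec{\mathcal H}'$ of hyperdigraphs on $X$ and $X'$ is given by a map $\varphi:X\to X'$ such that $(\varphi(v_0),\dots,\varphi(v_k))$ is a directed hyperedge of $\vec{\mathcal H}'$ for every directed hyperedge $(v_0,\dots,v_k)$ of $\vec{\mathcal H}$; by convention it sends distinct vertices to distinct vertices and distinct directed hyperedges to distinct directed hyperedges. Hypergraphs. A $k$-hyperedge on $X$ is a set $\{v_0,\dots,v_k\}$ of $k+1$ distinct points of $X$. A hypergraph on $X$ is a set of hyperedges on $X$. It is a simplicial complex if it is closed under nonempty subsets. If $X$ is totally ordered by $\prec$ through an embedding into $\mathbb{R}$, the chain complex $C_\bullet(\mathcal K;\mathbb{Z})$ of a simplicial complex $\mathcal K$ on $X$ is the graded free abelian group on its simplices with $\partial_k\{v_0,\dots,v_k\}=\sum_{i=0}^k(-1)^i\{v_0,\dots,\widehat{v_i},\dots,v_k\}$ for $v_0\prec\dots\prec v_k$, $k\geq 1$, and $\partial_0=0$. A morphism $\varphi:\mathcal H\to\mathcal H'$ of hypergraphs is given by a map $\varphi:X\to X'$ such that for each hyperedge of $\mathcal H$ its image (with repeated vertices removed) is a hyperedge of $\mathcal H'$. It is injective if it sends distinct vertices of $\mathcal H$ to distinct vertices of $\mathcal H'$ (hence distinct hyperedges to distinct hyperedges). Embedded homology. Let $\mathcal P$ be a hyperdigraph on a space $X$, or a hypergraph on a space $X$ that is totally ordered by $\prec$ through a topological embedding of $X$ into $\mathbb{R}$.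 Let $\Delta\mathcal P$ be the smallest (directed) simplicial complex containing $\mathcal P$, and let $\mathbb{Z}(\mathcal P)\subseteq C_\bullet(\Delta\mathcal P;\mathbb{Z})$ be the graded free abelian group generated by the (directed) hyperedges of $\mathcal P$. For a graded subgroup $G$ of $C_\bullet(\Delta\mathcal P;\mathbb{Z})$, $\mathrm{Inf}(G)$ denotes the largest sub-chain complex of $C_\bullet(\Delta\mathcal P;\mathbb{Z})$ contained in $G$; write $\mathrm{Inf}(\mathcal P)=\mathrm{Inf}(\mathbb{Z}(\mathcal P))$. The embedded homology is $H_\bullet(\mathcal P)=H_\bullet(\mathrm{Inf}(\mathcal P))$. For $\mathcal A\subseteq\mathcal P$ (a sub-hyper(di)graph, i.e. a subset), the relative embedded homology is $H_\bullet(\mathcal P,\mathcal A)=H_\bullet(\mathrm{Inf}(\mathcal P)/\mathrm{Inf}(\mathcal A))$. For a graded subgroup $G\subseteq\mathbb{Z}(\mathcal P)$, $H_\bullet(\mathbb{Z}(\mathcal P),G)=H_\bullet(\mathrm{Inf}(\mathcal P)/\mathrm{Inf}(G))$. With coefficients in a field $\mathbb{F}$, the homology of these chain complexes (respectively quotient chain complexes) tensored with $\mathbb{F}$ over $\mathbb{Z}$ is taken. Persistence objects. A persistence hyperdigraph (resp. hypergraph) $\mathcal P(-)$ on $X(-)$ is a family of hyperdigraphs (resp. hypergraphs) $\mathcal P(\mathbf{t})$ on $X(\mathbf{t})$ such that the maps $\varphi(\mathbf{s},\mathbf{t})$ induce morphisms $\mathcal P(\mathbf{s})\to\mathcal P(\mathbf{t})$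 for $\mathbf{s}\le\mathbf{t}$. These induce chain maps $\varphi(\mathbf{s},\mathbf{t})_\#:C_\bullet(\Delta\mathcal P(\mathbf{s});\mathbb{Z})\to C_\bullet(\Delta\mathcal P(\mathbf{t});\mathbb{Z})$ and homomorphisms $\varphi(\mathbf{s},\mathbf{t})_*$ on (relative) embedded homology. A persistence (injective) morphism $f:\mathcal P(-)\to\mathcal P'(-)$ is a family of (injective) morphisms $f(\mathbf{t}):\mathcal P(\mathbf{t})\to\mathcal P'(\mathbf{t})$ with $\varphi'(\mathbf{s},\mathbf{t})\circ f(\mathbf{s})=f(\mathbf{t})\circ\varphi(\mathbf{s},\mathbf{t})$ for all $\mathbf{s}\le\mathbf{t}$. Critical points. Let $\mathbf{t}\in\Omega$. (1) $\mathbf{t}$ is a homological regular point of $\mathcal P(-)$ if there is an open neighborhood $U$ of $\mathbf{t}$ in $\Omega$ such that for all $\mathbf{r}\le\mathbf{s}$ in $U$, $\varphi(\mathbf{r},\mathbf{s})_*:H_\bullet(\mathcal P(\mathbf{r}))\to H_\bullet(\mathcal P(\mathbf{s}))$ is an isomorphism. (2) $\mathbf{t}$ is a combinatorial-absolute homological regular point if there is an open neighborhood $U$ of $\mathbf{t}$ in $\Omega$ such that for all $\mathbf{r}\le\mathbf{s}$ in $U$ and every sub-hyper(di)graph $\mathcal A(\mathbf{r})$ of $\mathcal P(\mathbf{r})$, $\varphi(\mathbf{r},\mathbf{s})_*:H_\bullet(\mathcal P(\mathbf{r}),\mathcal A(\mathbf{r}))\to H_\bullet(\mathcal P(\mathbf{s}),\mathcal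 A(\mathbf{s}))$ is an isomorphism, where $\mathcal A(\mathbf{s})=\varphi(\mathbf{r},\mathbf{s})(\mathcal A(\mathbf{r}))$. (3) $\mathbf{t}$ is an algebraic-absolute homological regular point if there is an open neighborhood $U$ of $\mathbf{t}$ in $\Omega$ such that for all $\mathbf{r}\le\mathbf{s}$ in $U$ and every graded subgroup $G(\mathbf{r})$ of $\mathbb{Z}(\mathcal P(\mathbf{r}))$, $\varphi(\mathbf{r},\mathbf{s})_*:H_\bullet(\mathbb{Z}(\mathcal P(\mathbf{r})),G(\mathbf{r}))\to H_\bullet(\mathbb{Z}(\mathcal P(\mathbf{s})),G(\mathbf{s}))$ is an isomorphism, where $G(\mathbf{s})=\varphi(\mathbf{r},\mathbf{s})_\#(G(\mathbf{r}))$. (4) $\mathbf{t}$ is a homological regular point of a persistence morphism $f:\mathcal P(-)\to\mathcal P'(-)$ if there is an open neighborhood $U$ of $\mathbf{t}$ in $\Omega$ such that for all $\mathbf{r}\le\mathbf{s}$ in $U$, $\varphi'(\mathbf{r},\mathbf{s})_*:H_\bullet(\mathcal P'(\mathbf{r}),f(\mathbf{r})(\mathcal P(\mathbf{r})))\to H_\bullet(\mathcal P'(\mathbf{s}),f(\mathbf{s})(\mathcal P(\mathbf{s})))$ is an isomorphism. In each case a critical point of the given type is a point of $\Omega$ that is not regular of that type. The sets of critical points of types (1)–(4) are denoted $\mathrm{Cr}^H(\mathcal P(-))$, $\mathrm{CACr}^H(\mathcal P(-))$, $\mathrm{AACr}^H(\mathcal P(-))$, $\mathrm{Cr}^H(f)$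 for integer coefficients, and $\mathrm{Cr}^{H\mathbb{F}}$, $\mathrm{CACr}^{H\mathbb{F}}$, $\mathrm{AACr}^{H\mathbb{F}}$, $\mathrm{Cr}^{H\mathbb{F}}(f)$ when the coefficients of all the homology groups are taken from $\mathbb{F}$. *)

theory Defs
  imports
    "HOL-Analysis.Analysis"
    "HOL-Algebra.Free_Abelian_Groups"
    "HOL-Algebra.Generated_Groups"
    "HOL-Library.Sublist"
begin

section \<open>Hypergraphs, hyperdigraphs and their morphisms\<close>

definition hypergraph :: "'a set \<Rightarrow> 'a set set \<Rightarrow> bool" where
  "hypergraph S H \<longleftrightarrow> (\<forall>\<sigma>\<in>H. finite \<sigma> \<and> \<sigma> \<noteq> {} \<and> \<sigma> \<subseteq> S)"

definition simplicial_cx :: "'a set \<Rightarrow> 'a set set \<Rightarrow> bool" where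
  "simplicial_cx S K \<longleftrightarrow> hypergraph S K \<and> (\<forall>\<sigma>\<in>K. \<forall>\<tau>. \<tau> \<noteq> {} \<and> \<tau> \<subseteq> \<sigma> \<longrightarrow> \<tau> \<in> K)"

definition hypergraph_morphism ::
  "'a set \<Rightarrow> 'b set \<Rightarrow> ('a \<Rightarrow> 'b) \<Rightarrow> 'a set set \<Rightarrow> 'b set set \<Rightarrow> bool" where
  "hypergraph_morphism S S' f H H' \<longleftrightarrow> f \<in> S \<rightarrow> S' \<and> (\<forall>\<sigma>\<in>H. f ` \<sigma> \<in> H')"

definition injective_hypergraph_morphism ::
  "'a set \<Rightarrow> 'b set \<Rightarrow> ('a \<Rightarrow> 'b) \<Rightarrow> 'a set set \<Rightarrow> 'b set set \<Rightarrow> bool" where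
  "injective_hypergraph_morphism S S' f H H' \<longleftrightarrow>
     hypergraph_morphism S S' f H H' \<and> inj_on f (\<Union>H)"

text \<open>A directed hyperedge \<open>(v\<^sub>0, \<dots>, v\<^sub>k)\<close> is a nonempty list without repetitions.\<close>

definition hyperdigraph :: "'a set \<Rightarrow> 'a list set \<Rightarrow> bool" where
  "hyperdigraph S H \<longleftrightarrow> (\<forall>\<sigma>\<in>H. \<sigma> \<noteq> [] \<and> distinct \<sigma> \<and> set \<sigma> \<subseteq> S)"

definition directed_simplicial_cx :: "'a set \<Rightarrow> 'a list set \<Rightarrow> bool" where
  "directed_simplicial_cx S K \<longleftrightarrow>
     hyperdigraph S K \<and> (\<forall>\<sigma>\<in>K. \<forall>\<tau>. \<tau> \<noteq> [] \<and> subseq \<tau> \<sigma> \<longrightarrow> \<tau> \<in> K)"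

text \<open>By convention, morphisms of hyperdigraphs are injective on vertices and on directed
  hyperedges; the vertices of \<open>H\<close> are the points occurring in a directed hyperedge of \<open>H\<close>.\<close>

definition hyperdigraph_morphism ::
  "'a set \<Rightarrow> 'b set \<Rightarrow> ('a \<Rightarrow> 'b) \<Rightarrow> 'a list set \<Rightarrow> 'b list set \<Rightarrow> bool" where
  "hyperdigraph_morphism S S' f H H' \<longleftrightarrow>
     f \<in> S \<rightarrow> S' \<and> (\<forall>\<sigma>\<in>H. map f \<sigma> \<in> H') \<and>
     inj_on f (\<Union>(set ` H)) \<and> inj_on (map f) H"


section \<open>Persistence spaces\<close>

definition geometric_simplex :: "'v set \<Rightarrow> ('v \<Rightarrow> real) set" where
  "geometric_simplex \<sigma> = {b. (\<forall>v. 0 \<le> b v) \<and> (\<forall>v. v \<notin> \<sigma> \<longrightarrow> b v = 0) \<and> (\<Sum>v\<in>\<sigma>. b v) = 1}"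

text \<open>The geometric realization in barycentric coordinates, with the weak topology.\<close>

definition realization :: "'v set set \<Rightarrow> ('v \<Rightarrow> real) topology" where
  "realization K = topology (\<lambda>U. U \<subseteq> (\<Union>\<sigma>\<in>K. geometric_simplex \<sigma>) \<and>
     (\<forall>\<sigma>\<in>K. openin (top_of_set (geometric_simplex \<sigma>)) (U \<inter> geometric_simplex \<sigma>)))"

lemma openin_realization:
  "openin (realization K) U \<longleftrightarrow> U \<subseteq> (\<Union>\<sigma>\<in>K. geometric_simplex \<sigma>) \<and>
     (\<forall>\<sigma>\<in>K. openin (top_of_set (geometric_simplex \<sigma>)) (U \<inter> geometric_simplex \<sigma>))"
proof -
  have "istopology (\<lambda>U. U \<subseteq> (\<Union>\<sigma>\<in>K. geometric_simplex \<sigma>) \<and>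
     (\<forall>\<sigma>\<in>K. openin (top_of_set (geometric_simplex \<sigma>)) (U \<inter> geometric_simplex \<sigma>)))"
    (is "istopology ?L")
    unfolding istopology_def
  proof (intro conjI allI impI)
    fix S T assume "?L S" "?L T"
    then show "S \<inter> T \<subseteq> (\<Union>\<sigma>\<in>K. geometric_simplex \<sigma>)" by blast
  next
    fix S T assume ST: "?L S" "?L T"
    show "\<forall>\<sigma>\<in>K. openin (top_of_set (geometric_simplex \<sigma>)) (S \<inter> T \<inter> geometric_simplex \<sigma>)"
    proof
      fix \<sigma> assume \<sigma>: "\<sigma> \<in> K"
      have "openin (top_of_set (geometric_simplex \<sigma>))
          ((S \<inter> geometric_simplex \<sigma>) \<inter> (T \<inter> geometric_simplex \<sigma>))"
        by (rule openin_Int) (use ST \<sigma> in \<open>blast+\<close>)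
      then show "openin (top_of_set (geometric_simplex \<sigma>)) (S \<inter> T \<inter> geometric_simplex \<sigma>)"
        by (simp only: Int_ac Int_absorb Int_left_absorb)
    qed
  next
    fix \<U> assume "\<forall>S\<in>\<U>. ?L S"
    then show "\<Union>\<U> \<subseteq> (\<Union>\<sigma>\<in>K. geometric_simplex \<sigma>)" by blast
  next
    fix \<U> assume \<U>: "\<forall>S\<in>\<U>. ?L S"
    show "\<forall>\<sigma>\<in>K. openin (top_of_set (geometric_simplex \<sigma>)) (\<Union>\<U> \<inter> geometric_simplex \<sigma>)"
    proof
      fix \<sigma> assume \<sigma>: "\<sigma> \<in> K"
      have "openin (top_of_set (geometric_simplex \<sigma>)) (\<Union>S\<in>\<U>. S \<inter> geometric_simplex \<sigma>)"
        by (rule openin_Union) (use \<U> \<sigma> in \<open>blast\<close>)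
      then show "openin (top_of_set (geometric_simplex \<sigma>)) (\<Union>\<U> \<inter> geometric_simplex \<sigma>)"
        by (simp only: Int_Union2)
    qed
  qed
  then show ?thesis
    unfolding realization_def by (simp add: topology_inverse')
qed

text \<open>Vertices of a triangulation are points of the space, so it is no restriction that the
  vertex type is the type of points of \<open>X\<close>.\<close>

definition triangulable :: "'a topology \<Rightarrow> bool" where
  "triangulable X \<longleftrightarrow>
     (\<exists>K :: 'a set set. simplicial_cx UNIV K \<and> X homeomorphic_space realization K)"

definition persistence_space ::
  "'i::ord set \<Rightarrow> ('i \<Rightarrow> 'a topology) \<Rightarrow> ('i \<Rightarrow> 'i \<Rightarrow> 'a \<Rightarrow> 'a) \<Rightarrow> bool" where
  "persistence_space \<Omega> X \<phi> \<longleftrightarrow>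
     (\<forall>t\<in>\<Omega>. triangulable (X t)) \<and>
     (\<forall>s\<in>\<Omega>. \<forall>t\<in>\<Omega>. s \<le> t \<longrightarrow> continuous_map (X s) (X t) (\<phi> s t)) \<and>
     (\<forall>t\<in>\<Omega>. \<forall>x\<in>topspace (X t). \<phi> t t x = x) \<and>
     (\<forall>r\<in>\<Omega>. \<forall>s\<in>\<Omega>. \<forall>t\<in>\<Omega>. r \<le> s \<and> s \<le> t \<longrightarrow>
        (\<forall>x\<in>topspace (X r). \<phi> s t (\<phi> r s x) = \<phi> r t x))"

definition persistence_embedding ::
  "'i::ord set \<Rightarrow> ('i \<Rightarrow> 'a topology) \<Rightarrow> ('i \<Rightarrow> 'i \<Rightarrow> 'a \<Rightarrow> 'a) \<Rightarrow> ('i \<Rightarrow> 'a \<Rightarrow> real) \<Rightarrow> bool" where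
  "persistence_embedding \<Omega> X \<phi> e \<longleftrightarrow>
     (\<forall>t\<in>\<Omega>. embedding_map (X t) euclideanreal (e t)) \<and>
     (\<forall>s\<in>\<Omega>. \<forall>t\<in>\<Omega>. s \<le> t \<longrightarrow> (\<forall>x\<in>topspace (X s). e t (\<phi> s t x) = e s x))"

definition persistence_hyperdigraph ::
  "'i::ord set \<Rightarrow> ('i \<Rightarrow> 'a topology) \<Rightarrow> ('i \<Rightarrow> 'i \<Rightarrow> 'a \<Rightarrow> 'a) \<Rightarrow> ('i \<Rightarrow> 'a list set) \<Rightarrow> bool" where
  "persistence_hyperdigraph \<Omega> X \<phi> P \<longleftrightarrow>
     (\<forall>t\<in>\<Omega>. hyperdigraph (topspace (X t)) (P t)) \<and>
     (\<forall>s\<in>\<Omega>. \<forall>t\<in>\<Omega>. s \<le> t \<longrightarrow>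
        hyperdigraph_morphism (topspace (X s)) (topspace (X t)) (\<phi> s t) (P s) (P t))"

definition persistence_hypergraph ::
  "'i::ord set \<Rightarrow> ('i \<Rightarrow> 'a topology) \<Rightarrow> ('i \<Rightarrow> 'i \<Rightarrow> 'a \<Rightarrow> 'a) \<Rightarrow> ('i \<Rightarrow> 'a set set) \<Rightarrow> bool" where
  "persistence_hypergraph \<Omega> X \<phi> P \<longleftrightarrow>
     (\<forall>t\<in>\<Omega>. hypergraph (topspace (X t)) (P t)) \<and>
     (\<forall>s\<in>\<Omega>. \<forall>t\<in>\<Omega>. s \<le> t \<longrightarrow>
        hypergraph_morphism (topspace (X s)) (topspace (X t)) (\<phi> s t) (P s) (P t))"

definition persistence_map ::
  "'i::ord set \<Rightarrow> ('i \<Rightarrow> 'a topology) \<Rightarrow> ('i \<Rightarrow> 'i \<Rightarrow> 'a \<Rightarrow> 'a) \<Rightarrow>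
     ('i \<Rightarrow> 'i \<Rightarrow> 'b \<Rightarrow> 'b) \<Rightarrow> ('i \<Rightarrow> 'a \<Rightarrow> 'b) \<Rightarrow> bool" where
  "persistence_map \<Omega> X \<phi> \<phi>' f \<longleftrightarrow>
     (\<forall>s\<in>\<Omega>. \<forall>t\<in>\<Omega>. s \<le> t \<longrightarrow> (\<forall>x\<in>topspace (X s). \<phi>' s t (f s x) = f t (\<phi> s t x)))"

definition persistence_hyperdigraph_morphism ::
  "'i::ord set \<Rightarrow> ('i \<Rightarrow> 'a topology) \<Rightarrow> ('i \<Rightarrow> 'i \<Rightarrow> 'a \<Rightarrow> 'a) \<Rightarrow> ('i \<Rightarrow> 'a list set) \<Rightarrow>
     ('i \<Rightarrow> 'b topology) \<Rightarrow> ('i \<Rightarrow> 'i \<Rightarrow> 'b \<Rightarrow> 'b) \<Rightarrow> ('i \<Rightarrow> 'b list set) \<Rightarrow>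
     ('i \<Rightarrow> 'a \<Rightarrow> 'b) \<Rightarrow> bool" where
  "persistence_hyperdigraph_morphism \<Omega> X \<phi> P X' \<phi>' P' f \<longleftrightarrow>
     (\<forall>t\<in>\<Omega>. hyperdigraph_morphism (topspace (X t)) (topspace (X' t)) (f t) (P t) (P' t)) \<and>
     persistence_map \<Omega> X \<phi> \<phi>' f"

definition persistence_injective_hypergraph_morphism ::
  "'i::ord set \<Rightarrow> ('i \<Rightarrow> 'a topology) \<Rightarrow> ('i \<Rightarrow> 'i \<Rightarrow> 'a \<Rightarrow> 'a) \<Rightarrow> ('i \<Rightarrow> 'a set set) \<Rightarrow>
     ('i \<Rightarrow> 'b topology) \<Rightarrow> ('i \<Rightarrow> 'i \<Rightarrow> 'b \<Rightarrow> 'b) \<Rightarrow> ('i \<Rightarrow> 'b set set) \<Rightarrow>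
     ('i \<Rightarrow> 'a \<Rightarrow> 'b) \<Rightarrow> bool" where
  "persistence_injective_hypergraph_morphism \<Omega> X \<phi> P X' \<phi>' P' f \<longleftrightarrow>
     (\<forall>t\<in>\<Omega>. injective_hypergraph_morphism (topspace (X t)) (topspace (X' t)) (f t) (P t) (P' t)) \<and>
     persistence_map \<Omega> X \<phi> \<phi>' f"


section \<open>Chain complexes and homology\<close>

text \<open>\<open>bnd C k\<close> is \<open>\<partial>\<^sub>k\<close> from degree \<open>k\<close> to degree \<open>k - 1\<close> for \<open>k \<ge> 1\<close>; \<open>\<partial>\<^sub>0 = 0\<close>
  is built into \<open>cycles\<close>, and \<open>bnd C 0\<close> is never used.\<close>

record 'c chain_complex =
  grp :: "nat \<Rightarrow> 'c monoid"
  bnd :: "nat \<Rightarrow> 'c \<Rightarrow> 'c"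

fun cycles :: "'c chain_complex \<Rightarrow> nat \<Rightarrow> 'c set" where
  "cycles C 0 = carrier (grp C 0)"
| "cycles C (Suc k) = kernel (grp C (Suc k)) (grp C k) (bnd C (Suc k))"

definition boundaries :: "'c chain_complex \<Rightarrow> nat \<Rightarrow> 'c set" where
  "boundaries C k = bnd C (Suc k) ` carrier (grp C (Suc k))"

definition homology :: "'c chain_complex \<Rightarrow> nat \<Rightarrow> 'c set monoid" where
  "homology C k = (grp C k)\<lparr>carrier := cycles C k\<rparr> Mod boundaries C k"

text \<open>The map \<open>Nx \<mapsto> N'h(x)\<close> induced by \<open>h\<close> from a quotient into a quotient \<open>G' Mod N'\<close>.\<close>

definition coset_map :: "('d, 'm) monoid_scheme \<Rightarrow> 'd set \<Rightarrow> ('c \<Rightarrow> 'd) \<Rightarrow> 'c set \<Rightarrow> 'd set" where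
  "coset_map G' N' h S = (\<Union>x\<in>S. N' #>\<^bsub>G'\<^esub> h x)"

text \<open>The chain map \<open>h\<close> induces isomorphisms in homology, in all degrees.\<close>

definition homology_iso ::
  "'c chain_complex \<Rightarrow> 'd chain_complex \<Rightarrow> (nat \<Rightarrow> 'c \<Rightarrow> 'd) \<Rightarrow> bool" where
  "homology_iso C C' h \<longleftrightarrow>
     (\<forall>k. coset_map (grp C' k) (boundaries C' k) (h k) \<in> iso (homology C k) (homology C' k))"

definition subcomplex :: "'c chain_complex \<Rightarrow> (nat \<Rightarrow> 'c set) \<Rightarrow> bool" where
  "subcomplex C D \<longleftrightarrow>
     (\<forall>k. subgroup (D k) (grp C k)) \<and> (\<forall>k. bnd C (Suc k) ` D (Suc k) \<subseteq> D k)"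

text \<open>The largest subcomplex contained in a graded subgroup \<open>G\<close> (the order is degreewise
  inclusion); it exists because the sum of subcomplexes contained in \<open>G\<close> is again one.\<close>

definition infimum_subcomplex :: "'c chain_complex \<Rightarrow> (nat \<Rightarrow> 'c set) \<Rightarrow> nat \<Rightarrow> 'c set" where
  "infimum_subcomplex C G = (GREATEST D. subcomplex C D \<and> D \<le> G)"

definition restrict_complex :: "'c chain_complex \<Rightarrow> (nat \<Rightarrow> 'c set) \<Rightarrow> 'c chain_complex" where
  "restrict_complex C D = \<lparr>grp = (\<lambda>k. (grp C k)\<lparr>carrier := D k\<rparr>), bnd = bnd C\<rparr>"

definition quotient_complex :: "'c chain_complex \<Rightarrow> (nat \<Rightarrow> 'c set) \<Rightarrow> 'c set chain_complex" where
  "quotient_complex C D =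
     \<lparr>grp = (\<lambda>k. grp C k Mod D k),
      bnd = (\<lambda>k. coset_map (grp C (k - 1)) (D (k - 1)) (bnd C k))\<rparr>"


section \<open>Field coefficients\<close>

text \<open>\<open>A \<otimes>\<^sub>\<int> F\<close> is the free abelian group on the pairs \<open>(a, x)\<close> modulo the biadditivity
  relations. The map induced by \<open>h \<otimes> id\<close> on homology is \<open>F\<close>-linear, so it is an isomorphism
  of vector spaces iff it is an isomorphism of abelian groups.\<close>

definition tensor_free :: "'c monoid \<Rightarrow> ('c \<times> 'f \<Rightarrow>\<^sub>0 int) monoid" where
  "tensor_free A = free_Abelian_group (carrier A \<times> UNIV)"

definition tensor_relations :: "'c monoid \<Rightarrow> ('c \<times> 'f::field \<Rightarrow>\<^sub>0 int) set" where
  "tensor_relations A = generate (tensor_free A)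
     ({frag_of (a \<otimes>\<^bsub>A\<^esub> b, x) - frag_of (a, x) - frag_of (b, x) | a b x.
         a \<in> carrier A \<and> b \<in> carrier A} \<union>
      {frag_of (a, x + y) - frag_of (a, x) - frag_of (a, y) | a x y. a \<in> carrier A})"

definition tensor_group :: "'c monoid \<Rightarrow> ('c \<times> 'f::field \<Rightarrow>\<^sub>0 int) set monoid" where
  "tensor_group A = tensor_free A Mod tensor_relations A"

text \<open>\<open>h \<otimes> id\<close>, where \<open>B\<close> is the codomain of \<open>h\<close>.\<close>

definition tensor_map ::
  "'d monoid \<Rightarrow> ('c \<Rightarrow> 'd) \<Rightarrow> ('c \<times> 'f::field \<Rightarrow>\<^sub>0 int) set \<Rightarrow> ('d \<times> 'f \<Rightarrow>\<^sub>0 int) set" where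
  "tensor_map B h =
     coset_map (tensor_free B) (tensor_relations B) (frag_extend (\<lambda>(a, x). frag_of (h a, x)))"

definition tensor_complex :: "'c chain_complex \<Rightarrow> ('c \<times> 'f::field \<Rightarrow>\<^sub>0 int) set chain_complex" where
  "tensor_complex C =
     \<lparr>grp = (\<lambda>k. tensor_group (grp C k)),
      bnd = (\<lambda>k. tensor_map (grp C (k - 1)) (bnd C k))\<rparr>"

definition homology_iso_over ::
  "'f::field itself \<Rightarrow> 'c chain_complex \<Rightarrow> 'd chain_complex \<Rightarrow> (nat \<Rightarrow> 'c \<Rightarrow> 'd) \<Rightarrow> bool" where
  "homology_iso_over F C C' h \<longleftrightarrow>
     homology_iso
       (tensor_complex C :: ('c \<times> 'f \<Rightarrow>\<^sub>0 int) set chain_complex)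
       (tensor_complex C' :: ('d \<times> 'f \<Rightarrow>\<^sub>0 int) set chain_complex)
       (\<lambda>k. tensor_map (grp C' k) (h k))"


section \<open>Chain complexes of (directed) simplicial complexes\<close>

definition directed_boundary :: "'a list \<Rightarrow> ('a list \<Rightarrow>\<^sub>0 int)" where
  "directed_boundary \<sigma> =
     (if length \<sigma> \<le> 1 then 0
      else \<Sum>i<length \<sigma>. frag_cmul ((-1) ^ i) (frag_of (take i \<sigma> @ drop (Suc i) \<sigma>)))"

text \<open>The points are ordered by \<open>v \<prec> w \<longleftrightarrow> e v < e w\<close>; if \<open>\<sigma> = {v\<^sub>0 \<prec> \<dots> \<prec> v\<^sub>k}\<close> then the
  index \<open>i\<close> of \<open>v = v\<^sub>i\<close> is the number of vertices preceding \<open>v\<close>.\<close>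

definition ordered_boundary :: "('a \<Rightarrow> real) \<Rightarrow> 'a set \<Rightarrow> ('a set \<Rightarrow>\<^sub>0 int)" where
  "ordered_boundary e \<sigma> =
     (if card \<sigma> \<le> 1 then 0
      else \<Sum>v\<in>\<sigma>. frag_cmul ((-1) ^ card {w \<in> \<sigma>. e w < e v}) (frag_of (\<sigma> - {v})))"

text \<open>\<open>n \<sigma>\<close> is the number of vertices of \<open>\<sigma>\<close>, that is, its dimension plus one.\<close>

definition graded_span :: "('c \<Rightarrow> nat) \<Rightarrow> 'c set \<Rightarrow> nat \<Rightarrow> ('c \<Rightarrow>\<^sub>0 int) monoid" where
  "graded_span n A k = free_Abelian_group {\<sigma>\<in>A. n \<sigma> = Suc k}"

definition cell_complex ::
  "('c \<Rightarrow> nat) \<Rightarrow> ('c \<Rightarrow> ('c \<Rightarrow>\<^sub>0 int)) \<Rightarrow> 'c set \<Rightarrow> ('c \<Rightarrow>\<^sub>0 int) chain_complex" where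
  "cell_complex n d K = \<lparr>grp = graded_span n K, bnd = (\<lambda>k. frag_extend d)\<rparr>"


section \<open>Embedded homology of persistence hyper(di)graphs\<close>

text \<open>The data common to persistence hyperdigraphs (\<open>'c = 'a list\<close>) and persistence
  hypergraphs (\<open>'c = 'a set\<close>): the (directed) hyperedges of \<open>P(t)\<close>, the chain complex of
  \<open>\<Delta>P(t)\<close>, the number of vertices of a cell, and the action of \<open>\<phi>(s,t)\<close> on cells.\<close>

record ('i, 'c) pers_hyper =
  edges :: "'i \<Rightarrow> 'c set"
  chains :: "'i \<Rightarrow> ('c \<Rightarrow>\<^sub>0 int) chain_complex"
  nverts :: "'c \<Rightarrow> nat"
  trans_map :: "'i \<Rightarrow> 'i \<Rightarrow> 'c \<Rightarrow> 'c"

definition directed_hyper ::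
  "('i \<Rightarrow> 'a topology) \<Rightarrow> ('i \<Rightarrow> 'i \<Rightarrow> 'a \<Rightarrow> 'a) \<Rightarrow> ('i \<Rightarrow> 'a list set) \<Rightarrow>
     ('i, 'a list) pers_hyper" where
  "directed_hyper X \<phi> P =
     \<lparr>edges = P,
      chains = (\<lambda>t. cell_complex length directed_boundary
                      (directed_simplicial_cx (topspace (X t)) hull P t)),
      nverts = length,
      trans_map = (\<lambda>s t. map (\<phi> s t))\<rparr>"

text \<open>Compatibility with the embeddings \<open>e\<close> makes \<open>\<phi>(s,t)\<close> strictly increasing, so on the
  chains it maps a simplex to its image, without sign.\<close>

definition ordered_hyper ::
  "('i \<Rightarrow> 'a topology) \<Rightarrow> ('i \<Rightarrow> 'i \<Rightarrow> 'a \<Rightarrow> 'a) \<Rightarrow> ('i \<Rightarrow> 'a \<Rightarrow> real) \<Rightarrow> ('i \<Rightarrow> 'a set set) \<Rightarrow>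
     ('i, 'a set) pers_hyper" where
  "ordered_hyper X \<phi> e P =
     \<lparr>edges = P,
      chains = (\<lambda>t. cell_complex card (ordered_boundary (e t))
                      (simplicial_cx (topspace (X t)) hull P t)),
      nverts = card,
      trans_map = (\<lambda>s t. image (\<phi> s t))\<rparr>"

definition span_of :: "('i, 'c) pers_hyper \<Rightarrow> 'c set \<Rightarrow> nat \<Rightarrow> ('c \<Rightarrow>\<^sub>0 int) set" where
  "span_of M A k = carrier (graded_span (nverts M) A k)"

definition chain_push :: "('i, 'c) pers_hyper \<Rightarrow> 'i \<Rightarrow> 'i \<Rightarrow> ('c \<Rightarrow>\<^sub>0 int) \<Rightarrow> ('c \<Rightarrow>\<^sub>0 int)" where
  "chain_push M s t = frag_extend (\<lambda>\<sigma>. frag_of (trans_map M s t \<sigma>))"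

text \<open>\<open>Inf(P(t))\<close>\<close>

definition Inf_complex :: "('i, 'c) pers_hyper \<Rightarrow> 'i \<Rightarrow> ('c \<Rightarrow>\<^sub>0 int) chain_complex" where
  "Inf_complex M t =
     restrict_complex (chains M t) (infimum_subcomplex (chains M t) (span_of M (edges M t)))"

text \<open>\<open>Inf(P(t)) / Inf(G)\<close>\<close>

definition relative_complex ::
  "('i, 'c) pers_hyper \<Rightarrow> 'i \<Rightarrow> (nat \<Rightarrow> ('c \<Rightarrow>\<^sub>0 int) set) \<Rightarrow> ('c \<Rightarrow>\<^sub>0 int) set chain_complex" where
  "relative_complex M t G =
     quotient_complex (Inf_complex M t) (infimum_subcomplex (chains M t) G)"

text \<open>The map that \<open>\<phi>(r,s)\<close> induces from \<open>Inf(P(r)) / Inf(G)\<close> to \<open>Inf(P(s)) / Inf(G')\<close>.\<close>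

definition relative_push ::
  "('i, 'c) pers_hyper \<Rightarrow> 'i \<Rightarrow> 'i \<Rightarrow> (nat \<Rightarrow> ('c \<Rightarrow>\<^sub>0 int) set) \<Rightarrow>
     nat \<Rightarrow> ('c \<Rightarrow>\<^sub>0 int) set \<Rightarrow> ('c \<Rightarrow>\<^sub>0 int) set" where
  "relative_push M r s G' k =
     coset_map (grp (Inf_complex M s) k) (infimum_subcomplex (chains M s) G' k) (chain_push M r s)"


section \<open>Critical points\<close>

text \<open>The argument \<open>Q\<close> selects the coefficients: it is \<open>homology_iso\<close> for integer
  coefficients and \<open>homology_iso_over TYPE('f)\<close> for coefficients in the field \<open>'f\<close>.\<close>

definition Cr ::
  "(('c \<Rightarrow>\<^sub>0 int) chain_complex \<Rightarrow> ('c \<Rightarrow>\<^sub>0 int) chain_complex \<Rightarrow>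
      (nat \<Rightarrow> ('c \<Rightarrow>\<^sub>0 int) \<Rightarrow> ('c \<Rightarrow>\<^sub>0 int)) \<Rightarrow> bool) \<Rightarrow>
   'i::{ord, topological_space} set \<Rightarrow> ('i, 'c) pers_hyper \<Rightarrow> 'i set" where
  "Cr Q \<Omega> M = {t\<in>\<Omega>. \<not> (\<exists>U. openin (top_of_set \<Omega>) U \<and> t \<in> U \<and>
     (\<forall>r\<in>U. \<forall>s\<in>U. r \<le> s \<longrightarrow>
        Q (Inf_complex M r) (Inf_complex M s) (\<lambda>k. chain_push M r s)))}"

definition CACr ::
  "(('c \<Rightarrow>\<^sub>0 int) set chain_complex \<Rightarrow> ('c \<Rightarrow>\<^sub>0 int) set chain_complex \<Rightarrow>
      (nat \<Rightarrow> ('c \<Rightarrow>\<^sub>0 int) set \<Rightarrow> ('c \<Rightarrow>\<^sub>0 int) set) \<Rightarrow> bool) \<Rightarrow>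
   'i::{ord, topological_space} set \<Rightarrow> ('i, 'c) pers_hyper \<Rightarrow> 'i set" where
  "CACr Q \<Omega> M = {t\<in>\<Omega>. \<not> (\<exists>U. openin (top_of_set \<Omega>) U \<and> t \<in> U \<and>
     (\<forall>r\<in>U. \<forall>s\<in>U. r \<le> s \<longrightarrow> (\<forall>A. A \<subseteq> edges M r \<longrightarrow>
        (let G = span_of M A; G' = span_of M (trans_map M r s ` A) in
         Q (relative_complex M r G) (relative_complex M s G') (relative_push M r s G')))))}"

definition AACr ::
  "(('c \<Rightarrow>\<^sub>0 int) set chain_complex \<Rightarrow> ('c \<Rightarrow>\<^sub>0 int) set chain_complex \<Rightarrow>
      (nat \<Rightarrow> ('c \<Rightarrow>\<^sub>0 int) set \<Rightarrow> ('c \<Rightarrow>\<^sub>0 int) set) \<Rightarrow> bool) \<Rightarrow>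
   'i::{ord, topological_space} set \<Rightarrow> ('i, 'c) pers_hyper \<Rightarrow> 'i set" where
  "AACr Q \<Omega> M = {t\<in>\<Omega>. \<not> (\<exists>U. openin (top_of_set \<Omega>) U \<and> t \<in> U \<and>
     (\<forall>r\<in>U. \<forall>s\<in>U. r \<le> s \<longrightarrow>
        (\<forall>G. (\<forall>k. subgroup (G k) (graded_span (nverts M) (edges M r) k)) \<longrightarrow>
           (let G' = (\<lambda>k. chain_push M r s ` G k) in
            Q (relative_complex M r G) (relative_complex M s G') (relative_push M r s G')))))}"

text \<open>Critical points of a morphism \<open>f : P(-) \<rightarrow> P'(-)\<close>, where \<open>M'\<close> is the data of \<open>P'(-)\<close>
  and \<open>B t = f(t)(P(t))\<close>.\<close>

definition Cr_morphism ::
  "(('c \<Rightarrow>\<^sub>0 int) set chain_complex \<Rightarrow> ('c \<Rightarrow>\<^sub>0 int) set chain_complex \<Rightarrow>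
      (nat \<Rightarrow> ('c \<Rightarrow>\<^sub>0 int) set \<Rightarrow> ('c \<Rightarrow>\<^sub>0 int) set) \<Rightarrow> bool) \<Rightarrow>
   'i::{ord, topological_space} set \<Rightarrow> ('i, 'c) pers_hyper \<Rightarrow> ('i \<Rightarrow> 'c set) \<Rightarrow> 'i set" where
  "Cr_morphism Q \<Omega> M' B = {t\<in>\<Omega>. \<not> (\<exists>U. openin (top_of_set \<Omega>) U \<and> t \<in> U \<and>
     (\<forall>r\<in>U. \<forall>s\<in>U. r \<le> s \<longrightarrow>
        (let G = span_of M' (B r); G' = span_of M' (B s) in
         Q (relative_complex M' r G) (relative_complex M' s G') (relative_push M' r s G'))))}"

abbreviation "CrH \<equiv> Cr homology_iso"
abbreviation "CACrH \<equiv> CACr homology_iso"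
abbreviation "AACrH \<equiv> AACr homology_iso"
abbreviation "CrH_morphism \<equiv> Cr_morphism homology_iso"

abbreviation "CrHF F \<equiv> Cr (homology_iso_over F)"
abbreviation "CACrHF F \<equiv> CACr (homology_iso_over F)"
abbreviation "AACrHF F \<equiv> AACr (homology_iso_over F)"
abbreviation "CrHF_morphism F \<equiv> Cr_morphism (homology_iso_over F)"

end

theory Submission
  imports Defs
begin

text \<open>
  The point of the proof is that all structure maps are injective on vertices: for hyperdigraphs by
  convention, for hypergraphs because \<open>e(t) \<circ> \<phi>(s,t) = e(s)\<close> is injective. So for \<open>r \<le> s\<close> the chain map
  \<open>\<phi>\<^sub>#\<close> between the chain complexes of \<open>\<Delta>P(r)\<close> and \<open>\<Delta>P(s)\<close> is injective, and it commutes with taking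
  infima: \<open>Inf(\<phi>\<^sub>#(G)) = \<phi>\<^sub>#(Inf(G))\<close> for every graded subgroup \<open>G\<close> (lemma \<open>infimum_image\<close>). Hence there is a
  short exact sequence
  \<open>0 \<rightarrow> Inf(P(r))/Inf(G) \<rightarrow> Inf(P(s))/Inf(\<phi>\<^sub>#(G)) \<rightarrow> K \<rightarrow> 0\<close> with
  \<open>K = Inf(P(s)) / \<phi>\<^sub>#(Inf(P(r)))\<close>, where the cokernel \<open>K\<close> is the same for all \<open>G\<close>
  (lemma \<open>short_exact_quotients\<close>). An injective chain map is a homology isomorphism iff its cokernel is
  acyclic (lemma \<open>homology_iso_iff_acyclic_cokernel\<close>). So each of the three regularity conditions on
  \<open>r \<le> s\<close> just says that \<open>K\<close> is acyclic, and the three sets of critical points are equal.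

  Field coefficients work in the same way because \<open>K\<close> is torsion-free: \<open>\<phi>\<^sub>#(Inf(P(r)))\<close> consists of the
  chains that are supported on \<open>\<phi>(P(r))\<close> together with their boundaries, and a chain has the same
  support as its nonzero multiples. Tensoring with a field preserves short exact sequences with
  torsion-free quotient (lemma \<open>short_exact_tensor\<close>), even when the other two terms have torsion, as
  they may for an arbitrary graded subgroup \<open>G\<close>. So regularity over the field says that \<open>K \<otimes> F\<close> is
  acyclic, which follows if \<open>K\<close> is acyclic (lemma \<open>acyclic_tensor\<close>). The fact about abelian groups on
  which this rests, that an injection with torsion-free cokernel stays injective, is proved in lemma
  \<open>tensor_map_inj\<close> by constructing a retraction with the help of Zorn's lemma.

  For a morphism \<open>f\<close> the injective chain maps \<open>f(t)\<^sub>#\<close> give short exact sequences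
  \<open>0 \<rightarrow> Inf(P(t)) \<rightarrow> Inf(P'(t)) \<rightarrow> Inf(P'(t))/Inf(f(t)(P(t))) \<rightarrow> 0\<close>, natural in \<open>t\<close> and with torsion-free
  quotient, and the inclusions for \<open>f\<close> follow from the five lemma, over the integers and over the field.
  A morphism of hypergraphs need not respect the orders of the vertices, so \<open>f(t)\<^sub>#\<close> multiplies a simplex
  by the sign of the permutation by which its vertices are reordered (lemma \<open>ordered_boundary_image\<close>).
\<close>

section \<open>Quotients of abelian groups\<close>

lemma (in comm_group) FactGroup_carrierE:
  assumes "X \<in> carrier (G Mod N)"
  obtains x where "x \<in> carrier G" "X = N #> x"
  using assms by (auto simp: carrier_FactGroup)

lemma (in comm_group) FactGroup_carrierI:
  "x \<in> carrier G \<Longrightarrow> N #> x \<in> carrier (G Mod N)"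
  by (auto simp: carrier_FactGroup)

lemma (in comm_group) FactGroup_mult:
  assumes "subgroup N G" "x \<in> carrier G" "y \<in> carrier G"
  shows "(N #> x) \<otimes>\<^bsub>G Mod N\<^esub> (N #> y) = N #> (x \<otimes> y)"
  using normal.rcos_sum[OF subgroup_imp_normal[OF assms(1)] assms(2,3)] by simp

lemma (in comm_group) FactGroup_coset_hom:
  "subgroup N G \<Longrightarrow> (\<lambda>x. N #> x) \<in> hom G (G Mod N)"
  using normal.r_coset_hom_Mod[OF subgroup_imp_normal] .

lemma (in comm_group) coset_eq_subgroup_iff:
  assumes "subgroup N G" "x \<in> carrier G"
  shows "N #> x = N \<longleftrightarrow> x \<in> N"
  using coset_join1[OF _ _ assms(1)] coset_join2[OF _ assms(1)] assms(2) by blast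

lemma (in comm_group) coset_eq_iff:
  assumes "subgroup N G" "x \<in> carrier G" "y \<in> carrier G"
  shows "N #> x = N #> y \<longleftrightarrow> x \<otimes> inv y \<in> N"
  using subgroup.rcos_module[OF assms(1) is_group assms(3,2)]
    repr_independence[OF _ assms(3,1)] rcos_self[OF assms(2,1)] by metis

lemma coset_map_coset:
  assumes "comm_group G" "comm_group H" "h \<in> hom G H" "subgroup N G" "subgroup N' H"
    "h ` N \<subseteq> N'" "x \<in> carrier G"
  shows "coset_map H N' h (N #>\<^bsub>G\<^esub> x) = N' #>\<^bsub>H\<^esub> h x"
proof -
  interpret G: comm_group G by fact
  interpret H: comm_group H by fact
  interpret N: subgroup N G by fact
  have "N' #>\<^bsub>H\<^esub> h y = N' #>\<^bsub>H\<^esub> h x" if y: "y \<in> N #>\<^bsub>G\<^esub> x" for y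
  proof -
    obtain n where n: "n \<in> N" "y = n \<otimes>\<^bsub>G\<^esub> x"
      using y by (auto simp: r_coset_def)
    have hn: "h n \<in> N'" "h n \<in> carrier H" "h x \<in> carrier H"
      using n assms N.subset by (auto intro: hom_in_carrier[OF assms(3)])
    have "h y = h n \<otimes>\<^bsub>H\<^esub> h x"
      using n assms N.subset by (auto simp: hom_mult[OF assms(3)])
    then have "N' #>\<^bsub>H\<^esub> h y = (N' #>\<^bsub>H\<^esub> h n) #>\<^bsub>H\<^esub> h x"
      using hn H.coset_mult_assoc[OF subgroup.subset[OF assms(5)]] by simp
    then show ?thesis
      using H.coset_join2[OF hn(2) assms(5) hn(1)] by simp
  qed
  then show ?thesis
    using G.rcos_self[OF assms(7,4)] unfolding coset_map_def by blast
qed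

lemma coset_map_hom:
  assumes "comm_group G" "comm_group H" "h \<in> hom G H" "subgroup N G" "subgroup N' H"
    "h ` N \<subseteq> N'"
  shows "coset_map H N' h \<in> hom (G Mod N) (H Mod N')"
proof (rule homI)
  interpret G: comm_group G by fact
  interpret H: comm_group H by fact
  note [simp] = coset_map_coset[OF assms]
  fix X assume X: "X \<in> carrier (G Mod N)"
  then obtain x where x: "x \<in> carrier G" "X = N #>\<^bsub>G\<^esub> x" by (rule G.FactGroup_carrierE)
  then show "coset_map H N' h X \<in> carrier (H Mod N')"
    by (simp add: H.FactGroup_carrierI hom_in_carrier[OF assms(3)])
  fix Y assume Y: "Y \<in> carrier (G Mod N)"
  then obtain y where y: "y \<in> carrier G" "Y = N #>\<^bsub>G\<^esub> y" by (rule G.FactGroup_carrierE)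
  show "coset_map H N' h (X \<otimes>\<^bsub>G Mod N\<^esub> Y) = coset_map H N' h X \<otimes>\<^bsub>H Mod N'\<^esub> coset_map H N' h Y"
    using x y by (simp only: G.FactGroup_mult[OF assms(4)])
      (simp add: H.FactGroup_mult[OF assms(5)] hom_in_carrier[OF assms(3)] hom_mult[OF assms(3)]
        del: mult_FactGroup)
qed

section \<open>The tensor product of an abelian group with a field\<close>

type_synonym ('c, 'f) tensor = "('c \<times> 'f \<Rightarrow>\<^sub>0 int) set"

text \<open>The elementary tensor \<open>a \<otimes> x\<close>. Apart from the basic facts proved in this section, the
  tensor product is used only through these generators and its universal property.\<close>

definition tens :: "'c monoid \<Rightarrow> 'c \<Rightarrow> 'f::field \<Rightarrow> ('c, 'f) tensor" where
  "tens A a x = tensor_relations A #>\<^bsub>tensor_free A\<^esub> frag_of (a, x)"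

lemma comm_group_tensor_free: "comm_group (tensor_free A)"
  by (simp add: tensor_free_def abelian_free_Abelian_group)

lemma keys_diff3:
  "Poly_Mapping.keys a \<subseteq> S \<Longrightarrow> Poly_Mapping.keys b \<subseteq> S \<Longrightarrow> Poly_Mapping.keys c \<subseteq> S \<Longrightarrow>
   Poly_Mapping.keys (a - b - c) \<subseteq> S"
  by (meson Un_least keys_diff order_trans)

lemma subgroup_tensor_relations:
  assumes "comm_group (A :: 'c monoid)"
  shows "subgroup (tensor_relations A :: ('c, 'f::field) tensor) (tensor_free A)"
proof -
  interpret A: comm_group A by fact
  show ?thesis
    unfolding tensor_relations_def
  proof (rule group.generate_is_subgroup[OF comm_group.axioms(2)[OF comm_group_tensor_free]], rule Un_least)
    show "{frag_of (a \<otimes>\<^bsub>A\<^esub> b, x) - frag_of (a, x) - frag_of (b, x) |a b x.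
      a \<in> carrier A \<and> b \<in> carrier A} \<subseteq> carrier (tensor_free A :: ('c \<times> 'f \<Rightarrow>\<^sub>0 int) monoid)"
      by (safe; simp add: tensor_free_def keys_diff3)
    show "{frag_of (a, x + y) - frag_of (a, x) - frag_of (a, y) |a x y. a \<in> carrier A}
       \<subseteq> carrier (tensor_free A :: ('c \<times> 'f \<Rightarrow>\<^sub>0 int) monoid)"
      by (safe; simp add: tensor_free_def keys_diff3)
  qed
qed

lemma comm_group_tensor_group:
  assumes "comm_group A" shows "comm_group (tensor_group A :: ('c, 'f::field) tensor monoid)"
  unfolding tensor_group_def
  by (rule comm_group.abelian_FactGroup[OF comm_group_tensor_free subgroup_tensor_relations[OF assms]])

lemma
  shows tensor_relator_left: "a \<in> carrier A \<Longrightarrow> b \<in> carrier A \<Longrightarrow>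
      frag_of (a \<otimes>\<^bsub>A\<^esub> b, x) - frag_of (a, x) - frag_of (b, x) \<in> tensor_relations A"
    and tensor_relator_right: "a \<in> carrier A \<Longrightarrow>
      frag_of (a, x + y) - frag_of (a, x) - frag_of (a, y) \<in> tensor_relations A"
  unfolding tensor_relations_def by (rule generate.incl, blast)+

lemma tens_closed:
  assumes "a \<in> carrier A" shows "tens A a x \<in> carrier (tensor_group A)"
  unfolding tens_def tensor_group_def
  by (rule comm_group.FactGroup_carrierI[OF comm_group_tensor_free])
    (use assms in \<open>simp add: tensor_free_def\<close>)

lemma tens_mult_left:
  fixes A :: "'c monoid" and x :: "'f::field"
  assumes "comm_group A" "a \<in> carrier A" "b \<in> carrier A"
  shows "tens A (a \<otimes>\<^bsub>A\<^esub> b) x = tens A a x \<otimes>\<^bsub>tensor_group A\<^esub> tens A b x"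
proof -
  interpret A: comm_group A by fact
  interpret F: comm_group "tensor_free A :: ('c \<times> 'f \<Rightarrow>\<^sub>0 int) monoid" by (rule comm_group_tensor_free)
  note S = subgroup_tensor_relations[OF assms(1)]
  have c: "frag_of (a,x) \<in> carrier (tensor_free A)" "frag_of (b,x) \<in> carrier (tensor_free A)"
    "frag_of (a \<otimes>\<^bsub>A\<^esub> b,x) \<in> carrier (tensor_free A)" "frag_of (a,x) + frag_of (b,x) \<in> carrier (tensor_free A)"
    using assms by (auto simp: tensor_free_def dest!: subsetD[OF keys_add])
  have "frag_of (a \<otimes>\<^bsub>A\<^esub> b,x) \<otimes>\<^bsub>tensor_free A\<^esub> inv\<^bsub>tensor_free A\<^esub> (frag_of (a,x) + frag_of (b,x)) \<in> tensor_relations A"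
    using c(4) tensor_relator_left[of a A b x] assms by (simp add: tensor_free_def algebra_simps)
  then have "tensor_relations A #>\<^bsub>tensor_free A\<^esub> frag_of (a \<otimes>\<^bsub>A\<^esub> b,x)
     = tensor_relations A #>\<^bsub>tensor_free A\<^esub> (frag_of (a,x) \<otimes>\<^bsub>tensor_free A\<^esub> frag_of (b,x))"
    using F.coset_eq_iff[OF S c(3,4)] by (simp add: tensor_free_def)
  then show ?thesis
    unfolding tens_def tensor_group_def using F.FactGroup_mult[OF S c(1,2)] by simp
qed

lemma tens_add_right:
  fixes A :: "'c monoid" and x :: "'f::field"
  assumes "comm_group A" "a \<in> carrier A"
  shows "tens A a (x + y) = tens A a x \<otimes>\<^bsub>tensor_group A\<^esub> tens A a y"
proof -
  interpret A: comm_group A by fact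
  interpret F: comm_group "tensor_free A :: ('c \<times> 'f \<Rightarrow>\<^sub>0 int) monoid" by (rule comm_group_tensor_free)
  note S = subgroup_tensor_relations[OF assms(1)]
  have c: "frag_of (a,x) \<in> carrier (tensor_free A)" "frag_of (a,y) \<in> carrier (tensor_free A)"
    "frag_of (a,x+y) \<in> carrier (tensor_free A)" "frag_of (a,x) + frag_of (a,y) \<in> carrier (tensor_free A)"
    using assms by (auto simp: tensor_free_def dest!: subsetD[OF keys_add])
  have "frag_of (a,x+y) \<otimes>\<^bsub>tensor_free A\<^esub> inv\<^bsub>tensor_free A\<^esub> (frag_of (a,x) + frag_of (a,y)) \<in> tensor_relations A"
    using c(4) tensor_relator_right[of a A x y] assms by (simp add: tensor_free_def algebra_simps)
  then have "tensor_relations A #>\<^bsub>tensor_free A\<^esub> frag_of (a,x+y)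
     = tensor_relations A #>\<^bsub>tensor_free A\<^esub> (frag_of (a,x) \<otimes>\<^bsub>tensor_free A\<^esub> frag_of (a,y))"
    using F.coset_eq_iff[OF S c(3,4)] by (simp add: tensor_free_def)
  then show ?thesis
    unfolding tens_def tensor_group_def using F.FactGroup_mult[OF S c(1,2)] by simp
qed

lemma tens_hom_left:
  assumes "comm_group A"
  shows "(\<lambda>a. tens A a x) \<in> hom A (tensor_group A)"
  by (rule homI) (simp_all add: tens_closed tens_mult_left[OF assms])

text \<open>Integers can be moved across the tensor sign; the left-hand version is
  \<open>tens_int_pow\<close> below. This is how the characteristic of the field enters: if \<open>of_int m = 0\<close> in the
  field, then every \<open>a\<^sup>m \<otimes> x\<close> vanishes.\<close>

lemma tens_of_int_mult_right:
  fixes A :: "'c monoid" and x :: "'f::field"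
  assumes "comm_group A" "a \<in> carrier A"
  shows "tens A a (of_int m * x) = tens A a x [^]\<^bsub>tensor_group A\<^esub> m"
proof -
  interpret T: comm_group "tensor_group A :: ('c, 'f) tensor monoid"
    by (rule comm_group_tensor_group[OF assms(1)])
  note c = tens_closed[OF assms(2)]
  have z: "tens A a (0::'f) = \<one>\<^bsub>tensor_group A\<^esub>"
    using tens_add_right[OF assms, of "0::'f" 0] T.r_cancel_one[OF c c, of "0::'f" 0] by simp
  have n: "tens A a (of_nat k * x) = tens A a x [^]\<^bsub>tensor_group A\<^esub> k" for k :: nat
  proof (induction k)
    case 0 show ?case using z by simp
  next
    case (Suc k)
    have "tens A a (of_nat (Suc k) * x) = tens A a (of_nat k * x + x)"
      by (simp add: distrib_right add.commute)
    then show ?case by (simp add: tens_add_right[OF assms] Suc)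
  qed
  have i: "tens A a (- y) = inv\<^bsub>tensor_group A\<^esub> tens A a y" for y :: 'f
    by (rule T.inv_equality[symmetric]) (use tens_add_right[OF assms, of "-y" y] z c in simp_all)
  show ?thesis
  proof (cases m)
    case (nonneg k) then show ?thesis using n[of k] by (simp add: int_pow_int)
  next
    case (neg k)
    have "tens A a (of_int m * x) = inv\<^bsub>tensor_group A\<^esub> tens A a (of_nat (Suc k) * x)"
      unfolding neg i[symmetric] by (simp add: algebra_simps)
    also have "\<dots> = tens A a x [^]\<^bsub>tensor_group A\<^esub> m"
      unfolding neg n by (simp only: T.int_pow_neg[OF c] int_pow_int)
    finally show ?thesis .
  qed
qed

lemma tens_int_pow:
  fixes A :: "'c monoid" and x :: "'f::field"
  assumes "comm_group A" "a \<in> carrier A"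
  shows "tens A (a [^]\<^bsub>A\<^esub> (m::int)) x = tens A a (of_int m * x)"
  unfolding tens_of_int_mult_right[OF assms]
  by (rule hom_int_pow[OF tens_hom_left[OF assms(1)] assms(2) comm_group.axioms(2)[OF assms(1)]
     comm_group.axioms(2)[OF comm_group_tensor_group[OF assms(1)]]])

text \<open>The elementary tensors generate the tensor product, so they determine a homomorphism. Most
  identities between maps of tensor products are checked in this way.\<close>

lemma tensor_group_hom_eqI:
  fixes A :: "'c monoid"
  assumes "comm_group A" "comm_group V"
    and g: "g \<in> hom (tensor_group A :: ('c, 'f::field) tensor monoid) V"
    and h: "h \<in> hom (tensor_group A) V"
    and eq: "\<And>a x. a \<in> carrier A \<Longrightarrow> g (tens A a x) = h (tens A a x)"
    and u: "u \<in> carrier (tensor_group A)"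
  shows "g u = h u"
proof -
  interpret F: comm_group "tensor_free A :: ('c \<times> 'f \<Rightarrow>\<^sub>0 int) monoid" by (rule comm_group_tensor_free)
  interpret V: comm_group V by fact
  note S = subgroup_tensor_relations[OF assms(1)]
  let ?q = "\<lambda>x :: 'c \<times> 'f \<Rightarrow>\<^sub>0 int. tensor_relations A #>\<^bsub>tensor_free A\<^esub> x"
  obtain y where y: "y \<in> carrier (tensor_free A)" "u = ?q y"
    using u unfolding tensor_group_def by (rule F.FactGroup_carrierE)
  have q: "?q \<in> hom (tensor_free A) (tensor_group A)"
    unfolding tensor_group_def by (rule F.FactGroup_coset_hom[OF S])
  interpret gq: group_hom "tensor_free A" V "g \<circ> ?q"
    by unfold_locales (rule hom_compose[OF q g])
  interpret hq: group_hom "tensor_free A" V "h \<circ> ?q"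
    by unfold_locales (rule hom_compose[OF q h])
  have "Poly_Mapping.keys y \<subseteq> carrier A \<times> UNIV"
    using y by (simp add: tensor_free_def)
  then have "(g \<circ> ?q) y = (h \<circ> ?q) y"
  proof (rule free_Abelian_group_induct)
    show "(g \<circ> ?q) 0 = (h \<circ> ?q) 0" using gq.hom_one hq.hom_one unfolding tensor_free_def by simp
  next
    fix x y :: "'c \<times> 'f \<Rightarrow>\<^sub>0 int"
    assume xy: "Poly_Mapping.keys x \<subseteq> carrier A \<times> UNIV" "Poly_Mapping.keys y \<subseteq> carrier A \<times> UNIV"
      and IH: "(g \<circ> ?q) x = (h \<circ> ?q) x" "(g \<circ> ?q) y = (h \<circ> ?q) y"
    then have c: "x \<in> carrier (tensor_free A)" "y \<in> carrier (tensor_free A)"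
      "x - y = x \<otimes>\<^bsub>tensor_free A\<^esub> inv\<^bsub>tensor_free A\<^esub> y"
      by (simp_all add: tensor_free_def)
    show "(g \<circ> ?q) (x - y) = (h \<circ> ?q) (x - y)"
      unfolding c(3) gq.hom_mult[OF c(1) F.inv_closed[OF c(2)]] hq.hom_mult[OF c(1) F.inv_closed[OF c(2)]]
        gq.hom_inv[OF c(2)] hq.hom_inv[OF c(2)] IH ..
  next
    fix p assume "p \<in> carrier A \<times> (UNIV :: 'f set)"
    then show "(g \<circ> ?q) (frag_of p) = (h \<circ> ?q) (frag_of p)"
      using eq[of "fst p" "snd p"] by (auto simp: tens_def)
  qed
  then show ?thesis using y by simp
qed

lemma tensor_group_universal:
  fixes \<beta> :: "'c \<Rightarrow> 'f::field \<Rightarrow> 'v"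
  assumes "comm_group A" "comm_group V"
    and c: "\<And>a x. a \<in> carrier A \<Longrightarrow> \<beta> a x \<in> carrier V"
    and l: "\<And>a b x. a \<in> carrier A \<Longrightarrow> b \<in> carrier A \<Longrightarrow> \<beta> (a \<otimes>\<^bsub>A\<^esub> b) x = \<beta> a x \<otimes>\<^bsub>V\<^esub> \<beta> b x"
    and r: "\<And>a x y. a \<in> carrier A \<Longrightarrow> \<beta> a (x + y) = \<beta> a x \<otimes>\<^bsub>V\<^esub> \<beta> a y"
  obtains g where "g \<in> hom (tensor_group A) V" "\<And>a x. a \<in> carrier A \<Longrightarrow> g (tens A a x) = \<beta> a x"
proof -
  interpret A: comm_group A by fact
  interpret F: comm_group "tensor_free A :: ('c \<times> 'f \<Rightarrow>\<^sub>0 int) monoid" by (rule comm_group_tensor_free)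
  interpret V: comm_group V by fact
  note S = subgroup_tensor_relations[OF assms(1)]
  obtain h where h: "h \<in> hom (free_Abelian_group (carrier A \<times> UNIV)) V"
    and hb: "\<And>z. z \<in> carrier A \<times> (UNIV::'f set) \<Longrightarrow> h (frag_of z) = (\<lambda>(a,x). \<beta> a x) z"
    by (rule V.free_Abelian_group_universal[of "\<lambda>(a,x). \<beta> a x" "carrier A \<times> UNIV"]) (auto simp: c)
  have h: "h \<in> hom (tensor_free A) V" using h by (simp add: tensor_free_def)
  interpret h: group_hom "tensor_free A" V h by unfold_locales (rule h)
  have d: "h (u - v - w) = h u \<otimes>\<^bsub>V\<^esub> inv\<^bsub>V\<^esub> h v \<otimes>\<^bsub>V\<^esub> inv\<^bsub>V\<^esub> h w"
    if "u \<in> carrier (tensor_free A)" "v \<in> carrier (tensor_free A)" "w \<in> carrier (tensor_free A)" for u v w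
  proof -
    have "u - v - w = u \<otimes>\<^bsub>tensor_free A\<^esub> inv\<^bsub>tensor_free A\<^esub> v \<otimes>\<^bsub>tensor_free A\<^esub> inv\<^bsub>tensor_free A\<^esub> w"
      using that by (simp add: tensor_free_def)
    then show ?thesis using that by simp
  qed
  have cancel: "(p \<otimes>\<^bsub>V\<^esub> q) \<otimes>\<^bsub>V\<^esub> inv\<^bsub>V\<^esub> p \<otimes>\<^bsub>V\<^esub> inv\<^bsub>V\<^esub> q = \<one>\<^bsub>V\<^esub>" if "p \<in> carrier V" "q \<in> carrier V" for p q
    using that by (metis V.inv_closed V.m_assoc V.m_comm V.r_inv V.r_one V.m_closed)
  have fc: "frag_of (a, x) \<in> carrier (tensor_free A)" if "a \<in> carrier A" for a and x :: 'f
    using that by (simp add: tensor_free_def)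
  have rel: "tensor_relations A \<subseteq> kernel (tensor_free A) V h"
    unfolding tensor_relations_def
  proof (rule F.generate_subgroup_incl[OF _ h.subgroup_kernel], rule Un_least)
    show "{frag_of (a \<otimes>\<^bsub>A\<^esub> b, x) - frag_of (a, x) - frag_of (b, x) |a b x.
      a \<in> carrier A \<and> b \<in> carrier A} \<subseteq> kernel (tensor_free A) V h"
      by (safe; simp add: kernel_def fc d hb l c cancel; simp add: tensor_free_def keys_diff3)
    show "{frag_of (a, x + y) - frag_of (a, x) - frag_of (a, y) |a x y. a \<in> carrier A}
       \<subseteq> kernel (tensor_free A) V h"
      by (safe; simp add: kernel_def fc d hb r c cancel; simp add: tensor_free_def keys_diff3)
  qed
  obtain g where g: "g \<in> hom (tensor_free A Mod tensor_relations A) V"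
    and gh: "\<And>x. x \<in> carrier (tensor_free A) \<Longrightarrow> g (tensor_relations A #>\<^bsub>tensor_free A\<^esub> x) = h x"
  proof (rule FactGroup_universal[OF h F.subgroup_imp_normal[OF S]])
    fix x y :: "'c \<times> 'f \<Rightarrow>\<^sub>0 int"
    assume xy: "x \<in> carrier (tensor_free A)" "y \<in> carrier (tensor_free A)"
      "tensor_relations A #>\<^bsub>tensor_free A\<^esub> x = tensor_relations A #>\<^bsub>tensor_free A\<^esub> y"
    then have "h (x \<otimes>\<^bsub>tensor_free A\<^esub> inv\<^bsub>tensor_free A\<^esub> y) = \<one>\<^bsub>V\<^esub>"
      using F.coset_eq_iff[OF S xy(1,2)] rel by (auto simp: kernel_def)
    then have "h x \<otimes>\<^bsub>V\<^esub> inv\<^bsub>V\<^esub> h y = \<one>\<^bsub>V\<^esub>" using xy by simp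
    then show "h x = h y" using xy by (metis h.hom_closed V.inv_closed V.inv_equality V.inv_inv)
  qed auto
  show ?thesis
    by (rule that[of g]) (use g gh fc hb in \<open>auto simp: tensor_group_def tens_def\<close>)
qed

lemma
  fixes h :: "'c \<Rightarrow> 'd"
  assumes "comm_group A" "comm_group B" "h \<in> hom A B"
  shows tensor_map_hom: "tensor_map B h \<in> hom (tensor_group A :: ('c, 'f::field) tensor monoid) (tensor_group B)"
    and tensor_map_tens: "a \<in> carrier A \<Longrightarrow> tensor_map B h (tens A a (x::'f)) = tens B (h a) x"
proof -
  interpret A: comm_group A by fact
  interpret B: comm_group B by fact
  interpret FA: comm_group "tensor_free A :: ('c \<times> 'f \<Rightarrow>\<^sub>0 int) monoid" by (rule comm_group_tensor_free)
  interpret FB: comm_group "tensor_free B :: ('d \<times> 'f \<Rightarrow>\<^sub>0 int) monoid" by (rule comm_group_tensor_free)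
  let ?e = "frag_extend (\<lambda>(a, x). frag_of (h a, x)) :: ('c \<times> 'f \<Rightarrow>\<^sub>0 int) \<Rightarrow> _"
  have hc: "h a \<in> carrier B" if "a \<in> carrier A" for a using assms(3) that by (auto simp: hom_def)
  have e: "?e \<in> hom (tensor_free A) (tensor_free B)"
  proof (rule homI)
    fix u :: "'c \<times> 'f \<Rightarrow>\<^sub>0 int" assume u: "u \<in> carrier (tensor_free A)"
    have "Poly_Mapping.keys (?e u) \<subseteq> (\<Union>p\<in>Poly_Mapping.keys u. Poly_Mapping.keys (case p of (a, x) \<Rightarrow> frag_of (h a, x)))"
      by (rule keys_frag_extend)
    also have "\<dots> \<subseteq> carrier B \<times> UNIV"
    proof (rule UN_least)
      fix p assume "p \<in> Poly_Mapping.keys u"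
      then have "fst p \<in> carrier A" using u by (auto simp: tensor_free_def)
      then show "Poly_Mapping.keys (case p of (a, x) \<Rightarrow> frag_of (h a, x)) \<subseteq> carrier B \<times> UNIV"
        using hc by (cases p) simp
    qed
    finally show "?e u \<in> carrier (tensor_free B)" by (simp add: tensor_free_def)
  qed (simp add: tensor_free_def frag_extend_add)
  interpret e: group_hom "tensor_free A" "tensor_free B" ?e by unfold_locales (rule e)
  note SA = subgroup_tensor_relations[OF assms(1)] and SB = subgroup_tensor_relations[OF assms(2)]
  have "tensor_relations A \<subseteq> {u \<in> carrier (tensor_free A). ?e u \<in> tensor_relations B}"
    unfolding tensor_relations_def[of A]
  proof (rule FA.generate_subgroup_incl)
    show "subgroup {u \<in> carrier (tensor_free A). ?e u \<in> tensor_relations B} (tensor_free A)"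
    proof (rule FA.subgroupI)
      show "{u \<in> carrier (tensor_free A). ?e u \<in> tensor_relations B} \<noteq> {}"
        using subgroup.one_closed[OF SB] e.hom_one FA.one_closed by (metis (mono_tags, lifting) empty_iff mem_Collect_eq)
    qed (use subgroup.m_inv_closed[OF SB] subgroup.m_closed[OF SB] e.hom_inv e.hom_mult in auto)
    show "{frag_of (a \<otimes>\<^bsub>A\<^esub> b, x) - frag_of (a, x) - frag_of (b, x) |a b x. a \<in> carrier A \<and> b \<in> carrier A} \<union>
      {frag_of (a, x + y) - frag_of (a, x) - frag_of (a, y) |a x y. a \<in> carrier A}
      \<subseteq> {u \<in> carrier (tensor_free A). ?e u \<in> tensor_relations B}"
    proof (rule Un_least; clarify; intro conjI)
      fix a b x assume ab: "a \<in> carrier A" "b \<in> carrier A"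
      then show "frag_of (a \<otimes>\<^bsub>A\<^esub> b, x :: 'f) - frag_of (a, x) - frag_of (b, x) \<in> carrier (tensor_free A)"
        by (simp add: tensor_free_def keys_diff3)
      show "?e (frag_of (a \<otimes>\<^bsub>A\<^esub> b, x) - frag_of (a, x) - frag_of (b, x)) \<in> tensor_relations B"
        using ab hc by (simp add: frag_extend_diff hom_mult[OF assms(3)] tensor_relator_left)
    next
      fix a x y assume ab: "a \<in> carrier A"
      then show "frag_of (a, x + y :: 'f) - frag_of (a, x) - frag_of (a, y) \<in> carrier (tensor_free A)"
        by (simp add: tensor_free_def keys_diff3)
      show "?e (frag_of (a, x + y) - frag_of (a, x) - frag_of (a, y)) \<in> tensor_relations B"
        using ab hc by (simp add: frag_extend_diff tensor_relator_right)
    qed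
  qed
  then have rel: "?e ` tensor_relations A \<subseteq> tensor_relations B" by auto
  show "tensor_map B h \<in> hom (tensor_group A :: ('c, 'f) tensor monoid) (tensor_group B)"
    unfolding tensor_map_def tensor_group_def
    by (rule coset_map_hom[OF comm_group_tensor_free comm_group_tensor_free e SA SB rel])
  show "tensor_map B h (tens A a (x::'f)) = tens B (h a) x" if "a \<in> carrier A"
    unfolding tensor_map_def tens_def
    by (subst coset_map_coset[OF comm_group_tensor_free comm_group_tensor_free e SA SB rel])
      (use that in \<open>auto simp: tensor_free_def\<close>)
qed

lemma tensor_map_comp:
  fixes A :: "'c monoid"
  assumes "comm_group A" "comm_group B" "comm_group C" "h \<in> hom A B" "g \<in> hom B C"
    and "k \<in> hom A C" "\<And>a. a \<in> carrier A \<Longrightarrow> g (h a) = k a"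
    and u: "u \<in> carrier (tensor_group A :: ('c, 'f::field) tensor monoid)"
  shows "tensor_map C g (tensor_map B h u) = tensor_map C k u"
proof -
  have "tensor_map C g \<circ> tensor_map B h \<in> hom (tensor_group A :: ('c, 'f) tensor monoid) (tensor_group C)"
    using assms by (intro hom_compose[of _ _ "tensor_group B"] tensor_map_hom)
  then have "(tensor_map C g \<circ> tensor_map B h) u = tensor_map C k u"
    by (rule tensor_group_hom_eqI[OF assms(1) comm_group_tensor_group[OF assms(3)] _ _ _ u])
      (use assms in \<open>auto simp: tensor_map_tens hom_in_carrier[OF assms(4)] intro!: tensor_map_hom\<close>)
  then show ?thesis by simp
qed

section \<open>Exactness properties of the tensor product\<close>

text \<open>Right exactness. Let \<open>W\<close> be the image of \<open>A \<otimes> F\<close> in \<open>B \<otimes> F\<close>. A set-theoretic section \<open>s\<close>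
  of \<open>g\<close> gives the map \<open>d \<otimes> x \<mapsto> s d \<otimes> x\<close> from \<open>D \<otimes> F\<close> to \<open>(B \<otimes> F) / W\<close>: it is biadditive because the
  failure of \<open>s\<close> to be additive lies in the kernel of \<open>g\<close>, that is, in the image of \<open>h\<close>. Its composition
  with \<open>g \<otimes> id\<close> is the quotient map, so the kernel of \<open>g \<otimes> id\<close> is contained in \<open>W\<close>.\<close>

lemma tensor_right_exact:
  fixes u :: "('b, 'f::field) tensor"
  assumes A: "comm_group A" and B: "comm_group B" and D: "comm_group D"
    and h: "h \<in> hom A B" and g: "g \<in> hom B D"
    and surj: "carrier D \<subseteq> g ` carrier B"
    and ker: "\<And>b. b \<in> carrier B \<Longrightarrow> g b = \<one>\<^bsub>D\<^esub> \<Longrightarrow> b \<in> h ` carrier A"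
    and u: "u \<in> carrier (tensor_group B)" "tensor_map D g u = \<one>\<^bsub>tensor_group D\<^esub>"
  shows "u \<in> tensor_map B h ` carrier (tensor_group A)"
proof -
  interpret A: comm_group A by fact
  interpret B: comm_group B by fact
  interpret D: comm_group D by fact
  interpret TB: comm_group "tensor_group B :: ('b, 'f) tensor monoid" by (rule comm_group_tensor_group[OF B])
  interpret TA: comm_group "tensor_group A :: ('a, 'f) tensor monoid" by (rule comm_group_tensor_group[OF A])
  interpret TD: comm_group "tensor_group D :: ('c, 'f) tensor monoid" by (rule comm_group_tensor_group[OF D])
  interpret g: group_hom B D g by unfold_locales (rule g)
  interpret Th: group_hom "tensor_group A :: ('a, 'f) tensor monoid" "tensor_group B" "tensor_map B h"
    by unfold_locales (rule tensor_map_hom[OF A B h])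
  define W where "W = tensor_map B h ` carrier (tensor_group A :: ('a, 'f) tensor monoid)"
  have W: "subgroup W (tensor_group B)" unfolding W_def by (rule Th.img_is_subgroup)
  have V: "comm_group (tensor_group B Mod W)" by (rule TB.abelian_FactGroup[OF W])
  have same: "W #>\<^bsub>tensor_group B\<^esub> tens B b x = W #>\<^bsub>tensor_group B\<^esub> tens B b' x"
    if b: "b \<in> carrier B" "b' \<in> carrier B" "g b = g b'" for b b' and x :: 'f
  proof -
    have "g (b \<otimes>\<^bsub>B\<^esub> inv\<^bsub>B\<^esub> b') = \<one>\<^bsub>D\<^esub>" using b by simp
    then obtain a where a: "a \<in> carrier A" "b \<otimes>\<^bsub>B\<^esub> inv\<^bsub>B\<^esub> b' = h a"
      using ker[of "b \<otimes>\<^bsub>B\<^esub> inv\<^bsub>B\<^esub> b'"] b by auto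
    interpret tx: group_hom B "tensor_group B" "\<lambda>b. tens B b x"
      by unfold_locales (rule tens_hom_left[OF B])
    have "tens B (b \<otimes>\<^bsub>B\<^esub> inv\<^bsub>B\<^esub> b') x = tensor_map B h (tens A a x)"
      using a by (simp add: tensor_map_tens[OF A B h])
    then have "tens B b x \<otimes>\<^bsub>tensor_group B\<^esub> inv\<^bsub>tensor_group B\<^esub> tens B b' x \<in> W"
      unfolding W_def using b a(1) by (auto simp: tens_closed)
    then show ?thesis by (simp add: TB.coset_eq_iff[OF W] tens_closed b)
  qed
  define s where "s = inv_into (carrier B) g"
  have s: "s d \<in> carrier B" "g (s d) = d" if "d \<in> carrier D" for d
    using that surj by (auto simp: s_def inv_into_into f_inv_into_f subset_iff)
  obtain \<psi> where \<psi>: "\<psi> \<in> hom (tensor_group D) (tensor_group B Mod W)"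
    and \<psi>t: "\<And>d x. d \<in> carrier D \<Longrightarrow> \<psi> (tens D d x) = W #>\<^bsub>tensor_group B\<^esub> tens B (s d) x"
  proof (rule tensor_group_universal[OF D V, of "\<lambda>d x. W #>\<^bsub>tensor_group B\<^esub> tens B (s d) x"])
    fix d x assume "d \<in> carrier D"
    then show "W #>\<^bsub>tensor_group B\<^esub> tens B (s d) x \<in> carrier (tensor_group B Mod W)"
      by (simp add: TB.FactGroup_carrierI tens_closed s)
  next
    fix d d' x assume d: "d \<in> carrier D" "d' \<in> carrier D"
    have "W #>\<^bsub>tensor_group B\<^esub> tens B (s (d \<otimes>\<^bsub>D\<^esub> d')) x
       = W #>\<^bsub>tensor_group B\<^esub> tens B (s d \<otimes>\<^bsub>B\<^esub> s d') x"
      by (rule same) (use d s in auto)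
    also have "\<dots> = W #>\<^bsub>tensor_group B\<^esub> (tens B (s d) x \<otimes>\<^bsub>tensor_group B\<^esub> tens B (s d') x)"
      using d s by (simp add: tens_mult_left[OF B])
    also have "\<dots> = (W #>\<^bsub>tensor_group B\<^esub> tens B (s d) x) \<otimes>\<^bsub>tensor_group B Mod W\<^esub> (W #>\<^bsub>tensor_group B\<^esub> tens B (s d') x)"
      by (rule TB.FactGroup_mult[OF W, symmetric]) (use d s in \<open>auto simp: tens_closed\<close>)
    finally show "W #>\<^bsub>tensor_group B\<^esub> tens B (s (d \<otimes>\<^bsub>D\<^esub> d')) x =
       (W #>\<^bsub>tensor_group B\<^esub> tens B (s d) x) \<otimes>\<^bsub>tensor_group B Mod W\<^esub> (W #>\<^bsub>tensor_group B\<^esub> tens B (s d') x)" .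
  next
    fix d x y assume d: "d \<in> carrier D"
    have "W #>\<^bsub>tensor_group B\<^esub> tens B (s d) (x + y)
       = W #>\<^bsub>tensor_group B\<^esub> (tens B (s d) x \<otimes>\<^bsub>tensor_group B\<^esub> tens B (s d) y)"
      using d s by (simp add: tens_add_right[OF B])
    also have "\<dots> = (W #>\<^bsub>tensor_group B\<^esub> tens B (s d) x) \<otimes>\<^bsub>tensor_group B Mod W\<^esub> (W #>\<^bsub>tensor_group B\<^esub> tens B (s d) y)"
      by (rule TB.FactGroup_mult[OF W, symmetric]) (use d s in \<open>auto simp: tens_closed\<close>)
    finally show "W #>\<^bsub>tensor_group B\<^esub> tens B (s d) (x + y) =
      (W #>\<^bsub>tensor_group B\<^esub> tens B (s d) x) \<otimes>\<^bsub>tensor_group B Mod W\<^esub> (W #>\<^bsub>tensor_group B\<^esub> tens B (s d) y)" .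
  qed blast
  have comp: "\<psi> \<circ> tensor_map D g \<in> hom (tensor_group B) (tensor_group B Mod W)"
    by (rule hom_compose[OF tensor_map_hom[OF B D g] \<psi>])
  have "(\<psi> \<circ> tensor_map D g) u = W #>\<^bsub>tensor_group B\<^esub> u"
  proof (rule tensor_group_hom_eqI[OF B V comp TB.FactGroup_coset_hom[OF W] _ u(1)])
    fix b x assume b: "b \<in> carrier B"
    then show "(\<psi> \<circ> tensor_map D g) (tens B b x) = W #>\<^bsub>tensor_group B\<^esub> tens B b x"
      using same[of "s (g b)" b x] by (simp add: tensor_map_tens[OF B D g] \<psi>t s)
  qed
  moreover have "(\<psi> \<circ> tensor_map D g) u = W"
    using hom_one[OF \<psi> TD.is_group comm_group.axioms(2)[OF V]] u(2) by simp
  ultimately have "u \<in> W" using TB.coset_eq_subgroup_iff[OF W u(1)] by simp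
  then show ?thesis unfolding W_def .
qed

text \<open>Tensoring preserves an injection with torsion-free cokernel. Regard \<open>A\<close> as a subgroup of \<open>B\<close> and
  let \<open>p\<close> be the characteristic of the field. Among the subgroups \<open>N\<close> of \<open>B\<close> that contain all \<open>p\<close>-th
  powers and meet \<open>A\<close> only in \<open>p\<close>-th powers of elements of \<open>A\<close>, choose a maximal one. Maximality means
  that every \<open>b\<close> in \<open>B\<close> has a power \<open>b\<^sup>k = n a\<close> with \<open>n \<in> N\<close>, \<open>a \<in> A\<close> and \<open>k\<close> invertible in the
  field, and then \<open>b \<otimes> x \<mapsto> a \<otimes> x/k\<close> is a well-defined retraction of \<open>A \<otimes> F \<rightarrow> B \<otimes> F\<close>. This treats
  characteristic zero, where \<open>N\<close> is maximal among the subgroups that meet \<open>A\<close> trivially, and positive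
  characteristic alike.\<close>

lemma tensor_map_inj:
  fixes h :: "'a \<Rightarrow> 'b"
  assumes A: "comm_group A" and B: "comm_group B" and h: "h \<in> hom A B"
    and inj: "inj_on h (carrier A)"
    and pure: "\<And>b n. b \<in> carrier B \<Longrightarrow> n > (0::nat) \<Longrightarrow> b [^]\<^bsub>B\<^esub> n \<in> h ` carrier A \<Longrightarrow> b \<in> h ` carrier A"
  shows "inj_on (tensor_map B h) (carrier (tensor_group A :: ('a, 'f::field) tensor monoid))"
proof -
  interpret A: comm_group A by fact
  interpret B: comm_group B by fact
  interpret TA: comm_group "tensor_group A :: ('a, 'f) tensor monoid" by (rule comm_group_tensor_group[OF A])
  interpret h: group_hom A B h by unfold_locales (rule h)
  define p where "p = int CHAR('f)"
  have p0: "of_int k = (0::'f) \<longleftrightarrow> p dvd k" for k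
    by (simp add: p_def of_int_eq_0_iff_char_dvd)
  define P where "P = (\<lambda>c. c [^]\<^bsub>B\<^esub> p) ` h ` carrier A"
  define \<N> where "\<N> = {N. subgroup N B \<and> (\<forall>b\<in>carrier B. b [^]\<^bsub>B\<^esub> p \<in> N) \<and> N \<inter> h ` carrier A \<subseteq> P}"
  \<comment> \<open>The subgroup of all \<open>p\<close>-th powers qualifies; for elements of \<open>A\<close> this is purity.\<close>
  have "(\<lambda>b. b [^]\<^bsub>B\<^esub> p) ` carrier B \<in> \<N>"
  proof -
    have "(\<lambda>b. b [^]\<^bsub>B\<^esub> p) \<in> hom B B"
      by (rule homI) (auto simp: B.int_pow_distrib)
    then have "group_hom B B (\<lambda>b. b [^]\<^bsub>B\<^esub> p)" by unfold_locales
    then have sg: "subgroup ((\<lambda>b. b [^]\<^bsub>B\<^esub> p) ` carrier B) B" by (rule group_hom.img_is_subgroup)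
    have "b [^]\<^bsub>B\<^esub> p \<in> P" if b: "b \<in> carrier B" "b [^]\<^bsub>B\<^esub> p \<in> h ` carrier A" for b
    proof (cases "CHAR('f) = 0")
      case True
      then have "b [^]\<^bsub>B\<^esub> p = (h \<one>\<^bsub>A\<^esub>) [^]\<^bsub>B\<^esub> p" by (simp add: p_def)
      then show ?thesis unfolding P_def by blast
    next
      case False
      then have "b \<in> h ` carrier A"
        using pure[of b "CHAR('f)"] b by (simp add: p_def int_pow_int)
      then show ?thesis unfolding P_def by blast
    qed
    then show ?thesis using sg unfolding \<N>_def by blast
  qed
  then have ne: "\<N> \<noteq> {}" by blast
  obtain N where N: "N \<in> \<N>" and max: "\<And>X. X \<in> \<N> \<Longrightarrow> N \<subseteq> X \<Longrightarrow> X = N"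
  proof -
    have "\<Union>\<C> \<in> \<N>" if \<C>: "\<C> \<noteq> {}" "subset.chain \<N> \<C>" for \<C>
    proof -
      have sub: "\<C> \<subseteq> \<N>" and ch: "\<And>X Y. X \<in> \<C> \<Longrightarrow> Y \<in> \<C> \<Longrightarrow> X \<subseteq> Y \<or> Y \<subseteq> X"
        using \<C>(2) by (auto simp: subset_chain_def)
      obtain X0 where X0: "X0 \<in> \<C>" using \<C> by blast
      have sg: "subgroup X B" if "X \<in> \<C>" for X using sub that unfolding \<N>_def by blast
      have "subgroup (\<Union>\<C>) B"
      proof (rule B.subgroupI)
        show "\<Union>\<C> \<subseteq> carrier B" using sg subgroup.subset by blast
        show "\<Union>\<C> \<noteq> {}" using X0 subgroup.one_closed[OF sg] by blast
        show "inv\<^bsub>B\<^esub> a \<in> \<Union>\<C>" if "a \<in> \<Union>\<C>" for a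
          using that subgroup.m_inv_closed[OF sg] by blast
        show "a \<otimes>\<^bsub>B\<^esub> b \<in> \<Union>\<C>" if ab: "a \<in> \<Union>\<C>" "b \<in> \<Union>\<C>" for a b
        proof -
          obtain X Y where "X \<in> \<C>" "a \<in> X" "Y \<in> \<C>" "b \<in> Y" using ab by blast
          then obtain Z where "Z \<in> \<C>" "a \<in> Z" "b \<in> Z" using ch by blast
          then show ?thesis using subgroup.m_closed[OF sg] by blast
        qed
      qed
      moreover have "\<forall>b\<in>carrier B. b [^]\<^bsub>B\<^esub> p \<in> \<Union>\<C>"
        using X0 sub unfolding \<N>_def by blast
      moreover have "\<Union>\<C> \<inter> h ` carrier A \<subseteq> P"
        using sub unfolding \<N>_def by blast
      ultimately show ?thesis unfolding \<N>_def by blast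
    qed
    from subset_Zorn_nonempty[OF ne this] show ?thesis using that by blast
  qed
  have Nsg: "subgroup N B" and Np: "\<And>b. b \<in> carrier B \<Longrightarrow> b [^]\<^bsub>B\<^esub> p \<in> N"
    and NA: "\<And>a. a \<in> carrier A \<Longrightarrow> h a \<in> N \<Longrightarrow> h a \<in> P"
    using N unfolding \<N>_def by auto
  interpret N: subgroup N B by (rule Nsg)
  have Nint: "n [^]\<^bsub>B\<^esub> (k::int) \<in> N" if "n \<in> N" for n k
    by (rule B.subgroup_int_pow_closed[OF Nsg that])
  have ex: "\<exists>k n a. of_int k \<noteq> (0::'f) \<and> n \<in> N \<and> a \<in> carrier A \<and> b [^]\<^bsub>B\<^esub> (k::int) = n \<otimes>\<^bsub>B\<^esub> h a"
    if b: "b \<in> carrier B" for b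
  proof (cases "b \<in> N")
    case True
    then show ?thesis using b
      by (intro exI[of _ 1] exI[of _ b] exI[of _ "\<one>\<^bsub>A\<^esub>"]) auto
  next
    case False
    \<comment> \<open>The subgroup generated by \<open>N\<close> and \<open>b\<close> violates the condition on the intersection with \<open>A\<close>.\<close>
    define N' where "N' = {n \<otimes>\<^bsub>B\<^esub> b [^]\<^bsub>B\<^esub> k | n k. n \<in> N \<and> k \<in> (UNIV :: int set)}"
    have N'I: "n \<otimes>\<^bsub>B\<^esub> b [^]\<^bsub>B\<^esub> (k::int) \<in> N'" if "n \<in> N" for n k using that unfolding N'_def by blast
    have NN': "N \<subseteq> N'"
    proof
      fix n assume "n \<in> N" then show "n \<in> N'" using N'I[of n 0] by simp
    qed
    have "b \<in> N'" using N'I[of "\<one>\<^bsub>B\<^esub>" 1] b by simp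
    have "subgroup N' B"
    proof (rule B.subgroupI)
      show "N' \<subseteq> carrier B" using b unfolding N'_def by auto
      show "N' \<noteq> {}" using \<open>b \<in> N'\<close> by blast
      fix x assume "x \<in> N'"
      then obtain n k where x: "n \<in> N" "x = n \<otimes>\<^bsub>B\<^esub> b [^]\<^bsub>B\<^esub> (k::int)" unfolding N'_def by blast
      then have "inv\<^bsub>B\<^esub> x = inv\<^bsub>B\<^esub> n \<otimes>\<^bsub>B\<^esub> b [^]\<^bsub>B\<^esub> (- k)"
        using b by (simp add: B.inv_mult B.int_pow_neg)
      then show "inv\<^bsub>B\<^esub> x \<in> N'" using N'I x(1) by simp
      fix y assume "y \<in> N'"
      then obtain m l where y: "m \<in> N" "y = m \<otimes>\<^bsub>B\<^esub> b [^]\<^bsub>B\<^esub> (l::int)" unfolding N'_def by blast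
      then have "x \<otimes>\<^bsub>B\<^esub> y = (n \<otimes>\<^bsub>B\<^esub> m) \<otimes>\<^bsub>B\<^esub> b [^]\<^bsub>B\<^esub> (k + l)"
        using b x by (simp add: B.int_pow_mult B.m_ac)
      then show "x \<otimes>\<^bsub>B\<^esub> y \<in> N'" using N'I x(1) y(1) by simp
    qed
    then have "\<not> N' \<inter> h ` carrier A \<subseteq> P"
      using max[of N'] NN' \<open>b \<in> N'\<close> False Np unfolding \<N>_def by blast
    then obtain z where "z \<in> N'" "z \<in> h ` carrier A" "z \<notin> P" by blast
    then obtain n k a where y: "n \<in> N" "a \<in> carrier A" "n \<otimes>\<^bsub>B\<^esub> b [^]\<^bsub>B\<^esub> (k::int) = h a" "h a \<notin> P"
      unfolding N'_def by (smt (verit) image_iff mem_Collect_eq)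
    have "of_int k \<noteq> (0::'f)"
    proof
      assume "of_int k = (0::'f)"
      then obtain m where "k = m * p" using p0[of k] by (metis dvd_def mult.commute)
      then have "b [^]\<^bsub>B\<^esub> k = (b [^]\<^bsub>B\<^esub> m) [^]\<^bsub>B\<^esub> p" using b by (simp add: B.int_pow_pow)
      then have "b [^]\<^bsub>B\<^esub> k \<in> N" using Np[of "b [^]\<^bsub>B\<^esub> m"] b by simp
      then have "h a \<in> N" using y(1,3) N.m_closed by metis
      then show False using NA y by blast
    qed
    moreover have "b [^]\<^bsub>B\<^esub> k = inv\<^bsub>B\<^esub> n \<otimes>\<^bsub>B\<^esub> h a"
      using y b by (metis B.int_pow_closed B.inv_solve_left N.mem_carrier h.hom_closed)
    ultimately show ?thesis using y N.m_inv_closed by blast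
  qed
  \<comment> \<open>The value of the retraction does not depend on the choice of the power and its decomposition.\<close>
  have key: "tens A a (x / of_int k) = tens A a' (x / of_int k')"
    if k: "of_int k \<noteq> (0::'f)" "of_int k' \<noteq> (0::'f)" and n: "n \<in> N" "n' \<in> N"
      and a: "a \<in> carrier A" "a' \<in> carrier A" and b: "b \<in> carrier B"
      and e: "b [^]\<^bsub>B\<^esub> k = n \<otimes>\<^bsub>B\<^esub> h a" "b [^]\<^bsub>B\<^esub> k' = n' \<otimes>\<^bsub>B\<^esub> h a'"
    for k k' n n' a a' b and x :: 'f
  proof -
    have "(b [^]\<^bsub>B\<^esub> k) [^]\<^bsub>B\<^esub> k' = (b [^]\<^bsub>B\<^esub> k') [^]\<^bsub>B\<^esub> k"
      using b by (simp add: B.int_pow_pow mult.commute)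
    then have "(n [^]\<^bsub>B\<^esub> k') \<otimes>\<^bsub>B\<^esub> h (a [^]\<^bsub>A\<^esub> k') = (n' [^]\<^bsub>B\<^esub> k) \<otimes>\<^bsub>B\<^esub> h (a' [^]\<^bsub>A\<^esub> k)"
      using n a unfolding e by (simp add: B.int_pow_distrib h.hom_int_pow)
    moreover have solve: "v \<otimes>\<^bsub>B\<^esub> inv\<^bsub>B\<^esub> w = inv\<^bsub>B\<^esub> q \<otimes>\<^bsub>B\<^esub> r"
      if "q \<otimes>\<^bsub>B\<^esub> v = r \<otimes>\<^bsub>B\<^esub> w" "q \<in> carrier B" "r \<in> carrier B" "v \<in> carrier B" "w \<in> carrier B" for q r v w
      using that by (metis B.inv_closed B.inv_solve_left B.inv_solve_right B.m_assoc B.m_closed)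
    ultimately have "h (a [^]\<^bsub>A\<^esub> k') \<otimes>\<^bsub>B\<^esub> inv\<^bsub>B\<^esub> h (a' [^]\<^bsub>A\<^esub> k) = inv\<^bsub>B\<^esub> (n [^]\<^bsub>B\<^esub> k') \<otimes>\<^bsub>B\<^esub> (n' [^]\<^bsub>B\<^esub> k)"
      using n a by (intro solve) auto
    moreover have "inv\<^bsub>B\<^esub> (n [^]\<^bsub>B\<^esub> k') \<otimes>\<^bsub>B\<^esub> (n' [^]\<^bsub>B\<^esub> k) \<in> N"
      using Nint n by blast
    ultimately have "h (a [^]\<^bsub>A\<^esub> k' \<otimes>\<^bsub>A\<^esub> inv\<^bsub>A\<^esub> (a' [^]\<^bsub>A\<^esub> k)) \<in> N"
      using a by simp
    then obtain c where c: "c \<in> carrier A" "h (a [^]\<^bsub>A\<^esub> k' \<otimes>\<^bsub>A\<^esub> inv\<^bsub>A\<^esub> (a' [^]\<^bsub>A\<^esub> k)) = h c [^]\<^bsub>B\<^esub> p"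
      using NA[of "a [^]\<^bsub>A\<^esub> k' \<otimes>\<^bsub>A\<^esub> inv\<^bsub>A\<^esub> (a' [^]\<^bsub>A\<^esub> k)"] a unfolding P_def by auto
    then have "a [^]\<^bsub>A\<^esub> k' \<otimes>\<^bsub>A\<^esub> inv\<^bsub>A\<^esub> (a' [^]\<^bsub>A\<^esub> k) = c [^]\<^bsub>A\<^esub> p"
      using inj_onD[OF inj] a by (simp add: h.hom_int_pow[symmetric])
    then have eq: "a [^]\<^bsub>A\<^esub> k' = c [^]\<^bsub>A\<^esub> p \<otimes>\<^bsub>A\<^esub> a' [^]\<^bsub>A\<^esub> k"
      using a c by (metis A.int_pow_closed A.inv_solve_right)
    have "tens A (a [^]\<^bsub>A\<^esub> k') y = tens A (a' [^]\<^bsub>A\<^esub> k) y" for y :: 'f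
    proof -
      have "of_int p = (0::'f)" using p0[of p] by simp
      then have "tens A (c [^]\<^bsub>A\<^esub> p) y = \<one>\<^bsub>tensor_group A\<^esub>"
        using tens_int_pow[OF A c(1), of p y] tens_of_int_mult_right[OF A c(1), of 0 y] by simp
      then show ?thesis
        unfolding eq using a c by (simp add: tens_mult_left[OF A] tens_closed)
    qed
    from this[of "x / (of_int k * of_int k')"] show ?thesis
      using k by (simp add: tens_int_pow[OF A] a field_simps)
  qed
  obtain kk nn aa where kna: "\<And>b. b \<in> carrier B \<Longrightarrow> of_int (kk b) \<noteq> (0::'f) \<and> nn b \<in> N \<and> aa b \<in> carrier A
      \<and> b [^]\<^bsub>B\<^esub> (kk b :: int) = nn b \<otimes>\<^bsub>B\<^esub> h (aa b)"
    using ex by metis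
  define \<beta> where "\<beta> b x = tens A (aa b) (x / of_int (kk b))" for b and x :: 'f
  have \<beta>: "\<beta> b x = tens A a (x / of_int k)"
    if "of_int k \<noteq> (0::'f)" "n \<in> N" "a \<in> carrier A" "b \<in> carrier B" "b [^]\<^bsub>B\<^esub> k = n \<otimes>\<^bsub>B\<^esub> h a" for k n a b x
    unfolding \<beta>_def using kna[OF that(4)] that by (intro key[of _ _ "nn b" n _ _ b]) auto
  obtain \<rho> where \<rho>: "\<rho> \<in> hom (tensor_group B) (tensor_group A)"
    and \<rho>t: "\<And>b x. b \<in> carrier B \<Longrightarrow> \<rho> (tens B b x) = \<beta> b (x :: 'f)"
  proof (rule tensor_group_universal[OF B TA.comm_group_axioms, of \<beta>])
    fix b and x :: 'f assume "b \<in> carrier B"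
    then show "\<beta> b x \<in> carrier (tensor_group A)" using kna unfolding \<beta>_def by (simp add: tens_closed)
  next
    fix b and x y :: 'f assume "b \<in> carrier B"
    then show "\<beta> b (x + y) = \<beta> b x \<otimes>\<^bsub>tensor_group A\<^esub> \<beta> b y"
      using kna unfolding \<beta>_def by (simp add: add_divide_distrib tens_add_right[OF A])
  next
    fix b b' and x :: 'f assume b: "b \<in> carrier B" "b' \<in> carrier B"
    let ?k = "kk b" and ?k' = "kk b'" and ?a = "aa b" and ?a' = "aa b'"
    note kb = kna[OF b(1)] and kb' = kna[OF b(2)]
    have "(b \<otimes>\<^bsub>B\<^esub> b') [^]\<^bsub>B\<^esub> (?k * ?k') = (b [^]\<^bsub>B\<^esub> ?k) [^]\<^bsub>B\<^esub> ?k' \<otimes>\<^bsub>B\<^esub> (b' [^]\<^bsub>B\<^esub> ?k') [^]\<^bsub>B\<^esub> ?k"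
      using b by (simp add: B.int_pow_distrib B.int_pow_pow mult.commute)
    also have "\<dots> = (nn b [^]\<^bsub>B\<^esub> ?k' \<otimes>\<^bsub>B\<^esub> nn b' [^]\<^bsub>B\<^esub> ?k) \<otimes>\<^bsub>B\<^esub> h (?a [^]\<^bsub>A\<^esub> ?k' \<otimes>\<^bsub>A\<^esub> ?a' [^]\<^bsub>A\<^esub> ?k)"
      using kb kb' by (simp add: B.int_pow_distrib h.hom_int_pow B.m_ac)
    finally have "\<beta> (b \<otimes>\<^bsub>B\<^esub> b') x = tens A (?a [^]\<^bsub>A\<^esub> ?k' \<otimes>\<^bsub>A\<^esub> ?a' [^]\<^bsub>A\<^esub> ?k) (x / of_int (?k * ?k'))"
      using kb kb' b by (intro \<beta>) (auto intro: Nint)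
    also have "\<dots> = \<beta> b x \<otimes>\<^bsub>tensor_group A\<^esub> \<beta> b' x"
      using kb kb' unfolding \<beta>_def by (simp add: tens_mult_left[OF A] tens_int_pow[OF A])
    finally show "\<beta> (b \<otimes>\<^bsub>B\<^esub> b') x = \<beta> b x \<otimes>\<^bsub>tensor_group A\<^esub> \<beta> b' x" .
  qed blast
  have comp: "\<rho> \<circ> tensor_map B h \<in> hom (tensor_group A) (tensor_group A)"
    by (rule hom_compose[OF tensor_map_hom[OF A B h] \<rho>])
  have idh: "id \<in> hom (tensor_group A) (tensor_group A)" by (simp add: hom_def)
  have "(\<rho> \<circ> tensor_map B h) u = id u" if u: "u \<in> carrier (tensor_group A)" for u
  proof (rule tensor_group_hom_eqI[OF A TA.comm_group_axioms comp idh _ u])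
    fix a and x :: 'f assume a: "a \<in> carrier A"
    have "\<beta> (h a) x = tens A a (x / of_int 1)"
      by (rule \<beta>[of _ "\<one>\<^bsub>B\<^esub>"]) (use a in auto)
    then show "(\<rho> \<circ> tensor_map B h) (tens A a x) = id (tens A a x)"
      using a by (simp add: tensor_map_tens[OF A B h] \<rho>t)
  qed
  then show ?thesis by (intro inj_on_inverseI[of _ \<rho>]) simp
qed

section \<open>Chain complexes and homology isomorphisms\<close>

lemma (in comm_group) comm_group_subgroup:
  assumes "subgroup H G" shows "comm_group (G\<lparr>carrier := H\<rparr>)"
  by (rule group.group_comm_groupI[OF subgroup.subgroup_is_group[OF assms is_group]])
    (use subgroup.mem_carrier[OF assms] m_comm in auto)

text \<open>The conditions start with \<open>\<partial>\<^sub>1\<close>, since \<open>\<partial>\<^sub>0 = 0\<close> is built into the definition of the cycles.\<close>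

definition valid_complex :: "'c chain_complex \<Rightarrow> bool" where
  "valid_complex C \<longleftrightarrow> (\<forall>k. comm_group (grp C k)) \<and>
     (\<forall>k. bnd C (Suc k) \<in> hom (grp C (Suc k)) (grp C k)) \<and>
     (\<forall>k. \<forall>x\<in>carrier (grp C (Suc (Suc k))). bnd C (Suc k) (bnd C (Suc (Suc k)) x) = \<one>\<^bsub>grp C k\<^esub>)"

definition chain_map :: "'c chain_complex \<Rightarrow> 'd chain_complex \<Rightarrow> (nat \<Rightarrow> 'c \<Rightarrow> 'd) \<Rightarrow> bool" where
  "chain_map C C' h \<longleftrightarrow> (\<forall>k. h k \<in> hom (grp C k) (grp C' k)) \<and>
     (\<forall>k. \<forall>x\<in>carrier (grp C (Suc k)). h k (bnd C (Suc k) x) = bnd C' (Suc k) (h (Suc k) x))"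

definition acyclic_complex :: "'c chain_complex \<Rightarrow> bool" where
  "acyclic_complex C \<longleftrightarrow> (\<forall>k. cycles C k \<subseteq> boundaries C k)"

definition short_exact ::
  "'a chain_complex \<Rightarrow> 'b chain_complex \<Rightarrow> 'c chain_complex \<Rightarrow> (nat \<Rightarrow> 'a \<Rightarrow> 'b) \<Rightarrow> (nat \<Rightarrow> 'b \<Rightarrow> 'c) \<Rightarrow> bool" where
  "short_exact A B C i p \<longleftrightarrow> chain_map A B i \<and> chain_map B C p \<and>
     (\<forall>k. inj_on (i k) (carrier (grp A k)) \<and> p k ` carrier (grp B k) = carrier (grp C k) \<and>
        kernel (grp B k) (grp C k) (p k) = i k ` carrier (grp A k))"

lemma valid_complexD:
  assumes "valid_complex C"
  shows "comm_group (grp C k)" "group (grp C k)"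
    "bnd C (Suc k) \<in> hom (grp C (Suc k)) (grp C k)"
    "x \<in> carrier (grp C (Suc k)) \<Longrightarrow> bnd C (Suc k) x \<in> carrier (grp C k)"
    "x \<in> carrier (grp C (Suc (Suc k))) \<Longrightarrow> bnd C (Suc k) (bnd C (Suc (Suc k)) x) = \<one>\<^bsub>grp C k\<^esub>"
    "group_hom (grp C (Suc k)) (grp C k) (bnd C (Suc k))"
  using assms comm_group.axioms(2) unfolding valid_complex_def group_hom_def group_hom_axioms_def
  by (auto intro: hom_in_carrier)

lemma chain_mapD:
  assumes "chain_map C C' h"
  shows "h k \<in> hom (grp C k) (grp C' k)"
    "x \<in> carrier (grp C k) \<Longrightarrow> h k x \<in> carrier (grp C' k)"
    "x \<in> carrier (grp C (Suc k)) \<Longrightarrow> h k (bnd C (Suc k) x) = bnd C' (Suc k) (h (Suc k) x)"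
  using assms unfolding chain_map_def by (auto intro: hom_in_carrier)

lemma chain_map_group_hom:
  assumes "valid_complex C" "valid_complex C'" "chain_map C C' h"
  shows "group_hom (grp C k) (grp C' k) (h k)"
  using valid_complexD(2)[OF assms(1)] valid_complexD(2)[OF assms(2)] chain_mapD(1)[OF assms(3)]
  unfolding group_hom_def group_hom_axioms_def by auto

lemma subgroup_cycles:
  assumes "valid_complex C" shows "subgroup (cycles C k) (grp C k)"
proof (cases k)
  case 0 then show ?thesis using group.subgroup_self[OF valid_complexD(2)[OF assms]] by simp
next
  case (Suc j) then show ?thesis using group_hom.subgroup_kernel[OF valid_complexD(6)[OF assms]] by simp
qed

lemma subgroup_boundaries:
  assumes "valid_complex C" shows "subgroup (boundaries C k) (grp C k)"
  unfolding boundaries_def by (rule group_hom.img_is_subgroup[OF valid_complexD(6)[OF assms]])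

lemma boundaries_subset_cycles:
  assumes "valid_complex C" shows "boundaries C k \<subseteq> cycles C k"
  using valid_complexD[OF assms] by (cases k) (auto simp: boundaries_def kernel_def)

lemma chain_map_cycles:
  assumes "valid_complex C" "valid_complex C'" "chain_map C C' h" "x \<in> cycles C k"
  shows "h k x \<in> cycles C' k"
proof (cases k)
  case 0 then show ?thesis using assms chain_mapD by auto
next
  case (Suc j)
  then have x: "x \<in> carrier (grp C (Suc j))" "bnd C (Suc j) x = \<one>\<^bsub>grp C j\<^esub>" using assms(4) by (auto simp: kernel_def)
  then have "bnd C' (Suc j) (h (Suc j) x) = \<one>\<^bsub>grp C' j\<^esub>"
    using chain_mapD(3)[OF assms(3) x(1)] group_hom.hom_one[OF chain_map_group_hom[OF assms(1-3)]] by simp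
  then show ?thesis using Suc x chain_mapD(2)[OF assms(3)] by (auto simp: kernel_def)
qed

lemma chain_map_boundaries:
  assumes "valid_complex C" "chain_map C C' h" "x \<in> boundaries C k"
  shows "h k x \<in> boundaries C' k"
  using assms(3) chain_mapD[OF assms(2)] unfolding boundaries_def by auto

lemma homology_iso_iff:
  assumes C: "valid_complex C" and C': "valid_complex C'" and h: "chain_map C C' h"
  shows "homology_iso C C' h \<longleftrightarrow>
    (\<forall>k. (\<forall>x\<in>cycles C k. h k x \<in> boundaries C' k \<longrightarrow> x \<in> boundaries C k) \<and>
         (\<forall>y\<in>cycles C' k. \<exists>x\<in>cycles C k. y \<otimes>\<^bsub>grp C' k\<^esub> inv\<^bsub>grp C' k\<^esub> (h k x) \<in> boundaries C' k))"
proof -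
  have "coset_map (grp C' k) (boundaries C' k) (h k) \<in> iso (homology C k) (homology C' k) \<longleftrightarrow>
    (\<forall>x\<in>cycles C k. h k x \<in> boundaries C' k \<longrightarrow> x \<in> boundaries C k) \<and>
    (\<forall>y\<in>cycles C' k. \<exists>x\<in>cycles C k. y \<otimes>\<^bsub>grp C' k\<^esub> inv\<^bsub>grp C' k\<^esub> (h k x) \<in> boundaries C' k)" for k
  proof -
    let ?Z = "(grp C k)\<lparr>carrier := cycles C k\<rparr>" and ?Z' = "(grp C' k)\<lparr>carrier := cycles C' k\<rparr>"
    let ?B = "boundaries C k" and ?B' = "boundaries C' k"
    interpret G: comm_group "grp C k" by (rule valid_complexD(1)[OF C])
    interpret G': comm_group "grp C' k" by (rule valid_complexD(1)[OF C'])
    interpret Z: comm_group ?Z by (rule G.comm_group_subgroup[OF subgroup_cycles[OF C]])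
    interpret Z': comm_group ?Z' by (rule G'.comm_group_subgroup[OF subgroup_cycles[OF C']])
    have B: "subgroup ?B ?Z"
      by (rule G.subgroup_incl[OF subgroup_boundaries[OF C] subgroup_cycles[OF C] boundaries_subset_cycles[OF C]])
    have B': "subgroup ?B' ?Z'"
      by (rule G'.subgroup_incl[OF subgroup_boundaries[OF C'] subgroup_cycles[OF C'] boundaries_subset_cycles[OF C']])
    have hZ: "h k \<in> hom ?Z ?Z'"
      using chain_map_cycles[OF C C' h] chain_mapD(1)[OF h, of k] subgroup.subset[OF subgroup_cycles[OF C, of k]]
      by (auto simp: hom_def Pi_def subset_iff)
    have hB: "h k ` ?B \<subseteq> ?B'" using chain_map_boundaries[OF C h] by auto
    let ?m = "coset_map (grp C' k) ?B' (h k)"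
    have meq: "?m = coset_map ?Z' ?B' (h k)" by (rule ext) (simp add: coset_map_def r_coset_def)
    have m: "?m (?B #>\<^bsub>?Z\<^esub> x) = ?B' #>\<^bsub>?Z'\<^esub> h k x" if "x \<in> cycles C k" for x
      unfolding meq by (rule coset_map_coset[OF Z.comm_group_axioms Z'.comm_group_axioms hZ B B' hB]) (use that in simp)
    have homm: "?m \<in> hom (homology C k) (homology C' k)"
      unfolding meq homology_def by (rule coset_map_hom[OF Z.comm_group_axioms Z'.comm_group_axioms hZ B B' hB])
    have gh: "group_hom (homology C k) (homology C' k) ?m"
      unfolding group_hom_def group_hom_axioms_def
      using homm comm_group.axioms(2)[OF Z.abelian_FactGroup[OF B]] comm_group.axioms(2)[OF Z'.abelian_FactGroup[OF B']]
      unfolding homology_def by simp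
    have hc: "h k x \<in> cycles C' k" if "x \<in> cycles C k" for x using chain_map_cycles[OF C C' h that] .
    have e1: "?m (?B #>\<^bsub>grp C k\<^esub> x) = ?B' \<longleftrightarrow> h k x \<in> ?B'" if "x \<in> cycles C k" for x
      using Z'.coset_eq_subgroup_iff[OF B', of "h k x"] hc[OF that] m[OF that] by simp
    have e2: "?B #>\<^bsub>grp C k\<^esub> x = ?B \<longleftrightarrow> x \<in> ?B" if "x \<in> cycles C k" for x
      using Z.coset_eq_subgroup_iff[OF B, of x] that by simp
    have e3: "?B' #>\<^bsub>grp C' k\<^esub> y = ?m (?B #>\<^bsub>grp C k\<^esub> x) \<longleftrightarrow> y \<otimes>\<^bsub>grp C' k\<^esub> inv\<^bsub>grp C' k\<^esub> (h k x) \<in> ?B'"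
      if "x \<in> cycles C k" "y \<in> cycles C' k" for x y
      using Z'.coset_eq_iff[OF B', of y "h k x"] that(2) m[OF that(1)] hc[OF that(1)]
        G'.m_inv_consistent[OF subgroup_cycles[OF C'] hc[OF that(1)]] by simp
    have 1: "(\<forall>X\<in>carrier (homology C k). ?m X = \<one>\<^bsub>homology C' k\<^esub> \<longrightarrow> X = \<one>\<^bsub>homology C k\<^esub>) \<longleftrightarrow>
      (\<forall>x\<in>cycles C k. h k x \<in> ?B' \<longrightarrow> x \<in> ?B)"
      by (simp add: homology_def carrier_FactGroup e1 e2)
    have 2: "carrier (homology C' k) \<subseteq> ?m ` carrier (homology C k) \<longleftrightarrow>
      (\<forall>y\<in>cycles C' k. \<exists>x\<in>cycles C k. ?B' #>\<^bsub>grp C' k\<^esub> y = ?m (?B #>\<^bsub>grp C k\<^esub> x))"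
      by (simp add: homology_def carrier_FactGroup image_subset_iff image_image image_iff)
    show ?thesis unfolding group_hom.iso_iff[OF gh] 1 2 using e3 by (metis (no_types, lifting))
  qed
  then show ?thesis unfolding homology_iso_def by simp
qed

section \<open>Mapping cones\<close>

text \<open>The mapping cone, indexed so that degree \<open>k\<close> is \<open>C\<^sub>k\<^sub>-\<^sub>1 \<times> C'\<^sub>k\<close>; in degree 0 the first factor is
  the trivial subgroup of \<open>C\<^sub>0\<close>, which keeps the type of the elements.\<close>

fun cone_grp :: "'c chain_complex \<Rightarrow> 'd chain_complex \<Rightarrow> nat \<Rightarrow> ('c \<times> 'd) monoid" where
  "cone_grp C C' 0 = ((grp C 0)\<lparr>carrier := {\<one>\<^bsub>grp C 0\<^esub>}\<rparr>) \<times>\<times> grp C' 0"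
| "cone_grp C C' (Suc k) = grp C k \<times>\<times> grp C' (Suc k)"

fun cone_bnd :: "'c chain_complex \<Rightarrow> 'd chain_complex \<Rightarrow> (nat \<Rightarrow> 'c \<Rightarrow> 'd) \<Rightarrow> nat \<Rightarrow> 'c \<times> 'd \<Rightarrow> 'c \<times> 'd" where
  "cone_bnd C C' h 0 z = z"
| "cone_bnd C C' h (Suc k) (a, b) =
     ((case k of 0 \<Rightarrow> \<one>\<^bsub>grp C 0\<^esub> | Suc j \<Rightarrow> bnd C k a),
      h k a \<otimes>\<^bsub>grp C' k\<^esub> inv\<^bsub>grp C' k\<^esub> bnd C' (Suc k) b)"

definition cone :: "'c chain_complex \<Rightarrow> 'd chain_complex \<Rightarrow> (nat \<Rightarrow> 'c \<Rightarrow> 'd) \<Rightarrow> ('c \<times> 'd) chain_complex" where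
  "cone C C' h = \<lparr>grp = cone_grp C C', bnd = cone_bnd C C' h\<rparr>"

lemma comm_group_DirProd:
  "comm_group G \<Longrightarrow> comm_group H \<Longrightarrow> comm_group (G \<times>\<times> H)"
  by (rule group.group_comm_groupI[OF DirProd_group])
    (auto simp: comm_group.axioms(2) comm_monoid.m_comm comm_group.axioms(1))

lemma comm_group_cone:
  assumes "valid_complex C" "valid_complex C'"
  shows "comm_group (cone_grp C C' k)"
proof (cases k)
  case 0
  have "subgroup {\<one>\<^bsub>grp C 0\<^esub>} (grp C 0)" by (rule group.triv_subgroup[OF valid_complexD(2)[OF assms(1)]])
  then show ?thesis using 0 valid_complexD(1)[OF assms(1)] valid_complexD(1)[OF assms(2)]
    by (simp add: comm_group_DirProd comm_group.comm_group_subgroup)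
next
  case (Suc j) then show ?thesis using valid_complexD(1)[OF assms(1)] valid_complexD(1)[OF assms(2)]
    by (simp add: comm_group_DirProd)
qed

lemma valid_cone:
  assumes C: "valid_complex C" and C': "valid_complex C'" and h: "chain_map C C' h"
  shows "valid_complex (cone C C' h)"
  unfolding valid_complex_def cone_def chain_complex.select_convs
proof (intro conjI allI ballI)
  note [simp] = valid_complexD(4,5)[OF C] valid_complexD(4,5)[OF C'] chain_mapD(2,3)[OF h]
  show "comm_group (cone_grp C C' k)" for k by (rule comm_group_cone[OF C C'])
  show "cone_bnd C C' h (Suc k) \<in> hom (cone_grp C C' (Suc k)) (cone_grp C C' k)" for k
  proof -
    interpret G': comm_group "grp C' k" by (rule valid_complexD(1)[OF C'])
    interpret b': group_hom "grp C' (Suc k)" "grp C' k" "bnd C' (Suc k)" by (rule valid_complexD(6)[OF C'])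
    interpret h: group_hom "grp C k" "grp C' k" "h k" by (rule chain_map_group_hom[OF C C' h])
    show ?thesis
    proof (rule homI)
      fix x assume x: "x \<in> carrier (cone_grp C C' (Suc k))"
      obtain a b where ab: "x = (a,b)" "a \<in> carrier (grp C k)" "b \<in> carrier (grp C' (Suc k))" using x by (cases x) auto
      have "h k a \<otimes>\<^bsub>grp C' k\<^esub> inv\<^bsub>grp C' k\<^esub> bnd C' (Suc k) b \<in> carrier (grp C' k)" using ab by simp
      then show "cone_bnd C C' h (Suc k) x \<in> carrier (cone_grp C C' k)"
        using ab by (cases k) simp_all
      fix y assume y: "y \<in> carrier (cone_grp C C' (Suc k))"
      obtain c d where cd: "y = (c,d)" "c \<in> carrier (grp C k)" "d \<in> carrier (grp C' (Suc k))" using y by (cases y) auto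
      have "h k (a \<otimes>\<^bsub>grp C k\<^esub> c) \<otimes>\<^bsub>grp C' k\<^esub> inv\<^bsub>grp C' k\<^esub> bnd C' (Suc k) (b \<otimes>\<^bsub>grp C' (Suc k)\<^esub> d)
        = (h k a \<otimes>\<^bsub>grp C' k\<^esub> inv\<^bsub>grp C' k\<^esub> bnd C' (Suc k) b) \<otimes>\<^bsub>grp C' k\<^esub> (h k c \<otimes>\<^bsub>grp C' k\<^esub> inv\<^bsub>grp C' k\<^esub> bnd C' (Suc k) d)"
        using ab cd by (simp add: G'.inv_mult G'.m_ac)
      then show "cone_bnd C C' h (Suc k) (x \<otimes>\<^bsub>cone_grp C C' (Suc k)\<^esub> y) =
        cone_bnd C C' h (Suc k) x \<otimes>\<^bsub>cone_grp C C' k\<^esub> cone_bnd C C' h (Suc k) y"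
        using ab cd group.is_monoid[OF valid_complexD(2)[OF C, of 0]]
        by (cases k) (simp_all add: monoid.r_one group_hom.hom_mult[OF valid_complexD(6)[OF C]])
    qed
  qed
  show "cone_bnd C C' h (Suc k) (cone_bnd C C' h (Suc (Suc k)) z) = \<one>\<^bsub>cone_grp C C' k\<^esub>"
    if z: "z \<in> carrier (cone_grp C C' (Suc (Suc k)))" for z k
  proof -
    interpret G': comm_group "grp C' k" by (rule valid_complexD(1)[OF C'])
    interpret G1': comm_group "grp C' (Suc k)" by (rule valid_complexD(1)[OF C'])
    interpret b': group_hom "grp C' (Suc k)" "grp C' k" "bnd C' (Suc k)" by (rule valid_complexD(6)[OF C'])
    obtain a b where z: "z = (a,b)" "a \<in> carrier (grp C (Suc k))" "b \<in> carrier (grp C' (Suc (Suc k)))" using z by (cases z) auto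
    have "bnd C' (Suc k) (h (Suc k) a \<otimes>\<^bsub>grp C' (Suc k)\<^esub> inv\<^bsub>grp C' (Suc k)\<^esub> bnd C' (Suc (Suc k)) b)
      = bnd C' (Suc k) (h (Suc k) a)"
      using z by simp
    then have "h k (bnd C (Suc k) a) \<otimes>\<^bsub>grp C' k\<^esub> inv\<^bsub>grp C' k\<^esub>
       bnd C' (Suc k) (h (Suc k) a \<otimes>\<^bsub>grp C' (Suc k)\<^esub> inv\<^bsub>grp C' (Suc k)\<^esub> bnd C' (Suc (Suc k)) b) = \<one>\<^bsub>grp C' k\<^esub>"
      using z by simp
    then show ?thesis using z by (cases k) simp_all
  qed
qed

text \<open>The elementwise form: a pair \<open>(a, b)\<close> with \<open>h a = \<partial>b\<close> and \<open>a\<close> a cycle is a cycle of the cone, and it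
  has to be the boundary of some \<open>(e, d)\<close>.\<close>

lemma acyclic_cone_iff:
  assumes C: "valid_complex C" and C': "valid_complex C'" and h: "chain_map C C' h"
  shows "acyclic_complex (cone C C' h) \<longleftrightarrow>
    (\<forall>b\<in>carrier (grp C' 0). \<exists>e\<in>carrier (grp C 0). \<exists>d\<in>carrier (grp C' 1).
        b = h 0 e \<otimes>\<^bsub>grp C' 0\<^esub> inv\<^bsub>grp C' 0\<^esub> bnd C' 1 d) \<and>
    (\<forall>k. \<forall>a\<in>cycles C k. \<forall>b\<in>carrier (grp C' (Suc k)). h k a = bnd C' (Suc k) b \<longrightarrow>
      (\<exists>e\<in>carrier (grp C (Suc k)). \<exists>d\<in>carrier (grp C' (Suc (Suc k))).
         a = bnd C (Suc k) e \<and> b = h (Suc k) e \<otimes>\<^bsub>grp C' (Suc k)\<^esub> inv\<^bsub>grp C' (Suc k)\<^esub> bnd C' (Suc (Suc k)) d))"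
    (is "_ \<longleftrightarrow> ?base \<and> (\<forall>k. ?R k)")
proof -
  have 0: "cycles (cone C C' h) 0 \<subseteq> boundaries (cone C C' h) 0 \<longleftrightarrow> ?base"
    by (auto simp: cone_def boundaries_def image_iff subset_iff Bex_def)
  have S: "cycles (cone C C' h) (Suc k) \<subseteq> boundaries (cone C C' h) (Suc k) \<longleftrightarrow> ?R k" for k
  proof -
    interpret G': comm_group "grp C' k" by (rule valid_complexD(1)[OF C'])
    have eq: "h k a \<otimes>\<^bsub>grp C' k\<^esub> inv\<^bsub>grp C' k\<^esub> bnd C' (Suc k) b = \<one>\<^bsub>grp C' k\<^esub> \<longleftrightarrow> h k a = bnd C' (Suc k) b"
      if "a \<in> carrier (grp C k)" "b \<in> carrier (grp C' (Suc k))" for a b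
      using that chain_mapD(2)[OF h] valid_complexD(4)[OF C'] by (simp add: G'.inv_solve_right')
    have cyc: "(a, b) \<in> cycles (cone C C' h) (Suc k) \<longleftrightarrow>
       a \<in> cycles C k \<and> b \<in> carrier (grp C' (Suc k)) \<and> h k a = bnd C' (Suc k) b" for a b
      using eq subgroup.mem_carrier[OF subgroup_cycles[OF C, of k]]
      by (cases k) (auto simp: cone_def kernel_def)
    have bd: "(a, b) \<in> boundaries (cone C C' h) (Suc k) \<longleftrightarrow>
      (\<exists>e\<in>carrier (grp C (Suc k)). \<exists>d\<in>carrier (grp C' (Suc (Suc k))).
         a = bnd C (Suc k) e \<and> b = h (Suc k) e \<otimes>\<^bsub>grp C' (Suc k)\<^esub> inv\<^bsub>grp C' (Suc k)\<^esub> bnd C' (Suc (Suc k)) d)" for a b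
      by (auto simp: cone_def boundaries_def image_iff)
    show ?thesis unfolding subset_iff split_paired_All cyc bd by blast
  qed
  have "acyclic_complex (cone C C' h) \<longleftrightarrow> cycles (cone C C' h) 0 \<subseteq> boundaries (cone C C' h) 0 \<and>
    (\<forall>k. cycles (cone C C' h) (Suc k) \<subseteq> boundaries (cone C C' h) (Suc k))"
    unfolding acyclic_complex_def by (metis not0_implies_Suc)
  then show ?thesis unfolding 0 S .
qed

lemma cycles_carrier:
  "valid_complex C \<Longrightarrow> x \<in> cycles C k \<Longrightarrow> x \<in> carrier (grp C k)"
  using subgroup.mem_carrier[OF subgroup_cycles] .

text \<open>One condition on pairs replaces injectivity and surjectivity on homology. Since a short exact
  sequence of chain maps induces one of cones, two-out-of-three statements for homology isomorphisms
  reduce to those for acyclic complexes.\<close>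

lemma homology_iso_iff_acyclic_cone:
  assumes C: "valid_complex C" and C': "valid_complex C'" and h: "chain_map C C' h"
  shows "homology_iso C C' h \<longleftrightarrow> acyclic_complex (cone C C' h)"
proof
  note [simp] = valid_complexD(4)[OF C] valid_complexD(4)[OF C'] chain_mapD(2)[OF h]
  assume iso: "homology_iso C C' h"
  have lift: "\<exists>e\<in>cycles C k. \<exists>d\<in>carrier (grp C' (Suc k)). b = h k e \<otimes>\<^bsub>grp C' k\<^esub> inv\<^bsub>grp C' k\<^esub> bnd C' (Suc k) d"
    if b: "b \<in> cycles C' k" for b k
  proof -
    interpret G': comm_group "grp C' k" by (rule valid_complexD(1)[OF C'])
    interpret b': group_hom "grp C' (Suc k)" "grp C' k" "bnd C' (Suc k)" by (rule valid_complexD(6)[OF C'])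
    obtain e where e: "e \<in> cycles C k" "b \<otimes>\<^bsub>grp C' k\<^esub> inv\<^bsub>grp C' k\<^esub> (h k e) \<in> boundaries C' k"
      using iso b unfolding homology_iso_iff[OF C C' h] by blast
    then obtain d where d: "d \<in> carrier (grp C' (Suc k))" "b \<otimes>\<^bsub>grp C' k\<^esub> inv\<^bsub>grp C' k\<^esub> (h k e) = bnd C' (Suc k) d"
      unfolding boundaries_def by blast
    have c: "b \<in> carrier (grp C' k)" "h k e \<in> carrier (grp C' k)"
      using cycles_carrier[OF C' b] cycles_carrier[OF C e(1)] by auto
    have "b = bnd C' (Suc k) d \<otimes>\<^bsub>grp C' k\<^esub> h k e"
      using d c by (metis G'.inv_solve_right b'.hom_closed)
    then have "b = h k e \<otimes>\<^bsub>grp C' k\<^esub> inv\<^bsub>grp C' k\<^esub> bnd C' (Suc k) (inv\<^bsub>grp C' (Suc k)\<^esub> d)"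
      using d(1) c by (simp add: G'.m_comm)
    then show ?thesis using e(1) d(1) b'.G.inv_closed by blast
  qed
  show "acyclic_complex (cone C C' h)"
    unfolding acyclic_cone_iff[OF C C' h]
  proof (intro conjI allI ballI impI)
    fix b assume "b \<in> carrier (grp C' 0)"
    then show "\<exists>e\<in>carrier (grp C 0). \<exists>d\<in>carrier (grp C' 1). b = h 0 e \<otimes>\<^bsub>grp C' 0\<^esub> inv\<^bsub>grp C' 0\<^esub> bnd C' 1 d"
      using lift[of b 0] by simp
  next
    fix k a b assume ab: "a \<in> cycles C k" "b \<in> carrier (grp C' (Suc k))" "h k a = bnd C' (Suc k) b"
    interpret G': comm_group "grp C' k" by (rule valid_complexD(1)[OF C'])
    interpret G1': comm_group "grp C' (Suc k)" by (rule valid_complexD(1)[OF C'])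
    interpret G1: comm_group "grp C (Suc k)" by (rule valid_complexD(1)[OF C])
    interpret b': group_hom "grp C' (Suc k)" "grp C' k" "bnd C' (Suc k)" by (rule valid_complexD(6)[OF C'])
    interpret bb: group_hom "grp C (Suc k)" "grp C k" "bnd C (Suc k)" by (rule valid_complexD(6)[OF C])
    interpret h1: group_hom "grp C (Suc k)" "grp C' (Suc k)" "h (Suc k)" by (rule chain_map_group_hom[OF C C' h])
    have "a \<in> boundaries C k"
      using iso ab unfolding homology_iso_iff[OF C C' h] boundaries_def[of C'] by blast
    then obtain e0 where e0: "e0 \<in> carrier (grp C (Suc k))" "a = bnd C (Suc k) e0"
      unfolding boundaries_def by blast
    have "b \<otimes>\<^bsub>grp C' (Suc k)\<^esub> inv\<^bsub>grp C' (Suc k)\<^esub> h (Suc k) e0 \<in> cycles C' (Suc k)"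
      using ab e0 chain_mapD(3)[OF h e0(1)] by (simp add: kernel_def)
    then obtain e d where ed: "e \<in> cycles C (Suc k)" "d \<in> carrier (grp C' (Suc (Suc k)))"
      "b \<otimes>\<^bsub>grp C' (Suc k)\<^esub> inv\<^bsub>grp C' (Suc k)\<^esub> h (Suc k) e0
       = h (Suc k) e \<otimes>\<^bsub>grp C' (Suc k)\<^esub> inv\<^bsub>grp C' (Suc k)\<^esub> bnd C' (Suc (Suc k)) d"
      using lift by blast
    have e: "e \<in> carrier (grp C (Suc k))" "bnd C (Suc k) e = \<one>\<^bsub>grp C k\<^esub>" using ed(1) by (auto simp: kernel_def)
    have "b = (h (Suc k) e \<otimes>\<^bsub>grp C' (Suc k)\<^esub> inv\<^bsub>grp C' (Suc k)\<^esub> bnd C' (Suc (Suc k)) d) \<otimes>\<^bsub>grp C' (Suc k)\<^esub> h (Suc k) e0"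
      using ed(2,3) e e0 ab by (metis G1'.inv_solve_right G1'.inv_closed G1'.m_closed chain_mapD(2)[OF h] valid_complexD(4)[OF C'])
    then have "b = h (Suc k) (e0 \<otimes>\<^bsub>grp C (Suc k)\<^esub> e) \<otimes>\<^bsub>grp C' (Suc k)\<^esub> inv\<^bsub>grp C' (Suc k)\<^esub> bnd C' (Suc (Suc k)) d"
      using ed(2) e e0 by (simp add: G1'.m_ac)
    moreover have "a = bnd C (Suc k) (e0 \<otimes>\<^bsub>grp C (Suc k)\<^esub> e)" using e e0 by simp
    ultimately show "\<exists>e\<in>carrier (grp C (Suc k)). \<exists>d\<in>carrier (grp C' (Suc (Suc k))). a = bnd C (Suc k) e \<and>
       b = h (Suc k) e \<otimes>\<^bsub>grp C' (Suc k)\<^esub> inv\<^bsub>grp C' (Suc k)\<^esub> bnd C' (Suc (Suc k)) d"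
      using e e0 ed(2) G1.m_closed by blast
  qed
next
  note [simp] = valid_complexD(4)[OF C] valid_complexD(4)[OF C'] chain_mapD(2)[OF h]
  assume "acyclic_complex (cone C C' h)"
  then have base: "\<And>b. b\<in>carrier (grp C' 0) \<Longrightarrow> \<exists>e\<in>carrier (grp C 0). \<exists>d\<in>carrier (grp C' 1).
        b = h 0 e \<otimes>\<^bsub>grp C' 0\<^esub> inv\<^bsub>grp C' 0\<^esub> bnd C' 1 d"
    and step: "\<And>k a b. a\<in>cycles C k \<Longrightarrow> b\<in>carrier (grp C' (Suc k)) \<Longrightarrow> h k a = bnd C' (Suc k) b \<Longrightarrow>
      \<exists>e\<in>carrier (grp C (Suc k)). \<exists>d\<in>carrier (grp C' (Suc (Suc k))).
         a = bnd C (Suc k) e \<and> b = h (Suc k) e \<otimes>\<^bsub>grp C' (Suc k)\<^esub> inv\<^bsub>grp C' (Suc k)\<^esub> bnd C' (Suc (Suc k)) d"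
    unfolding acyclic_cone_iff[OF C C' h] by blast+
  show "homology_iso C C' h"
    unfolding homology_iso_iff[OF C C' h]
  proof (intro allI conjI ballI impI)
    fix k x assume "x \<in> cycles C k" "h k x \<in> boundaries C' k"
    then show "x \<in> boundaries C k" using step unfolding boundaries_def by blast
  next
    fix k y assume y: "y \<in> cycles C' k"
    have "\<exists>e\<in>cycles C k. \<exists>d\<in>carrier (grp C' (Suc k)). y = h k e \<otimes>\<^bsub>grp C' k\<^esub> inv\<^bsub>grp C' k\<^esub> bnd C' (Suc k) d"
    proof (cases k)
      case 0 then show ?thesis using base[of y] y by simp
    next
      case (Suc j)
      interpret G: comm_group "grp C j" by (rule valid_complexD(1)[OF C])
      have one: "\<one>\<^bsub>grp C j\<^esub> \<in> cycles C j" by (rule subgroup.one_closed[OF subgroup_cycles[OF C]])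
      obtain e d where "e \<in> carrier (grp C (Suc j))" "d\<in>carrier (grp C' (Suc (Suc j)))" "\<one>\<^bsub>grp C j\<^esub> = bnd C (Suc j) e"
        "y = h (Suc j) e \<otimes>\<^bsub>grp C' (Suc j)\<^esub> inv\<^bsub>grp C' (Suc j)\<^esub> bnd C' (Suc (Suc j)) d"
        using step[OF one, of y] y group_hom.hom_one[OF chain_map_group_hom[OF C C' h]] unfolding Suc
        by (auto simp: kernel_def)
      then show ?thesis unfolding Suc by (auto simp: kernel_def)
    qed
    then obtain e d where ed: "e\<in>cycles C k" "d\<in>carrier (grp C' (Suc k))"
      "y = h k e \<otimes>\<^bsub>grp C' k\<^esub> inv\<^bsub>grp C' k\<^esub> bnd C' (Suc k) d" by blast
    interpret G': comm_group "grp C' k" by (rule valid_complexD(1)[OF C'])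
    have c: "h k e \<in> carrier (grp C' k)"
      using ed(1) subgroup.mem_carrier[OF subgroup_cycles[OF C]] by auto
    have "y \<otimes>\<^bsub>grp C' k\<^esub> inv\<^bsub>grp C' k\<^esub> h k e = inv\<^bsub>grp C' k\<^esub> bnd C' (Suc k) d"
      unfolding ed(3) using c ed(2)
      by (metis G'.inv_closed G'.m_comm G'.m_closed G'.inv_solve_right valid_complexD(4)[OF C'])
    also have "\<dots> \<in> boundaries C' k"
      using subgroup.m_inv_closed[OF subgroup_boundaries[OF C']] ed(2) unfolding boundaries_def by blast
    finally show "\<exists>x\<in>cycles C k. y \<otimes>\<^bsub>grp C' k\<^esub> inv\<^bsub>grp C' k\<^esub> h k x \<in> boundaries C' k"
      using ed(1) by blast
  qed
qed

section \<open>Short exact sequences of complexes\<close>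

lemma short_exactD:
  assumes "short_exact A B C i p"
  shows "chain_map A B i" "chain_map B C p" "inj_on (i k) (carrier (grp A k))"
    "c \<in> carrier (grp C k) \<Longrightarrow> \<exists>b\<in>carrier (grp B k). p k b = c"
    "b \<in> carrier (grp B k) \<Longrightarrow> p k b = \<one>\<^bsub>grp C k\<^esub> \<Longrightarrow> \<exists>a\<in>carrier (grp A k). i k a = b"
    "a \<in> carrier (grp A k) \<Longrightarrow> p k (i k a) = \<one>\<^bsub>grp C k\<^esub>"
proof -
  have *: "chain_map A B i" "chain_map B C p" "inj_on (i k) (carrier (grp A k))"
    "p k ` carrier (grp B k) = carrier (grp C k)" "kernel (grp B k) (grp C k) (p k) = i k ` carrier (grp A k)" for k
    using assms unfolding short_exact_def by auto
  show "chain_map A B i" "chain_map B C p" "inj_on (i k) (carrier (grp A k))" using * by auto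
  show "c \<in> carrier (grp C k) \<Longrightarrow> \<exists>b\<in>carrier (grp B k). p k b = c" using *(4)[of k] by (metis imageE)
  show "b \<in> carrier (grp B k) \<Longrightarrow> p k b = \<one>\<^bsub>grp C k\<^esub> \<Longrightarrow> \<exists>a\<in>carrier (grp A k). i k a = b"
    using *(5)[of k] unfolding kernel_def by (metis (mono_tags, lifting) imageE mem_Collect_eq)
  show "a \<in> carrier (grp A k) \<Longrightarrow> p k (i k a) = \<one>\<^bsub>grp C k\<^esub>"
    using *(5)[of k] unfolding kernel_def by blast
qed

lemma short_exactI:
  assumes "chain_map A B i" "chain_map B C p" "\<And>k. inj_on (i k) (carrier (grp A k))"
    "\<And>k c. c \<in> carrier (grp C k) \<Longrightarrow> \<exists>b\<in>carrier (grp B k). p k b = c"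
    "\<And>k b. b \<in> carrier (grp B k) \<Longrightarrow> p k b = \<one>\<^bsub>grp C k\<^esub> \<Longrightarrow> \<exists>a\<in>carrier (grp A k). i k a = b"
    "\<And>k a. a \<in> carrier (grp A k) \<Longrightarrow> p k (i k a) = \<one>\<^bsub>grp C k\<^esub>"
  shows "short_exact A B C i p"
  unfolding short_exact_def kernel_def
  using assms chain_mapD(2)[OF assms(1)] chain_mapD(2)[OF assms(2)]
  by (auto simp: set_eq_iff image_iff) (metis, metis)

context
  fixes A :: "'a chain_complex" and B :: "'b chain_complex" and C :: "'c chain_complex" and i p
  assumes A: "valid_complex A" and B: "valid_complex B" and C: "valid_complex C"
    and ex: "short_exact A B C i p"
begin

private lemmas valid = valid_complexD(4)[OF A] valid_complexD(4)[OF B] valid_complexD(4)[OF C]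
  valid_complexD(5)[OF A] valid_complexD(5)[OF B] valid_complexD(5)[OF C]
  chain_mapD(2)[OF short_exactD(1)[OF ex]] chain_mapD(2)[OF short_exactD(2)[OF ex]]
private lemmas ci = chain_mapD(3)[OF short_exactD(1)[OF ex]]
private lemmas cp = chain_mapD(3)[OF short_exactD(2)[OF ex]]
private lemmas inj = inj_onD[OF short_exactD(3)[OF ex]]
private lemmas gi = chain_map_group_hom[OF A B short_exactD(1)[OF ex]]
private lemmas gp = chain_map_group_hom[OF B C short_exactD(2)[OF ex]]

lemma short_exact_cycle_cancel:
  assumes "a \<in> carrier (grp A (Suc k))" "bnd B (Suc k) (i (Suc k) a) = \<one>\<^bsub>grp B k\<^esub>"
  shows "bnd A (Suc k) a = \<one>\<^bsub>grp A k\<^esub>"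
proof -
  interpret gi: group_hom "grp A k" "grp B k" "i k" by (rule gi)
  have "i k (bnd A (Suc k) a) = i k \<one>\<^bsub>grp A k\<^esub>" using assms ci by simp
  then show ?thesis using inj assms(1) valid by blast
qed

lemma short_exact_boundary_lift:
  assumes b: "b \<in> carrier (grp B k)" and c: "c \<in> carrier (grp C (Suc k))" "p k b = bnd C (Suc k) c"
  obtains b' a where "b' \<in> carrier (grp B (Suc k))" "a \<in> carrier (grp A k)" "p (Suc k) b' = c"
    "b = bnd B (Suc k) b' \<otimes>\<^bsub>grp B k\<^esub> i k a"
proof -
  interpret GB: comm_group "grp B k" by (rule valid_complexD(1)[OF B])
  interpret gp: group_hom "grp B k" "grp C k" "p k" by (rule gp)
  obtain b' where b': "b' \<in> carrier (grp B (Suc k))" "p (Suc k) b' = c"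
    using short_exactD(4)[OF ex c(1)] by blast
  have "p k (b \<otimes>\<^bsub>grp B k\<^esub> inv\<^bsub>grp B k\<^esub> bnd B (Suc k) b') = \<one>\<^bsub>grp C k\<^esub>"
    using b b' c by (simp add: valid cp)
  then obtain a where a: "a \<in> carrier (grp A k)" "i k a = b \<otimes>\<^bsub>grp B k\<^esub> inv\<^bsub>grp B k\<^esub> bnd B (Suc k) b'"
    using short_exactD(5)[OF ex, of "b \<otimes>\<^bsub>grp B k\<^esub> inv\<^bsub>grp B k\<^esub> bnd B (Suc k) b'" k] b b' by (auto simp: valid)
  have "b = i k a \<otimes>\<^bsub>grp B k\<^esub> bnd B (Suc k) b'"
    using a b b' by (metis GB.inv_solve_right valid(2,7))
  then have "b = bnd B (Suc k) b' \<otimes>\<^bsub>grp B k\<^esub> i k a"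
    using a b b' by (simp add: GB.m_comm valid)
  then show ?thesis using that a b' by blast
qed

lemma acyclic_left:
  assumes "acyclic_complex B" "acyclic_complex C" shows "acyclic_complex A"
  unfolding acyclic_complex_def
proof (intro allI subsetI)
  fix k a assume a: "a \<in> cycles A k"
  have ac: "a \<in> carrier (grp A k)" by (rule cycles_carrier[OF A a])
  have "i k a \<in> boundaries B k"
    using chain_map_cycles[OF A B short_exactD(1)[OF ex] a] assms(1) unfolding acyclic_complex_def by blast
  then obtain b where b: "b \<in> carrier (grp B (Suc k))" "i k a = bnd B (Suc k) b" unfolding boundaries_def by blast
  have "p (Suc k) b \<in> cycles C (Suc k)"
    using b ac cp[OF b(1)] short_exactD(6)[OF ex ac] by (simp add: kernel_def valid)
  then obtain c where c: "c \<in> carrier (grp C (Suc (Suc k)))" "p (Suc k) b = bnd C (Suc (Suc k)) c"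
    using assms(2) unfolding acyclic_complex_def boundaries_def by blast
  obtain b' a' where b': "b' \<in> carrier (grp B (Suc (Suc k)))" "a' \<in> carrier (grp A (Suc k))"
    "b = bnd B (Suc (Suc k)) b' \<otimes>\<^bsub>grp B (Suc k)\<^esub> i (Suc k) a'"
    using short_exact_boundary_lift[OF b(1) c] by blast
  interpret bb: group_hom "grp B (Suc k)" "grp B k" "bnd B (Suc k)" by (rule valid_complexD(6)[OF B])
  have "i k a = i k (bnd A (Suc k) a')"
    unfolding b(2) b'(3) using b'(1,2) by (simp add: valid ci)
  then have "a = bnd A (Suc k) a'" using inj ac b'(2) valid by blast
  then show "a \<in> boundaries A k" using b'(2) unfolding boundaries_def by blast
qed

lemma acyclic_right:
  assumes "acyclic_complex A" "acyclic_complex B" shows "acyclic_complex C"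
  unfolding acyclic_complex_def
proof (intro allI subsetI)
  fix k c assume c: "c \<in> cycles C k"
  have "c \<in> carrier (grp C k)" using c subgroup.mem_carrier[OF subgroup_cycles[OF C]] by blast
  then obtain b where b: "b \<in> carrier (grp B k)" "p k b = c" using short_exactD(4)[OF ex] by blast
  have "\<exists>a\<in>carrier (grp A k). b \<otimes>\<^bsub>grp B k\<^esub> inv\<^bsub>grp B k\<^esub> i k a \<in> cycles B k"
  proof (cases k)
    case 0
    interpret G: comm_group "grp B k" by (rule valid_complexD(1)[OF B])
    interpret gi: group_hom "grp A k" "grp B k" "i k" by (rule gi)
    have "b \<otimes>\<^bsub>grp B k\<^esub> inv\<^bsub>grp B k\<^esub> i k \<one>\<^bsub>grp A k\<^esub> = b" using b by simp
    moreover have "b \<in> cycles B k" using 0 b by simp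
    ultimately show ?thesis using gi.G.one_closed by metis
  next
    case (Suc j)
    interpret GB: comm_group "grp B k" by (rule valid_complexD(1)[OF B])
    interpret bb: group_hom "grp B (Suc j)" "grp B j" "bnd B (Suc j)" by (rule valid_complexD(6)[OF B])
    have "p j (bnd B (Suc j) b) = \<one>\<^bsub>grp C j\<^esub>" using c b cp[of b j] by (simp add: kernel_def Suc)
    then obtain a where a: "a \<in> carrier (grp A j)" "i j a = bnd B (Suc j) b"
      using short_exactD(5)[OF ex, of "bnd B (Suc j) b" j] b by (auto simp: valid Suc)
    have "a \<in> cycles A j"
    proof (cases j)
      case 0 then show ?thesis using a by simp
    next
      case (Suc l)
      then show ?thesis using a b \<open>k = Suc j\<close> short_exact_cycle_cancel[of a l] by (auto simp: kernel_def valid)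
    qed
    then obtain a' where a': "a' \<in> carrier (grp A (Suc j))" "a = bnd A (Suc j) a'"
      using assms(1) unfolding acyclic_complex_def boundaries_def by blast
    have "bnd B (Suc j) (b \<otimes>\<^bsub>grp B (Suc j)\<^esub> inv\<^bsub>grp B (Suc j)\<^esub> i (Suc j) a') = \<one>\<^bsub>grp B j\<^esub>"
      using a a' b ci[OF a'(1)] unfolding Suc by (simp add: valid)
    then show ?thesis using a' b unfolding Suc by (intro bexI[of _ a']) (auto simp: kernel_def valid)
  qed
  then obtain a where a: "a \<in> carrier (grp A k)" "b \<otimes>\<^bsub>grp B k\<^esub> inv\<^bsub>grp B k\<^esub> i k a \<in> cycles B k" by blast
  then obtain b' where b': "b' \<in> carrier (grp B (Suc k))" "b \<otimes>\<^bsub>grp B k\<^esub> inv\<^bsub>grp B k\<^esub> i k a = bnd B (Suc k) b'"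
    using assms(2) unfolding acyclic_complex_def boundaries_def by blast
  interpret gp: group_hom "grp B k" "grp C k" "p k" by (rule gp)
  have "c = p k (b \<otimes>\<^bsub>grp B k\<^esub> inv\<^bsub>grp B k\<^esub> i k a)"
    using a(1) b short_exactD(6)[OF ex a(1)] \<open>c \<in> carrier (grp C k)\<close> by (simp add: valid)
  also have "\<dots> = bnd C (Suc k) (p (Suc k) b')" unfolding b'(2) using cp[OF b'(1)] .
  finally show "c \<in> boundaries C k" using valid(8)[OF b'(1)] unfolding boundaries_def by blast
qed

text \<open>The criterion behind the coincidence of the kinds of critical points: whether an injective
  chain map is a homology isomorphism depends only on its cokernel.\<close>

lemma homology_iso_iff_acyclic_cokernel:
  "homology_iso A B i \<longleftrightarrow> acyclic_complex C"
  unfolding homology_iso_iff_acyclic_cone[OF A B short_exactD(1)[OF ex]] acyclic_cone_iff[OF A B short_exactD(1)[OF ex]]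
proof
  assume H: "(\<forall>b\<in>carrier (grp B 0). \<exists>e\<in>carrier (grp A 0). \<exists>d\<in>carrier (grp B 1).
        b = i 0 e \<otimes>\<^bsub>grp B 0\<^esub> inv\<^bsub>grp B 0\<^esub> bnd B 1 d) \<and>
    (\<forall>k. \<forall>a\<in>cycles A k. \<forall>b\<in>carrier (grp B (Suc k)). i k a = bnd B (Suc k) b \<longrightarrow>
      (\<exists>e\<in>carrier (grp A (Suc k)). \<exists>d\<in>carrier (grp B (Suc (Suc k))).
         a = bnd A (Suc k) e \<and> b = i (Suc k) e \<otimes>\<^bsub>grp B (Suc k)\<^esub> inv\<^bsub>grp B (Suc k)\<^esub> bnd B (Suc (Suc k)) d))"
  show "acyclic_complex C" unfolding acyclic_complex_def
  proof (intro allI subsetI)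
    fix k c assume c: "c \<in> cycles C k"
    have "c \<in> carrier (grp C k)" using c subgroup.mem_carrier[OF subgroup_cycles[OF C]] by blast
    then obtain b where b: "b \<in> carrier (grp B k)" "p k b = c" using short_exactD(4)[OF ex] by blast
    have "\<exists>e\<in>carrier (grp A k). \<exists>d\<in>carrier (grp B (Suc k)). b = i k e \<otimes>\<^bsub>grp B k\<^esub> inv\<^bsub>grp B k\<^esub> bnd B (Suc k) d"
    proof (cases k)
      case 0 then show ?thesis using H b by simp
    next
      case (Suc j)
      have "p j (bnd B (Suc j) b) = \<one>\<^bsub>grp C j\<^esub>" using c b cp[of b j] by (simp add: kernel_def Suc)
      then obtain a where a: "a \<in> carrier (grp A j)" "i j a = bnd B (Suc j) b"
        using short_exactD(5)[OF ex, of "bnd B (Suc j) b" j] b by (auto simp: valid Suc)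
      have "a \<in> cycles A j"
      proof (cases j)
        case 0 then show ?thesis using a by simp
      next
        case (Suc l)
        then show ?thesis using a b \<open>k = Suc j\<close> short_exact_cycle_cancel[of a l] by (auto simp: kernel_def valid)
      qed
      then show ?thesis using H a b unfolding Suc by metis
    qed
    then obtain e d where ed: "e\<in>carrier (grp A k)" "d\<in>carrier (grp B (Suc k))"
      "b = i k e \<otimes>\<^bsub>grp B k\<^esub> inv\<^bsub>grp B k\<^esub> bnd B (Suc k) d" by blast
    interpret gp: group_hom "grp B k" "grp C k" "p k" by (rule gp)
    interpret bb: group_hom "grp B (Suc k)" "grp B k" "bnd B (Suc k)" by (rule valid_complexD(6)[OF B])
    have "c = p k (bnd B (Suc k) (inv\<^bsub>grp B (Suc k)\<^esub> d))"
      using ed b short_exactD(6)[OF ex ed(1)] by (auto simp: valid)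
    also have "\<dots> = bnd C (Suc k) (p (Suc k) (inv\<^bsub>grp B (Suc k)\<^esub> d))" by (rule cp) (use ed bb.G.inv_closed in blast)
    finally show "c \<in> boundaries C k" using ed(2) unfolding boundaries_def by (auto simp: valid)
  qed
next
  assume acy: "acyclic_complex C"
  have main: "\<exists>e\<in>carrier (grp A k). \<exists>d\<in>carrier (grp B (Suc k)). b = i k e \<otimes>\<^bsub>grp B k\<^esub> inv\<^bsub>grp B k\<^esub> bnd B (Suc k) d"
    if b: "b \<in> carrier (grp B k)" "p k b \<in> cycles C k" for b k
  proof -
    obtain c where c: "c \<in> carrier (grp C (Suc k))" "p k b = bnd C (Suc k) c"
      using acy b unfolding acyclic_complex_def boundaries_def by blast
    obtain b' a where b': "b' \<in> carrier (grp B (Suc k))" "a \<in> carrier (grp A k)"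
      "b = bnd B (Suc k) b' \<otimes>\<^bsub>grp B k\<^esub> i k a"
      using short_exact_boundary_lift[OF b(1) c] by blast
    interpret GB: comm_group "grp B k" by (rule valid_complexD(1)[OF B])
    interpret bb: group_hom "grp B (Suc k)" "grp B k" "bnd B (Suc k)" by (rule valid_complexD(6)[OF B])
    have "b = i k a \<otimes>\<^bsub>grp B k\<^esub> inv\<^bsub>grp B k\<^esub> bnd B (Suc k) (inv\<^bsub>grp B (Suc k)\<^esub> b')"
      using b' by (simp add: valid GB.m_comm)
    then show ?thesis using b' bb.G.inv_closed by blast
  qed
  show "(\<forall>b\<in>carrier (grp B 0). \<exists>e\<in>carrier (grp A 0). \<exists>d\<in>carrier (grp B 1).
        b = i 0 e \<otimes>\<^bsub>grp B 0\<^esub> inv\<^bsub>grp B 0\<^esub> bnd B 1 d) \<and>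
    (\<forall>k. \<forall>a\<in>cycles A k. \<forall>b\<in>carrier (grp B (Suc k)). i k a = bnd B (Suc k) b \<longrightarrow>
      (\<exists>e\<in>carrier (grp A (Suc k)). \<exists>d\<in>carrier (grp B (Suc (Suc k))).
         a = bnd A (Suc k) e \<and> b = i (Suc k) e \<otimes>\<^bsub>grp B (Suc k)\<^esub> inv\<^bsub>grp B (Suc k)\<^esub> bnd B (Suc (Suc k)) d))"
  proof (intro conjI allI ballI impI)
    fix b assume "b \<in> carrier (grp B 0)"
    then show "\<exists>e\<in>carrier (grp A 0). \<exists>d\<in>carrier (grp B 1). b = i 0 e \<otimes>\<^bsub>grp B 0\<^esub> inv\<^bsub>grp B 0\<^esub> bnd B 1 d"
      using main[of b 0] by (simp add: valid)
  next
    fix k a b assume ab: "a \<in> cycles A k" "b \<in> carrier (grp B (Suc k))" "i k a = bnd B (Suc k) b"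
    have ac: "a \<in> carrier (grp A k)" using ab(1) subgroup.mem_carrier[OF subgroup_cycles[OF A]] by blast
    have "p (Suc k) b \<in> cycles C (Suc k)"
      using ab ac cp[OF ab(2)] short_exactD(6)[OF ex ac] by (simp add: kernel_def valid)
    then obtain e d where ed: "e\<in>carrier (grp A (Suc k))" "d\<in>carrier (grp B (Suc (Suc k)))"
      "b = i (Suc k) e \<otimes>\<^bsub>grp B (Suc k)\<^esub> inv\<^bsub>grp B (Suc k)\<^esub> bnd B (Suc (Suc k)) d"
      using main[OF ab(2)] by blast
    interpret bb: group_hom "grp B (Suc k)" "grp B k" "bnd B (Suc k)" by (rule valid_complexD(6)[OF B])
    have "i k a = i k (bnd A (Suc k) e)" unfolding ab(3) ed(3) using ed(1,2) by (simp add: valid ci)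
    then have "a = bnd A (Suc k) e" using inj ac ed(1) valid by blast
    then show "\<exists>e\<in>carrier (grp A (Suc k)). \<exists>d\<in>carrier (grp B (Suc (Suc k))).
         a = bnd A (Suc k) e \<and> b = i (Suc k) e \<otimes>\<^bsub>grp B (Suc k)\<^esub> inv\<^bsub>grp B (Suc k)\<^esub> bnd B (Suc (Suc k)) d"
      using ed by blast
  qed
qed

end

section \<open>The five lemma\<close>

text \<open>The map of cones induced by a commutative square. In degree 0 the truncated subtraction yields
  \<open>i 0\<close>, applied to the neutral element, as it should be.\<close>

definition cone_map :: "(nat \<Rightarrow> 'a \<Rightarrow> 'b) \<Rightarrow> (nat \<Rightarrow> 'c \<Rightarrow> 'd) \<Rightarrow> nat \<Rightarrow> 'a \<times> 'c \<Rightarrow> 'b \<times> 'd" where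
  "cone_map i i' k = (\<lambda>(a, b). (i (k - 1) a, i' k b))"

lemma chain_map_cone_map:
  assumes A: "valid_complex A" and A': "valid_complex A'" and B: "valid_complex B" and B': "valid_complex B'"
    and i: "chain_map A B i" and i': "chain_map A' B' i'"
    and \<alpha>: "chain_map A A' \<alpha>" and \<beta>: "chain_map B B' \<beta>"
    and sq: "\<And>k x. x \<in> carrier (grp A k) \<Longrightarrow> \<beta> k (i k x) = i' k (\<alpha> k x)"
  shows "chain_map (cone A A' \<alpha>) (cone B B' \<beta>) (cone_map i i')"
  unfolding chain_map_def cone_def chain_complex.select_convs
proof (intro conjI allI ballI)
  note gi = chain_map_group_hom[OF A B i] and gi' = chain_map_group_hom[OF A' B' i']
  show "cone_map i i' k \<in> hom (cone_grp A A' k) (cone_grp B B' k)" for k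
  proof (rule homI)
    fix x assume "x \<in> carrier (cone_grp A A' k)"
    then show "cone_map i i' k x \<in> carrier (cone_grp B B' k)"
      using group_hom.hom_one[OF gi] chain_mapD(2)[OF i] chain_mapD(2)[OF i']
      by (cases x; cases k) (auto simp: cone_map_def)
    fix y assume "y \<in> carrier (cone_grp A A' k)"
    then show "cone_map i i' k (x \<otimes>\<^bsub>cone_grp A A' k\<^esub> y) = cone_map i i' k x \<otimes>\<^bsub>cone_grp B B' k\<^esub> cone_map i i' k y"
      using \<open>x \<in> carrier (cone_grp A A' k)\<close> group.is_monoid[OF valid_complexD(2)[OF A]] group.is_monoid[OF valid_complexD(2)[OF B]]
      by (cases x; cases y; cases k)
        (auto simp: cone_map_def group_hom.hom_mult[OF gi] group_hom.hom_mult[OF gi'] group_hom.hom_one[OF gi] monoid.r_one)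
  qed
  fix k z assume "z \<in> carrier (cone_grp A A' (Suc k))"
  then obtain a b where z: "z = (a,b)" "a \<in> carrier (grp A k)" "b \<in> carrier (grp A' (Suc k))" by (cases z) auto
  have "\<alpha> k a \<in> carrier (grp A' k)" "bnd A' (Suc k) b \<in> carrier (grp A' k)"
    using z chain_mapD(2)[OF \<alpha>] valid_complexD(4)[OF A'] by auto
  then have "i' k (\<alpha> k a \<otimes>\<^bsub>grp A' k\<^esub> inv\<^bsub>grp A' k\<^esub> bnd A' (Suc k) b)
    = \<beta> k (i k a) \<otimes>\<^bsub>grp B' k\<^esub> inv\<^bsub>grp B' k\<^esub> bnd B' (Suc k) (i' (Suc k) b)"
    using group_hom.hom_mult[OF gi'] group_hom.hom_inv[OF gi'] group.inv_closed[OF valid_complexD(2)[OF A']]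
      sq[OF z(2)] chain_mapD(3)[OF i' z(3)] by simp
  then show "cone_map i i' k (cone_bnd A A' \<alpha> (Suc k) z) = cone_bnd B B' \<beta> (Suc k) (cone_map i i' (Suc k) z)"
    using z group_hom.hom_one[OF gi] chain_mapD(3)[OF i] by (cases k) (simp_all add: cone_map_def)
qed

lemma short_exact_cone:
  assumes A: "valid_complex A" and A': "valid_complex A'" and B: "valid_complex B" and B': "valid_complex B'"
    and C: "valid_complex C" and C': "valid_complex C'"
    and ex: "short_exact A B C i p" and ex': "short_exact A' B' C' i' p'"
    and \<alpha>: "chain_map A A' \<alpha>" and \<beta>: "chain_map B B' \<beta>" and \<gamma>: "chain_map C C' \<gamma>"
    and sq1: "\<And>k x. x \<in> carrier (grp A k) \<Longrightarrow> \<beta> k (i k x) = i' k (\<alpha> k x)"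
    and sq2: "\<And>k x. x \<in> carrier (grp B k) \<Longrightarrow> \<gamma> k (p k x) = p' k (\<beta> k x)"
  shows "short_exact (cone A A' \<alpha>) (cone B B' \<beta>) (cone C C' \<gamma>) (cone_map i i') (cone_map p p')"
proof (rule short_exactI)
  note E = short_exactD[OF ex] and E' = short_exactD[OF ex']
  note one = group_hom.hom_one[OF chain_map_group_hom[OF A B E(1)]] group_hom.hom_one[OF chain_map_group_hom[OF B C E(2)]]
  note oc = group.is_monoid[OF valid_complexD(2)[OF A]] group.is_monoid[OF valid_complexD(2)[OF B]]
  show "chain_map (cone A A' \<alpha>) (cone B B' \<beta>) (cone_map i i')"
    by (rule chain_map_cone_map[OF A A' B B' E(1) E'(1) \<alpha> \<beta> sq1])
  show "chain_map (cone B B' \<beta>) (cone C C' \<gamma>) (cone_map p p')"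
    by (rule chain_map_cone_map[OF B B' C C' E(2) E'(2) \<beta> \<gamma> sq2])
  fix k
  show "inj_on (cone_map i i' k) (carrier (grp (cone A A' \<alpha>) k))"
    using E(3) E'(3) by (cases k) (auto simp: inj_on_def cone_map_def cone_def)
  show "\<exists>b\<in>carrier (grp (cone B B' \<beta>) k). cone_map p p' k b = c"
    if c: "c \<in> carrier (grp (cone C C' \<gamma>) k)" for c
  proof (cases k)
    case 0
    then obtain y where y: "c = (\<one>\<^bsub>grp C 0\<^esub>, y)" "y \<in> carrier (grp C' 0)" using c by (auto simp: cone_def)
    obtain b where "b \<in> carrier (grp B' 0)" "p' 0 b = y" using E'(4)[OF y(2)] by blast
    then show ?thesis using 0 y one by (intro bexI[of _ "(\<one>\<^bsub>grp B 0\<^esub>, b)"]) (auto simp: cone_def cone_map_def)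
  next
    case (Suc j)
    then obtain x y where y: "c = (x, y)" "x \<in> carrier (grp C j)" "y \<in> carrier (grp C' k)" using c by (auto simp: cone_def)
    obtain a b where "b \<in> carrier (grp B' k)" "p' k b = y" "a \<in> carrier (grp B j)" "p j a = x" using E'(4)[OF y(3)] E(4)[OF y(2)] by blast
    then show ?thesis using Suc y by (intro bexI[of _ "(a, b)"]) (auto simp: cone_def cone_map_def)
  qed
  show "\<exists>a\<in>carrier (grp (cone A A' \<alpha>) k). cone_map i i' k a = b"
    if b: "b \<in> carrier (grp (cone B B' \<beta>) k)" and pb: "cone_map p p' k b = \<one>\<^bsub>grp (cone C C' \<gamma>) k\<^esub>" for b
  proof (cases k)
    case 0
    then obtain y where y: "b = (\<one>\<^bsub>grp B 0\<^esub>, y)" "y \<in> carrier (grp B' 0)" using b by (auto simp: cone_def)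
    have "p' 0 y = \<one>\<^bsub>grp C' 0\<^esub>" using pb y 0 by (auto simp: cone_def cone_map_def)
    then obtain a where "a \<in> carrier (grp A' 0)" "i' 0 a = y" using E'(5)[OF y(2)] by blast
    then show ?thesis using 0 y one by (intro bexI[of _ "(\<one>\<^bsub>grp A 0\<^esub>, a)"]) (auto simp: cone_def cone_map_def)
  next
    case (Suc j)
    then obtain x y where y: "b = (x, y)" "x \<in> carrier (grp B j)" "y \<in> carrier (grp B' k)" using b by (auto simp: cone_def)
    have "p' k y = \<one>\<^bsub>grp C' k\<^esub>" "p j x = \<one>\<^bsub>grp C j\<^esub>" using pb y Suc by (auto simp: cone_def cone_map_def)
    then obtain a c where "a \<in> carrier (grp A j)" "i j a = x" "c \<in> carrier (grp A' k)" "i' k c = y"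
      using E'(5)[OF y(3)] E(5)[OF y(2)] by blast
    then show ?thesis using Suc y by (intro bexI[of _ "(a, c)"]) (auto simp: cone_def cone_map_def)
  qed
  show "cone_map p p' k (cone_map i i' k a) = \<one>\<^bsub>grp (cone C C' \<gamma>) k\<^esub>"
    if "a \<in> carrier (grp (cone A A' \<alpha>) k)" for a
    using that E(6) E'(6) one by (cases a; cases k) (auto simp: cone_def cone_map_def)
qed

lemma
  assumes A: "valid_complex A" and A': "valid_complex A'" and B: "valid_complex B" and B': "valid_complex B'"
    and C: "valid_complex C" and C': "valid_complex C'"
    and ex: "short_exact A B C i p" and ex': "short_exact A' B' C' i' p'"
    and \<alpha>: "chain_map A A' \<alpha>" and \<beta>: "chain_map B B' \<beta>" and \<gamma>: "chain_map C C' \<gamma>"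
    and sq1: "\<And>k x. x \<in> carrier (grp A k) \<Longrightarrow> \<beta> k (i k x) = i' k (\<alpha> k x)"
    and sq2: "\<And>k x. x \<in> carrier (grp B k) \<Longrightarrow> \<gamma> k (p k x) = p' k (\<beta> k x)"
  shows homology_iso_left: "homology_iso B B' \<beta> \<Longrightarrow> homology_iso C C' \<gamma> \<Longrightarrow> homology_iso A A' \<alpha>"
    and homology_iso_right: "homology_iso A A' \<alpha> \<Longrightarrow> homology_iso B B' \<beta> \<Longrightarrow> homology_iso C C' \<gamma>"
proof -
  note cones = valid_cone[OF A A' \<alpha>] valid_cone[OF B B' \<beta>] valid_cone[OF C C' \<gamma>]
    short_exact_cone[OF A A' B B' C C' ex ex' \<alpha> \<beta> \<gamma> sq1 sq2]
  show "homology_iso B B' \<beta> \<Longrightarrow> homology_iso C C' \<gamma> \<Longrightarrow> homology_iso A A' \<alpha>"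
    "homology_iso A A' \<alpha> \<Longrightarrow> homology_iso B B' \<beta> \<Longrightarrow> homology_iso C C' \<gamma>"
    unfolding homology_iso_iff_acyclic_cone[OF A A' \<alpha>] homology_iso_iff_acyclic_cone[OF B B' \<beta>]
      homology_iso_iff_acyclic_cone[OF C C' \<gamma>]
    using acyclic_left[OF cones] acyclic_right[OF cones] by blast+
qed

section \<open>Tensoring complexes with a field\<close>

definition torsion_free :: "('c, 'm) monoid_scheme \<Rightarrow> bool" where
  "torsion_free G \<longleftrightarrow> (\<forall>x\<in>carrier G. \<forall>n>(0::nat). x [^]\<^bsub>G\<^esub> n = \<one>\<^bsub>G\<^esub> \<longrightarrow> x = \<one>\<^bsub>G\<^esub>)"

lemma tensor_map_one:
  fixes A :: "'c monoid" and B :: "'b monoid" and u :: "('c, 'f::field) tensor"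
  assumes "comm_group A" "comm_group B" "\<And>a. a \<in> carrier A \<Longrightarrow> h a = \<one>\<^bsub>B\<^esub>"
    and u: "u \<in> carrier (tensor_group A)"
  shows "tensor_map B h u = \<one>\<^bsub>tensor_group B\<^esub>"
proof -
  interpret TB: comm_group "tensor_group B :: ('b, 'f) tensor monoid" by (rule comm_group_tensor_group[OF assms(2)])
  interpret A: comm_group A by fact
  interpret B: comm_group B by fact
  have h: "h \<in> hom A B" by (rule homI) (use assms in auto)
  have z: "tens B \<one>\<^bsub>B\<^esub> x = \<one>\<^bsub>tensor_group B\<^esub>" for x :: 'f
    by (rule hom_one[OF tens_hom_left[OF assms(2)] B.is_group TB.is_group])
  have one: "(\<lambda>_. \<one>\<^bsub>tensor_group B\<^esub> :: ('b, 'f) tensor) \<in> hom (tensor_group A :: ('c, 'f) tensor monoid) (tensor_group B)"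
    by (rule homI) auto
  show ?thesis
    by (rule tensor_group_hom_eqI[OF assms(1) TB.comm_group_axioms tensor_map_hom[OF assms(1,2) h] one _ u])
      (simp add: tensor_map_tens[OF assms(1,2) h] assms(3) z)
qed

lemma tensor_map_surj:
  fixes A :: "'c monoid" and u :: "('d, 'f::field) tensor"
  assumes A: "comm_group A" and B: "comm_group B" and h: "h \<in> hom A B" and surj: "carrier B \<subseteq> h ` carrier A"
    and u: "u \<in> carrier (tensor_group B)"
  shows "u \<in> tensor_map B h ` carrier (tensor_group A)"
proof -
  interpret TB: comm_group "tensor_group B :: ('d, 'f) tensor monoid" by (rule comm_group_tensor_group[OF B])
  interpret TA: comm_group "tensor_group A :: ('c, 'f) tensor monoid" by (rule comm_group_tensor_group[OF A])
  interpret Th: group_hom "tensor_group A :: ('c, 'f) tensor monoid" "tensor_group B" "tensor_map B h"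
    by unfold_locales (rule tensor_map_hom[OF A B h])
  let ?W = "tensor_map B h ` carrier (tensor_group A :: ('c, 'f) tensor monoid)"
  have W: "subgroup ?W (tensor_group B)" by (rule Th.img_is_subgroup)
  have one: "(\<lambda>_. ?W) \<in> hom (tensor_group B) (tensor_group B Mod ?W)"
    using group.is_monoid[OF comm_group.axioms(2)[OF TB.abelian_FactGroup[OF W]]] monoid.one_closed monoid.l_one
    by (intro homI) fastforce+
  have "?W #>\<^bsub>tensor_group B\<^esub> u = ?W"
  proof (rule tensor_group_hom_eqI[OF B TB.abelian_FactGroup[OF W] TB.FactGroup_coset_hom[OF W] one _ u])
    fix b and x :: 'f assume b: "b \<in> carrier B"
    then obtain a where a: "a \<in> carrier A" "b = h a" using surj by blast
    then have "tens B b x \<in> ?W" using tensor_map_tens[OF A B h a(1), of x] tens_closed[OF a(1), of x] by (metis imageI)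
    then show "?W #>\<^bsub>tensor_group B\<^esub> tens B b x = ?W"
      using TB.coset_eq_subgroup_iff[OF W tens_closed[OF b]] by blast
  qed
  then show ?thesis using TB.coset_eq_subgroup_iff[OF W u] by blast
qed

lemma tensor_complex_simps:
  "grp (tensor_complex C) k = tensor_group (grp C k)"
  "bnd (tensor_complex C) (Suc k) = tensor_map (grp C k) (bnd C (Suc k))"
  by (simp_all add: tensor_complex_def)

lemma valid_tensor_complex:
  assumes C: "valid_complex C"
  shows "valid_complex (tensor_complex C :: ('c, 'f::field) tensor chain_complex)"
  unfolding valid_complex_def tensor_complex_simps
proof (intro conjI allI ballI)
  note v = valid_complexD[OF C]
  show "comm_group (tensor_group (grp C k) :: ('c, 'f) tensor monoid)" for k
    by (rule comm_group_tensor_group[OF v(1)])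
  show "tensor_map (grp C k) (bnd C (Suc k)) \<in> hom (tensor_group (grp C (Suc k)) :: ('c, 'f) tensor monoid) (tensor_group (grp C k))" for k
    by (rule tensor_map_hom[OF v(1) v(1) v(3)])
  fix k and u :: "('c, 'f) tensor" assume u: "u \<in> carrier (tensor_group (grp C (Suc (Suc k))))"
  have one: "(\<lambda>_. \<one>\<^bsub>grp C k\<^esub>) \<in> hom (grp C (Suc (Suc k))) (grp C k)"
    using group.is_monoid[OF v(2)[of k]] by (intro homI) (auto simp: monoid.one_closed monoid.l_one)
  have "tensor_map (grp C k) (bnd C (Suc k)) (tensor_map (grp C (Suc k)) (bnd C (Suc (Suc k))) u)
    = tensor_map (grp C k) (\<lambda>_. \<one>\<^bsub>grp C k\<^esub>) u"
    by (rule tensor_map_comp[OF v(1) v(1) v(1) v(3) v(3) one v(5) u])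
  also have "\<dots> = \<one>\<^bsub>tensor_group (grp C k)\<^esub>" by (rule tensor_map_one[OF v(1) v(1) _ u]) simp
  finally show "tensor_map (grp C k) (bnd C (Suc k)) (tensor_map (grp C (Suc k)) (bnd C (Suc (Suc k))) u)
    = \<one>\<^bsub>tensor_group (grp C k)\<^esub>" .
qed

lemma chain_map_tensor:
  assumes C: "valid_complex C" and C': "valid_complex C'" and h: "chain_map C C' h"
  shows "chain_map (tensor_complex C :: ('c, 'f::field) tensor chain_complex) (tensor_complex C')
    (\<lambda>k. tensor_map (grp C' k) (h k))"
  unfolding chain_map_def tensor_complex_simps
proof (intro conjI allI ballI)
  note v = valid_complexD[OF C] and v' = valid_complexD[OF C'] and h = chain_mapD[OF h]
  show "tensor_map (grp C' k) (h k) \<in> hom (tensor_group (grp C k) :: ('c, 'f) tensor monoid) (tensor_group (grp C' k))" for k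
    by (rule tensor_map_hom[OF v(1) v'(1) h(1)])
  fix k and u :: "('c, 'f) tensor" assume u: "u \<in> carrier (tensor_group (grp C (Suc k)))"
  have comp: "h k \<circ> bnd C (Suc k) \<in> hom (grp C (Suc k)) (grp C' k)" by (rule hom_compose[OF v(3) h(1)])
  have "tensor_map (grp C' k) (h k) (tensor_map (grp C k) (bnd C (Suc k)) u) = tensor_map (grp C' k) (h k \<circ> bnd C (Suc k)) u"
    by (rule tensor_map_comp[OF v(1) v(1) v'(1) v(3) h(1) comp _ u]) simp
  also have "\<dots> = tensor_map (grp C' k) (bnd C' (Suc k)) (tensor_map (grp C' (Suc k)) (h (Suc k)) u)"
    by (rule tensor_map_comp[symmetric, OF v(1) v'(1) v'(1) h(1) v'(3) comp _ u]) (simp add: h(3))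
  finally show "tensor_map (grp C' k) (h k) (tensor_map (grp C k) (bnd C (Suc k)) u) =
    tensor_map (grp C' k) (bnd C' (Suc k)) (tensor_map (grp C' (Suc k)) (h (Suc k)) u)" .
qed

lemma pure_if_torsion_free_quotient:
  assumes "comm_group B" "comm_group C" and p: "p \<in> hom B C" and tf: "torsion_free C"
    and ker: "kernel B C p = S" and b: "b \<in> carrier B" "n > (0::nat)" "b [^]\<^bsub>B\<^esub> n \<in> S"
  shows "b \<in> S"
proof -
  interpret B: comm_group B by fact
  interpret C: comm_group C by fact
  interpret p: group_hom B C p by unfold_locales (rule p)
  have "p b [^]\<^bsub>C\<^esub> n = \<one>\<^bsub>C\<^esub>" using b ker p.hom_nat_pow[of b n] by (auto simp: kernel_def)
  then have "p b = \<one>\<^bsub>C\<^esub>" using tf b unfolding torsion_free_def by auto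
  then show ?thesis using b ker by (auto simp: kernel_def)
qed

text \<open>The left end stays exact because the quotient is torsion-free. The left and the middle complex may
  have torsion, as quotients by the infimum of a graded subgroup do in general.\<close>

lemma short_exact_tensor:
  assumes A: "valid_complex A" and B: "valid_complex B" and C: "valid_complex C" and ex: "short_exact A B C i p"
    and tf: "\<And>k. torsion_free (grp C k)"
  shows "short_exact (tensor_complex A :: ('a, 'f::field) tensor chain_complex) (tensor_complex B) (tensor_complex C)
    (\<lambda>k. tensor_map (grp B k) (i k)) (\<lambda>k. tensor_map (grp C k) (p k))"
proof (rule short_exactI)
  note E = short_exactD[OF ex]
  show "chain_map (tensor_complex A :: ('a, 'f) tensor chain_complex) (tensor_complex B) (\<lambda>k. tensor_map (grp B k) (i k))"
    by (rule chain_map_tensor[OF A B E(1)])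
  show "chain_map (tensor_complex B :: ('b, 'f) tensor chain_complex) (tensor_complex C) (\<lambda>k. tensor_map (grp C k) (p k))"
    by (rule chain_map_tensor[OF B C E(2)])
  fix k
  note a = valid_complexD(1)[OF A, of k] and b = valid_complexD(1)[OF B, of k] and c = valid_complexD(1)[OF C, of k]
  note i = chain_mapD(1)[OF E(1), of k] and p = chain_mapD(1)[OF E(2), of k]
  have ker: "kernel (grp B k) (grp C k) (p k) = i k ` carrier (grp A k)" using ex unfolding short_exact_def by blast
  show "inj_on (tensor_map (grp B k) (i k)) (carrier (grp (tensor_complex A :: ('a, 'f) tensor chain_complex) k))"
    unfolding tensor_complex_simps
    by (rule tensor_map_inj[OF a b i E(3) pure_if_torsion_free_quotient[OF b c p tf ker]])
  show "\<exists>b\<in>carrier (grp (tensor_complex B) k). tensor_map (grp C k) (p k) b = u"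
    if "u \<in> carrier (grp (tensor_complex C) k)" for u :: "('c, 'f) tensor"
    using tensor_map_surj[OF b c p _ that[unfolded tensor_complex_simps]] E(4)[of _ k] unfolding tensor_complex_simps by blast
  show "\<exists>a\<in>carrier (grp (tensor_complex A) k). tensor_map (grp B k) (i k) a = u"
    if u: "u \<in> carrier (grp (tensor_complex B) k)" "tensor_map (grp C k) (p k) u = \<one>\<^bsub>grp (tensor_complex C) k\<^esub>"
    for u :: "('b, 'f) tensor"
  proof -
    have "u \<in> tensor_map (grp B k) (i k) ` carrier (tensor_group (grp A k))"
    proof (rule tensor_right_exact[OF a b c i p _ _ u[unfolded tensor_complex_simps]])
      show "carrier (grp C k) \<subseteq> p k ` carrier (grp B k)" using E(4) by blast
      show "z \<in> i k ` carrier (grp A k)" if "z \<in> carrier (grp B k)" "p k z = \<one>\<^bsub>grp C k\<^esub>" for z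
        using E(5)[OF that] by blast
    qed
    then show ?thesis unfolding tensor_complex_simps by blast
  qed
  show "tensor_map (grp C k) (p k) (tensor_map (grp B k) (i k) u) = \<one>\<^bsub>grp (tensor_complex C) k\<^esub>"
    if u: "u \<in> carrier (grp (tensor_complex A) k)" for u :: "('a, 'f) tensor"
  proof -
    have comp: "p k \<circ> i k \<in> hom (grp A k) (grp C k)" by (rule hom_compose[OF i p])
    have "tensor_map (grp C k) (p k) (tensor_map (grp B k) (i k) u) = tensor_map (grp C k) (p k \<circ> i k) u"
      by (rule tensor_map_comp[OF a b c i p comp _ u[unfolded tensor_complex_simps]]) simp
    also have "\<dots> = \<one>\<^bsub>tensor_group (grp C k)\<^esub>"
      by (rule tensor_map_one[OF a c _ u[unfolded tensor_complex_simps]]) (simp add: E(6))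
    finally show ?thesis unfolding tensor_complex_simps .
  qed
qed

text \<open>In an acyclic complex the group \<open>B\<^sub>j\<close> of boundaries in degree \<open>j\<close> is the kernel of the next
  boundary map, so it has a torsion-free quotient and \<open>B\<^sub>j \<otimes> F\<close> embeds into \<open>C\<^sub>j \<otimes> F\<close>. A cycle of
  \<open>C \<otimes> F\<close> in degree \<open>j + 1\<close> is therefore already mapped to zero in \<open>B\<^sub>j \<otimes> F\<close>, and right exactness of
  \<open>C\<^sub>j\<^sub>+\<^sub>2 \<rightarrow> C\<^sub>j\<^sub>+\<^sub>1 \<rightarrow> B\<^sub>j \<rightarrow> 0\<close> shows that it is a boundary.\<close>

lemma acyclic_tensor:
  assumes C: "valid_complex C" and tf: "\<And>k. torsion_free (grp C k)" and acy: "acyclic_complex C"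
  shows "acyclic_complex (tensor_complex C :: ('c, 'f::field) tensor chain_complex)"
  unfolding acyclic_complex_def
proof (intro allI subsetI)
  note v = valid_complexD[OF C]
  have exact: "cycles C k = boundaries C k" for k
    using acy boundaries_subset_cycles[OF C] unfolding acyclic_complex_def by blast
  fix k and u :: "('c, 'f) tensor" assume u: "u \<in> cycles (tensor_complex C) k"
  have uc: "u \<in> carrier (tensor_group (grp C k))"
    using cycles_carrier[OF valid_tensor_complex[OF C] u] unfolding tensor_complex_simps .
  have "u \<in> tensor_map (grp C k) (bnd C (Suc k)) ` carrier (tensor_group (grp C (Suc k)))"
  proof (cases k)
    case 0
    then show ?thesis using exact[of 0] unfolding boundaries_def by (intro tensor_map_surj[OF v(1) v(1) v(3) _ uc]) simp
  next
    case (Suc j)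
    define D where "D = (grp C j)\<lparr>carrier := boundaries C j\<rparr>"
    have D: "comm_group D" unfolding D_def
      by (rule comm_group.comm_group_subgroup[OF v(1) subgroup_boundaries[OF C]])
    have bD: "bnd C (Suc j) \<in> hom (grp C (Suc j)) D"
      using v(3)[of j] unfolding D_def hom_def boundaries_def by auto
    have inc: "(\<lambda>x. x) \<in> hom D (grp C j)"
      using subgroup.subset[OF subgroup_boundaries[OF C]] unfolding D_def hom_def by auto
    have pure: "b \<in> (\<lambda>x. x) ` carrier D"
      if b: "b \<in> carrier (grp C j)" "n > (0::nat)" "b [^]\<^bsub>grp C j\<^esub> n \<in> (\<lambda>x. x) ` carrier D" for b n
    proof (cases j)
      case 0 then show ?thesis using b exact[of 0] unfolding D_def by simp
    next
      case (Suc l)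
      have "kernel (grp C j) (grp C l) (bnd C j) = boundaries C j" using exact[of j] Suc by simp
      then show ?thesis
        using pure_if_torsion_free_quotient[OF v(1) v(1) _ tf, of "bnd C j" j l "boundaries C j" b n] v(3)[of l] b Suc
        unfolding D_def by simp
    qed
    have inj: "inj_on (tensor_map (grp C j) (\<lambda>x. x)) (carrier (tensor_group D :: ('c, 'f) tensor monoid))"
      by (rule tensor_map_inj[OF D v(1) inc _ pure]) simp
    have "tensor_map (grp C j) (\<lambda>x. x) (tensor_map D (bnd C (Suc j)) u) = tensor_map (grp C j) (bnd C (Suc j)) u"
      using uc unfolding Suc by (intro tensor_map_comp[OF v(1) D v(1) bD inc v(3)]) auto
    also have "\<dots> = \<one>\<^bsub>tensor_group (grp C j)\<^esub>"
      using u unfolding Suc by (simp add: kernel_def tensor_complex_simps)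
    also have "\<dots> = tensor_map (grp C j) (\<lambda>x. x) \<one>\<^bsub>tensor_group D\<^esub>"
      by (rule hom_one[symmetric, OF tensor_map_hom[OF D v(1) inc]])
        (rule comm_group.axioms(2)[OF comm_group_tensor_group], rule D v(1))+
    finally have "tensor_map D (bnd C (Suc j)) u = \<one>\<^bsub>tensor_group D\<^esub>"
    proof (rule inj_onD[OF inj])
      show "tensor_map D (bnd C (Suc j)) u \<in> carrier (tensor_group D)"
        using hom_in_carrier[OF tensor_map_hom[OF v(1) D bD]] uc unfolding Suc by blast
      show "\<one>\<^bsub>tensor_group D\<^esub> \<in> carrier (tensor_group D)"
        using group.is_monoid[OF comm_group.axioms(2)[OF comm_group_tensor_group[OF D]]] by (rule monoid.one_closed)
    qed
    then have "u \<in> tensor_map (grp C (Suc j)) (bnd C (Suc (Suc j))) ` carrier (tensor_group (grp C (Suc (Suc j))))"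
    proof (intro tensor_right_exact[OF v(1) v(1) D v(3) bD])
      show "carrier D \<subseteq> bnd C (Suc j) ` carrier (grp C (Suc j))" unfolding D_def boundaries_def by simp
      show "u \<in> carrier (tensor_group (grp C (Suc j)))" using uc unfolding Suc .
      show "z \<in> bnd C (Suc (Suc j)) ` carrier (grp C (Suc (Suc j)))"
        if "z \<in> carrier (grp C (Suc j))" "bnd C (Suc j) z = \<one>\<^bsub>D\<^esub>" for z
        using that exact[of "Suc j"] unfolding D_def boundaries_def by (auto simp: kernel_def)
    qed
    then show ?thesis unfolding Suc .
  qed
  then show "u \<in> boundaries (tensor_complex C) k" unfolding boundaries_def tensor_complex_simps .
qed

lemma homology_iso_over_iff_acyclic_cokernel:
  fixes A :: "'a chain_complex" and B :: "'b chain_complex" and C :: "'c chain_complex"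
  assumes A: "valid_complex A" and B: "valid_complex B" and C: "valid_complex C" and ex: "short_exact A B C i p"
    and tf: "\<And>k. torsion_free (grp C k)"
  shows "homology_iso_over TYPE('f::field) A B i \<longleftrightarrow> acyclic_complex (tensor_complex C :: ('c, 'f) tensor chain_complex)"
  unfolding homology_iso_over_def
  by (rule homology_iso_iff_acyclic_cokernel[OF valid_tensor_complex[OF A] valid_tensor_complex[OF B]
    valid_tensor_complex[OF C] short_exact_tensor[OF A B C ex tf]])

lemma tensor_square:
  fixes u :: "('a, 'f::field) tensor"
  assumes A: "comm_group A" and B: "comm_group B" and A': "comm_group A'" and B': "comm_group B'"
    and i: "i \<in> hom A B" and i': "i' \<in> hom A' B'" and \<alpha>: "\<alpha> \<in> hom A A'" and \<beta>: "\<beta> \<in> hom B B'"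
    and sq: "\<And>x. x \<in> carrier A \<Longrightarrow> \<beta> (i x) = i' (\<alpha> x)" and u: "u \<in> carrier (tensor_group A)"
  shows "tensor_map B' \<beta> (tensor_map B i u) = tensor_map B' i' (tensor_map A' \<alpha> u)"
proof -
  have c: "\<beta> \<circ> i \<in> hom A B'" by (rule hom_compose[OF i \<beta>])
  have "tensor_map B' \<beta> (tensor_map B i u) = tensor_map B' (\<beta> \<circ> i) u"
    by (rule tensor_map_comp[OF A B B' i \<beta> c _ u]) simp
  also have "\<dots> = tensor_map B' i' (tensor_map A' \<alpha> u)"
    by (rule tensor_map_comp[OF A A' B' \<alpha> i' c _ u, symmetric]) (simp add: sq)
  finally show ?thesis .
qed

text \<open>With field coefficients the quotients \<open>C\<close> and \<open>C'\<close> have to be torsion-free, so that both rows stay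
  exact after tensoring.\<close>

lemma
  fixes A :: "'a chain_complex" and B :: "'b chain_complex"
  assumes A: "valid_complex A" and A': "valid_complex A'" and B: "valid_complex B" and B': "valid_complex B'"
    and C: "valid_complex C" and C': "valid_complex C'"
    and ex: "short_exact A B C i p" and ex': "short_exact A' B' C' i' p'"
    and tf: "\<And>k. torsion_free (grp C k)" and tf': "\<And>k. torsion_free (grp C' k)"
    and \<alpha>: "chain_map A A' \<alpha>" and \<beta>: "chain_map B B' \<beta>" and \<gamma>: "chain_map C C' \<gamma>"
    and sq1: "\<And>k x. x \<in> carrier (grp A k) \<Longrightarrow> \<beta> k (i k x) = i' k (\<alpha> k x)"
    and sq2: "\<And>k x. x \<in> carrier (grp B k) \<Longrightarrow> \<gamma> k (p k x) = p' k (\<beta> k x)"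
  shows homology_iso_over_left: "homology_iso_over TYPE('f::field) B B' \<beta> \<Longrightarrow> homology_iso_over TYPE('f) C C' \<gamma> \<Longrightarrow>
      homology_iso_over TYPE('f) A A' \<alpha>"
    and homology_iso_over_right: "homology_iso_over TYPE('f) A A' \<alpha> \<Longrightarrow> homology_iso_over TYPE('f) B B' \<beta> \<Longrightarrow>
      homology_iso_over TYPE('f) C C' \<gamma>"
proof -
  note v = valid_complexD(1)
  note E = short_exactD(1,2)[OF ex] and E' = short_exactD(1,2)[OF ex']
  have t1: "tensor_map (grp B' k) (\<beta> k) (tensor_map (grp B k) (i k) u) = tensor_map (grp B' k) (i' k) (tensor_map (grp A' k) (\<alpha> k) u)"
    if "u \<in> carrier (grp (tensor_complex A) k)" for k and u :: "('a, 'f) tensor"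
    by (rule tensor_square[OF v[OF A] v[OF B] v[OF A'] v[OF B'] chain_mapD(1)[OF E(1)] chain_mapD(1)[OF E'(1)]
        chain_mapD(1)[OF \<alpha>] chain_mapD(1)[OF \<beta>] sq1 that[unfolded tensor_complex_simps]])
  have t2: "tensor_map (grp C' k) (\<gamma> k) (tensor_map (grp C k) (p k) u) = tensor_map (grp C' k) (p' k) (tensor_map (grp B' k) (\<beta> k) u)"
    if "u \<in> carrier (grp (tensor_complex B) k)" for k and u :: "('b, 'f) tensor"
    by (rule tensor_square[OF v[OF B] v[OF C] v[OF B'] v[OF C'] chain_mapD(1)[OF E(2)] chain_mapD(1)[OF E'(2)]
        chain_mapD(1)[OF \<beta>] chain_mapD(1)[OF \<gamma>] sq2 that[unfolded tensor_complex_simps]])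
  note l = homology_iso_left[OF valid_tensor_complex[OF A] valid_tensor_complex[OF A'] valid_tensor_complex[OF B]
      valid_tensor_complex[OF B'] valid_tensor_complex[OF C] valid_tensor_complex[OF C']
      short_exact_tensor[OF A B C ex tf] short_exact_tensor[OF A' B' C' ex' tf']
      chain_map_tensor[OF A A' \<alpha>] chain_map_tensor[OF B B' \<beta>] chain_map_tensor[OF C C' \<gamma>] t1 t2]
  note r = homology_iso_right[OF valid_tensor_complex[OF A] valid_tensor_complex[OF A'] valid_tensor_complex[OF B]
      valid_tensor_complex[OF B'] valid_tensor_complex[OF C] valid_tensor_complex[OF C']
      short_exact_tensor[OF A B C ex tf] short_exact_tensor[OF A' B' C' ex' tf']
      chain_map_tensor[OF A A' \<alpha>] chain_map_tensor[OF B B' \<beta>] chain_map_tensor[OF C C' \<gamma>] t1 t2]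
  show "homology_iso_over TYPE('f) B B' \<beta> \<Longrightarrow> homology_iso_over TYPE('f) C C' \<gamma> \<Longrightarrow> homology_iso_over TYPE('f) A A' \<alpha>"
    unfolding homology_iso_over_def by (rule l)
  show "homology_iso_over TYPE('f) A A' \<alpha> \<Longrightarrow> homology_iso_over TYPE('f) B B' \<beta> \<Longrightarrow> homology_iso_over TYPE('f) C C' \<gamma>"
    unfolding homology_iso_over_def by (rule r)
qed

section \<open>Infima, subcomplexes and quotient complexes\<close>

lemma subcomplexD:
  assumes "subcomplex C D"
  shows "subgroup (D k) (grp C k)" "x \<in> D (Suc k) \<Longrightarrow> bnd C (Suc k) x \<in> D k"
    "x \<in> D k \<Longrightarrow> x \<in> carrier (grp C k)"
  using assms subgroup.mem_carrier[of "D k" "grp C k" x] unfolding subcomplex_def by (auto simp: image_subset_iff)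

text \<open>The elements of \<open>G\<close> with boundary in \<open>G\<close> form a subcomplex because \<open>\<partial>\<partial> = 0\<close>, and any subcomplex inside
  \<open>G\<close> consists of such elements. This explicit form of the infimum is used throughout.\<close>

lemma
  assumes C: "valid_complex C" and G: "\<And>k. subgroup (G k) (grp C k)"
  shows infimum_subcomplex_eq: "infimum_subcomplex C G = (\<lambda>k. {x \<in> G k. \<forall>j. k = Suc j \<longrightarrow> bnd C k x \<in> G j})"
    (is "_ = ?I")
    and subcomplex_infimum: "subcomplex C (infimum_subcomplex C G)"
proof -
  note v = valid_complexD[OF C]
  have sg: "subgroup (?I k) (grp C k)" for k
  proof (cases k)
    case 0 then show ?thesis using G by simp
  next
    case (Suc j)
    interpret b: group_hom "grp C (Suc j)" "grp C j" "bnd C (Suc j)" by (rule v(6))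
    have "?I k = {x \<in> G (Suc j). bnd C (Suc j) x \<in> G j}" using Suc by auto
    also have "subgroup \<dots> (grp C (Suc j))"
    proof (rule b.G.subgroupI)
      note Gc = subgroup.mem_carrier[OF G]
      show "{x \<in> G (Suc j). bnd C (Suc j) x \<in> G j} \<subseteq> carrier (grp C (Suc j))" using Gc by blast
      have "\<one>\<^bsub>grp C (Suc j)\<^esub> \<in> {x \<in> G (Suc j). bnd C (Suc j) x \<in> G j}"
        using subgroup.one_closed[OF G] by (simp add: b.hom_one)
      then show "{x \<in> G (Suc j). bnd C (Suc j) x \<in> G j} \<noteq> {}" by blast
      fix x assume x: "x \<in> {x \<in> G (Suc j). bnd C (Suc j) x \<in> G j}"
      then show "inv\<^bsub>grp C (Suc j)\<^esub> x \<in> {x \<in> G (Suc j). bnd C (Suc j) x \<in> G j}"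
        using subgroup.m_inv_closed[OF G] Gc[of x "Suc j"] by (simp add: b.hom_inv)
      fix y assume "y \<in> {x \<in> G (Suc j). bnd C (Suc j) x \<in> G j}"
      then show "x \<otimes>\<^bsub>grp C (Suc j)\<^esub> y \<in> {x \<in> G (Suc j). bnd C (Suc j) x \<in> G j}"
        using x subgroup.m_closed[OF G] Gc[of x "Suc j"] Gc[of y "Suc j"] by (simp add: b.hom_mult)
    qed
    finally show ?thesis using Suc by simp
  qed
  have sc: "subcomplex C ?I" unfolding subcomplex_def
  proof (intro conjI allI subsetI)
    show "subgroup (?I k) (grp C k)" for k by (rule sg)
    fix k y assume "y \<in> bnd C (Suc k) ` ?I (Suc k)"
    then obtain x where x: "x \<in> G (Suc k)" "bnd C (Suc k) x \<in> G k" "y = bnd C (Suc k) x" by auto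
    have "bnd C k y \<in> G j" if "k = Suc j" for j
      using v(5)[of x j] x(1,3) subgroup.mem_carrier[OF G] subgroup.one_closed[OF G] that by metis
    then show "y \<in> ?I k" using x by auto
  qed
  have "D \<le> ?I" if D: "subcomplex C D \<and> D \<le> G" for D
    using D subcomplexD(2)[of C D] by (auto simp: le_fun_def)
  then show eq: "infimum_subcomplex C G = ?I"
    unfolding infimum_subcomplex_def using sc
    by (intro Greatest_equality conjI) (auto simp: le_fun_def)
  show "subcomplex C (infimum_subcomplex C G)"
    using sc unfolding eq .
qed

lemma restrict_complex_simps:
  "grp (restrict_complex C D) k = (grp C k)\<lparr>carrier := D k\<rparr>" "bnd (restrict_complex C D) = bnd C"
  by (simp_all add: restrict_complex_def)

lemma valid_restrict_complex:
  assumes C: "valid_complex C" and D: "subcomplex C D"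
  shows "valid_complex (restrict_complex C D)"
  unfolding valid_complex_def restrict_complex_simps
proof (intro conjI allI ballI)
  note v = valid_complexD[OF C] and d = subcomplexD[OF D]
  show "comm_group ((grp C k)\<lparr>carrier := D k\<rparr>)" for k
    by (rule comm_group.comm_group_subgroup[OF v(1) d(1)])
  show "bnd C (Suc k) \<in> hom ((grp C (Suc k))\<lparr>carrier := D (Suc k)\<rparr>) ((grp C k)\<lparr>carrier := D k\<rparr>)" for k
    using d(2,3) hom_mult[OF v(3)] by (intro homI) auto
  show "bnd C (Suc k) (bnd C (Suc (Suc k)) x) = \<one>\<^bsub>(grp C k)\<lparr>carrier := D k\<rparr>\<^esub>"
    if "x \<in> carrier ((grp C (Suc (Suc k)))\<lparr>carrier := D (Suc (Suc k))\<rparr>)" for x k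
    using that v(5) d(3) by simp
qed

lemma subcomplex_restrict:
  assumes C: "valid_complex C" and D: "subcomplex C D" and E: "subcomplex C E" and sub: "\<And>k. E k \<subseteq> D k"
  shows "subcomplex (restrict_complex C D) E"
  using subcomplexD(1,2)[OF E] group.subgroup_incl[OF valid_complexD(2)[OF C] subcomplexD(1)[OF E] subcomplexD(1)[OF D] sub]
  unfolding subcomplex_def restrict_complex_simps by auto

lemma chain_map_restrict:
  assumes h: "chain_map C C' h" and D: "subcomplex C D" and D': "subcomplex C' D'" and sub: "\<And>k. h k ` D k \<subseteq> D' k"
  shows "chain_map (restrict_complex C D) (restrict_complex C' D') h"
  unfolding chain_map_def restrict_complex_simps
proof (intro conjI allI ballI)
  note d = subcomplexD[OF D]
  show "h k \<in> hom ((grp C k)\<lparr>carrier := D k\<rparr>) ((grp C' k)\<lparr>carrier := D' k\<rparr>)" for k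
    using d(3) sub[unfolded image_subset_iff] hom_mult[OF chain_mapD(1)[OF h]] by (intro homI) auto
  show "h k (bnd C (Suc k) x) = bnd C' (Suc k) (h (Suc k) x)"
    if "x \<in> carrier ((grp C (Suc k))\<lparr>carrier := D (Suc k)\<rparr>)" for k x
    using that d(3) chain_mapD(3)[OF h] by simp
qed

lemma quotient_complex_simps:
  "grp (quotient_complex C E) k = grp C k Mod E k"
  "bnd (quotient_complex C E) (Suc k) = coset_map (grp C k) (E k) (bnd C (Suc k))"
  by (simp_all add: quotient_complex_def)

lemma quotient_complex_bnd_coset:
  assumes "valid_complex C" "subcomplex C E" "x \<in> carrier (grp C (Suc k))"
  shows "bnd (quotient_complex C E) (Suc k) (E (Suc k) #>\<^bsub>grp C (Suc k)\<^esub> x) = E k #>\<^bsub>grp C k\<^esub> bnd C (Suc k) x"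
  unfolding quotient_complex_simps using assms
  by (intro coset_map_coset valid_complexD(1,3) subcomplexD(1)) (auto simp: subcomplexD)

lemma valid_quotient_complex:
  assumes C: "valid_complex C" and E: "subcomplex C E"
  shows "valid_complex (quotient_complex C E)"
  unfolding valid_complex_def
proof (intro conjI allI ballI)
  note v = valid_complexD[OF C] and e = subcomplexD[OF E]
  show "comm_group (grp (quotient_complex C E) k)" for k
    unfolding quotient_complex_simps by (rule comm_group.abelian_FactGroup[OF v(1) e(1)])
  show "bnd (quotient_complex C E) (Suc k) \<in> hom (grp (quotient_complex C E) (Suc k)) (grp (quotient_complex C E) k)" for k
    unfolding quotient_complex_simps using e(2) by (intro coset_map_hom v e) auto
  fix k X assume "X \<in> carrier (grp (quotient_complex C E) (Suc (Suc k)))"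
  then obtain x where x: "x \<in> carrier (grp C (Suc (Suc k)))" "X = E (Suc (Suc k)) #>\<^bsub>grp C (Suc (Suc k))\<^esub> x"
    unfolding quotient_complex_simps by (rule comm_group.FactGroup_carrierE[OF v(1)])
  show "bnd (quotient_complex C E) (Suc k) (bnd (quotient_complex C E) (Suc (Suc k)) X) = \<one>\<^bsub>grp (quotient_complex C E) k\<^esub>"
    unfolding x(2) quotient_complex_bnd_coset[OF C E x(1)] quotient_complex_bnd_coset[OF C E v(4)[OF x(1)]] v(5)[OF x(1)]
    using group.coset_mult_one[OF v(2) subgroup.subset[OF e(1)]] by (simp add: quotient_complex_simps)
qed

lemma chain_map_quotient:
  assumes A: "valid_complex A" and B: "valid_complex B" and h: "chain_map A B h"
    and E: "subcomplex A E" and E': "subcomplex B E'" and sub: "\<And>k. h k ` E k \<subseteq> E' k"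
  shows "chain_map (quotient_complex A E) (quotient_complex B E') (\<lambda>k. coset_map (grp B k) (E' k) (h k))"
  unfolding chain_map_def
proof (intro conjI allI ballI)
  note v = valid_complexD[OF A] and v' = valid_complexD[OF B] and h' = chain_mapD[OF h]
  show "coset_map (grp B k) (E' k) (h k) \<in> hom (grp (quotient_complex A E) k) (grp (quotient_complex B E') k)" for k
    unfolding quotient_complex_simps by (rule coset_map_hom[OF v(1) v'(1) h'(1) subcomplexD(1)[OF E] subcomplexD(1)[OF E'] sub])
  fix k X assume "X \<in> carrier (grp (quotient_complex A E) (Suc k))"
  then obtain x where x: "x \<in> carrier (grp A (Suc k))" "X = E (Suc k) #>\<^bsub>grp A (Suc k)\<^esub> x"
    unfolding quotient_complex_simps by (rule comm_group.FactGroup_carrierE[OF v(1)])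
  note c = coset_map_coset[OF v(1) v'(1) h'(1) subcomplexD(1)[OF E] subcomplexD(1)[OF E'] sub]
  show "coset_map (grp B k) (E' k) (h k) (bnd (quotient_complex A E) (Suc k) X) =
    bnd (quotient_complex B E') (Suc k) (coset_map (grp B (Suc k)) (E' (Suc k)) (h (Suc k)) X)"
    unfolding x(2) quotient_complex_bnd_coset[OF A E x(1)] c[OF x(1)] c[OF v(4)[OF x(1)]]
      quotient_complex_bnd_coset[OF B E' h'(2)[OF x(1)]] h'(3)[OF x(1)] ..
qed

lemma (in comm_group) torsion_free_FactGroup:
  assumes N: "subgroup N G"
    and pure: "\<And>x n. x \<in> carrier G \<Longrightarrow> n > (0::nat) \<Longrightarrow> x [^]\<^bsub>G\<^esub> n \<in> N \<Longrightarrow> x \<in> N"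
  shows "torsion_free (G Mod N)"
  unfolding torsion_free_def
proof (intro ballI allI impI)
  fix X and n :: nat assume "X \<in> carrier (G Mod N)" and n: "n > 0" "X [^]\<^bsub>G Mod N\<^esub> n = \<one>\<^bsub>G Mod N\<^esub>"
  then obtain x where x: "x \<in> carrier G" "X = N #> x" using FactGroup_carrierE by blast
  have "N #> (x [^] n) = N"
    using n(2) normal.FactGroup_pow[OF subgroup_imp_normal[OF N] x(1), of n] x by simp
  then have "x \<in> N" using pure[OF x(1) n(1)] coset_eq_subgroup_iff[OF N] x(1) by simp
  then show "X = \<one>\<^bsub>G Mod N\<^esub>" using x coset_eq_subgroup_iff[OF N x(1)] by simp
qed

lemma subcomplex_image:
  assumes A: "valid_complex A" and B: "valid_complex B" and h: "chain_map A B h" and E: "subcomplex A E"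
  shows "subcomplex B (\<lambda>k. h k ` E k)"
  unfolding subcomplex_def
proof (intro conjI allI)
  show "subgroup (h k ` E k) (grp B k)" for k
    by (rule group_hom.subgroup_img_is_subgroup[OF chain_map_group_hom[OF A B h] subcomplexD(1)[OF E]])
  show "bnd B (Suc k) ` h (Suc k) ` E (Suc k) \<subseteq> h k ` E k" for k
    using chain_mapD(3)[OF h, of _ k, symmetric] subcomplexD(2,3)[OF E] by auto
qed

lemma subcomplex_carrier: "valid_complex A \<Longrightarrow> subcomplex A (\<lambda>k. carrier (grp A k))"
  unfolding subcomplex_def using valid_complexD(4) group.subgroup_self[OF valid_complexD(2)] by auto

definition cokernel_complex :: "'a chain_complex \<Rightarrow> 'b chain_complex \<Rightarrow> (nat \<Rightarrow> 'a \<Rightarrow> 'b) \<Rightarrow> 'b set chain_complex" where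
  "cokernel_complex A B i = quotient_complex B (\<lambda>k. i k ` carrier (grp A k))"

lemma subcomplex_chain_map_image:
  assumes "valid_complex A" "valid_complex B" "chain_map A B i"
  shows "subcomplex B (\<lambda>k. i k ` carrier (grp A k))"
  by (rule subcomplex_image[OF assms subcomplex_carrier[OF assms(1)]])

lemma valid_cokernel_complex:
  assumes "valid_complex A" "valid_complex B" "chain_map A B i"
  shows "valid_complex (cokernel_complex A B i)"
  unfolding cokernel_complex_def by (rule valid_quotient_complex[OF assms(2) subcomplex_chain_map_image[OF assms]])

context
  fixes A :: "'a chain_complex" and B :: "'b chain_complex" and i
  assumes A: "valid_complex A" and B: "valid_complex B" and i: "chain_map A B i"
    and inj: "\<And>k. inj_on (i k) (carrier (grp A k))"
begin

private abbreviation "E \<equiv> \<lambda>k. i k ` carrier (grp A k)"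

private lemmas im = subcomplex_chain_map_image[OF A B i]
private lemmas e = subcomplexD[OF im]

lemma short_exact_cokernel:
  "short_exact A B (cokernel_complex A B i) i (\<lambda>k x. i k ` carrier (grp A k) #>\<^bsub>grp B k\<^esub> x)"
proof (rule short_exactI[OF i _ inj])
  note v = valid_complexD[OF B]
  show "chain_map B (cokernel_complex A B i) (\<lambda>k x. i k ` carrier (grp A k) #>\<^bsub>grp B k\<^esub> x)"
    unfolding chain_map_def cokernel_complex_def
  proof (intro conjI allI ballI)
    show "(\<lambda>x. E k #>\<^bsub>grp B k\<^esub> x) \<in> hom (grp B k) (grp (quotient_complex B E) k)" for k
      unfolding quotient_complex_simps by (rule comm_group.FactGroup_coset_hom[OF v(1) e(1)])
    show "E k #>\<^bsub>grp B k\<^esub> bnd B (Suc k) x = bnd (quotient_complex B E) (Suc k) (E (Suc k) #>\<^bsub>grp B (Suc k)\<^esub> x)"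
      if "x \<in> carrier (grp B (Suc k))" for k x
      by (rule quotient_complex_bnd_coset[OF B im that, symmetric])
  qed
  fix k
  show "\<exists>b\<in>carrier (grp B k). E k #>\<^bsub>grp B k\<^esub> b = c" if "c \<in> carrier (grp (cokernel_complex A B i) k)" for c
    using that unfolding cokernel_complex_def quotient_complex_simps
    by (rule comm_group.FactGroup_carrierE[OF v(1)]) blast
  show "\<exists>a\<in>carrier (grp A k). i k a = b"
    if "b \<in> carrier (grp B k)" "E k #>\<^bsub>grp B k\<^esub> b = \<one>\<^bsub>grp (cokernel_complex A B i) k\<^esub>" for b
    using that comm_group.coset_eq_subgroup_iff[OF v(1) e(1) that(1)] unfolding cokernel_complex_def quotient_complex_simps by auto
  show "E k #>\<^bsub>grp B k\<^esub> i k a = \<one>\<^bsub>grp (cokernel_complex A B i) k\<^esub>" if a: "a \<in> carrier (grp A k)" for a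
    using comm_group.coset_eq_subgroup_iff[OF v(1) e(1) chain_mapD(2)[OF i a]] a
    unfolding cokernel_complex_def quotient_complex_simps by auto
qed

text \<open>The third isomorphism theorem in the form \<open>0 \<rightarrow> A/F \<rightarrow> B/i(F) \<rightarrow> B/i(A) \<rightarrow> 0\<close>: the cokernel is the same
  for all subcomplexes \<open>F\<close> of \<open>A\<close>.\<close>

lemma short_exact_quotients:
  assumes F: "subcomplex A F"
  shows "short_exact (quotient_complex A F) (quotient_complex B (\<lambda>k. i k ` F k)) (cokernel_complex A B i)
    (\<lambda>k. coset_map (grp B k) (i k ` F k) (i k)) (\<lambda>k. coset_map (grp B k) (i k ` carrier (grp A k)) (\<lambda>x. x))"
proof (rule short_exactI)
  note v = valid_complexD[OF A] and v' = valid_complexD[OF B] and f = subcomplexD[OF F]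
  have iF: "subcomplex B (\<lambda>k. i k ` F k)" by (rule subcomplex_image[OF A B i F])
  note if' = subcomplexD[OF iF]
  have sub: "(\<lambda>x. x) ` i k ` F k \<subseteq> E k" for k using f(3) by auto
  have idm: "chain_map B B (\<lambda>k x. x)" by (simp add: chain_map_def hom_def)
  note c1 = coset_map_coset[OF v(1) v'(1) chain_mapD(1)[OF i] f(1) if'(1) order_refl]
  note c2 = coset_map_coset[OF v'(1) v'(1) chain_mapD(1)[OF idm] if'(1) e(1) sub]
  show "chain_map (quotient_complex A F) (quotient_complex B (\<lambda>k. i k ` F k)) (\<lambda>k. coset_map (grp B k) (i k ` F k) (i k))"
    by (rule chain_map_quotient[OF A B i F iF]) simp
  show "chain_map (quotient_complex B (\<lambda>k. i k ` F k)) (cokernel_complex A B i) (\<lambda>k. coset_map (grp B k) (E k) (\<lambda>x. x))"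
    unfolding cokernel_complex_def by (rule chain_map_quotient[OF B B idm iF im sub])
  fix k
  interpret GA: comm_group "grp A k" by (rule v(1))
  interpret GB: comm_group "grp B k" by (rule v'(1))
  interpret i: group_hom "grp A k" "grp B k" "i k" by (rule chain_map_group_hom[OF A B i])
  show "inj_on (coset_map (grp B k) (i k ` F k) (i k)) (carrier (grp (quotient_complex A F) k))"
  proof (rule inj_onI)
    fix X Y assume "X \<in> carrier (grp (quotient_complex A F) k)" "Y \<in> carrier (grp (quotient_complex A F) k)"
      and eq: "coset_map (grp B k) (i k ` F k) (i k) X = coset_map (grp B k) (i k ` F k) (i k) Y"
    then have XY: "X \<in> carrier (grp A k Mod F k)" "Y \<in> carrier (grp A k Mod F k)" unfolding quotient_complex_simps by auto
    obtain x where x: "x \<in> carrier (grp A k)" "X = F k #>\<^bsub>grp A k\<^esub> x" using XY(1) by (rule GA.FactGroup_carrierE)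
    obtain y where y: "y \<in> carrier (grp A k)" "Y = F k #>\<^bsub>grp A k\<^esub> y" using XY(2) by (rule GA.FactGroup_carrierE)
    note xy = x y
    have "i k x \<otimes>\<^bsub>grp B k\<^esub> inv\<^bsub>grp B k\<^esub> i k y \<in> i k ` F k"
      using eq GB.coset_eq_iff[OF if'(1), of "i k x" "i k y"] xy c1 by simp
    then obtain z where "z \<in> F k" "i k (x \<otimes>\<^bsub>grp A k\<^esub> inv\<^bsub>grp A k\<^esub> y) = i k z" using xy by auto
    then have "x \<otimes>\<^bsub>grp A k\<^esub> inv\<^bsub>grp A k\<^esub> y \<in> F k"
      using inj_onD[OF inj, of k "x \<otimes>\<^bsub>grp A k\<^esub> inv\<^bsub>grp A k\<^esub> y" z] f(3) xy by simp
    then show "X = Y" using GA.coset_eq_iff[OF f(1), of x y] xy by simp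
  qed
  show "\<exists>b\<in>carrier (grp (quotient_complex B (\<lambda>k. i k ` F k)) k). coset_map (grp B k) (E k) (\<lambda>x. x) b = c"
    if c: "c \<in> carrier (grp (cokernel_complex A B i) k)" for c
  proof -
    obtain x where "x \<in> carrier (grp B k)" "c = E k #>\<^bsub>grp B k\<^esub> x"
      using c unfolding cokernel_complex_def quotient_complex_simps by (rule GB.FactGroup_carrierE)
    then show ?thesis using c2[of x k] GB.FactGroup_carrierI[of x "i k ` F k"] unfolding quotient_complex_simps by blast
  qed
  show "\<exists>a\<in>carrier (grp (quotient_complex A F) k). coset_map (grp B k) (i k ` F k) (i k) a = b"
    if b: "b \<in> carrier (grp (quotient_complex B (\<lambda>k. i k ` F k)) k)"
      "coset_map (grp B k) (E k) (\<lambda>x. x) b = \<one>\<^bsub>grp (cokernel_complex A B i) k\<^esub>" for b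
  proof -
    obtain x where x: "x \<in> carrier (grp B k)" "b = i k ` F k #>\<^bsub>grp B k\<^esub> x"
      using b(1) unfolding quotient_complex_simps by (rule GB.FactGroup_carrierE)
    then have "x \<in> E k"
      using b(2) c2[OF x(1)] GB.coset_eq_subgroup_iff[OF e(1) x(1)] unfolding cokernel_complex_def quotient_complex_simps by simp
    then obtain a where "a \<in> carrier (grp A k)" "x = i k a" by blast
    then show ?thesis using c1[of a k] GA.FactGroup_carrierI[of a "F k"] x(2) unfolding quotient_complex_simps by blast
  qed
  show "coset_map (grp B k) (E k) (\<lambda>x. x) (coset_map (grp B k) (i k ` F k) (i k) X) = \<one>\<^bsub>grp (cokernel_complex A B i) k\<^esub>"
    if X: "X \<in> carrier (grp (quotient_complex A F) k)" for X
  proof -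
    obtain a where a: "a \<in> carrier (grp A k)" "X = F k #>\<^bsub>grp A k\<^esub> a"
      using X unfolding quotient_complex_simps by (rule GA.FactGroup_carrierE)
    then show ?thesis
      using c1[OF a(1)] c2[of "i k a" k] GB.coset_eq_subgroup_iff[OF e(1), of "i k a"]
      unfolding cokernel_complex_def quotient_complex_simps by simp
  qed
qed

end

section \<open>Infima under injective chain maps\<close>

text \<open>Injectivity makes \<open>\<partial>(i x) = i (\<partial>x)\<close> lie in \<open>i(G)\<close> exactly if \<open>\<partial>x\<close> lies in \<open>G\<close>.\<close>

lemma infimum_image:
  assumes C: "valid_complex C" and C': "valid_complex C'" and i: "chain_map C C' i"
    and inj: "\<And>k. inj_on (i k) (carrier (grp C k))" and G: "\<And>k. subgroup (G k) (grp C k)"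
  shows "infimum_subcomplex C' (\<lambda>k. i k ` G k) = (\<lambda>k. i k ` infimum_subcomplex C G k)"
proof (rule ext)
  fix k
  have iG: "subgroup (i k ` G k) (grp C' k)" for k
    by (rule group_hom.subgroup_img_is_subgroup[OF chain_map_group_hom[OF C C' i] G])
  have Gc: "x \<in> G k \<Longrightarrow> x \<in> carrier (grp C k)" for x k using subgroup.mem_carrier[OF G] .
  have "bnd C' (Suc j) (i (Suc j) x) \<in> i j ` G j \<longleftrightarrow> bnd C (Suc j) x \<in> G j" if x: "x \<in> G (Suc j)" for x j
  proof -
    have "bnd C' (Suc j) (i (Suc j) x) = i j (bnd C (Suc j) x)" using chain_mapD(3)[OF i Gc[OF x]] by simp
    moreover have "bnd C (Suc j) x \<in> carrier (grp C j)" using valid_complexD(4)[OF C Gc[OF x]] .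
    ultimately show ?thesis using inj_on_image_mem_iff[OF inj] Gc by (metis subsetI)
  qed
  then show "infimum_subcomplex C' (\<lambda>k. i k ` G k) k = i k ` infimum_subcomplex C G k"
    unfolding infimum_subcomplex_eq[OF C G] infimum_subcomplex_eq[OF C' iG]
    by (cases k) auto
qed

lemma infimum_mono:
  assumes C: "valid_complex C" and G: "\<And>k. subgroup (G k) (grp C k)" and D: "\<And>k. subgroup (D k) (grp C k)"
    and sub: "\<And>k. G k \<subseteq> D k"
  shows "infimum_subcomplex C G k \<subseteq> infimum_subcomplex C D k"
  using sub unfolding infimum_subcomplex_eq[OF C G] infimum_subcomplex_eq[OF C D] by blast

lemma infimum_pure:
  assumes C: "valid_complex C" and G: "\<And>k. subgroup (G k) (grp C k)"
    and pure: "\<And>k x n. x \<in> carrier (grp C k) \<Longrightarrow> n > (0::nat) \<Longrightarrow> x [^]\<^bsub>grp C k\<^esub> n \<in> G k \<Longrightarrow> x \<in> G k"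
    and x: "x \<in> carrier (grp C k)" "n > (0::nat)" "x [^]\<^bsub>grp C k\<^esub> n \<in> infimum_subcomplex C G k"
  shows "x \<in> infimum_subcomplex C G k"
proof -
  have "bnd C k x \<in> G j" if k: "k = Suc j" for j
  proof -
    interpret b: group_hom "grp C (Suc j)" "grp C j" "bnd C (Suc j)" by (rule valid_complexD(6)[OF C])
    have "bnd C (Suc j) x [^]\<^bsub>grp C j\<^esub> n \<in> G j"
      using x k b.hom_nat_pow[of x n] unfolding infimum_subcomplex_eq[OF C G] by auto
    then show ?thesis using pure[of "bnd C k x" j n] x k by simp
  qed
  then show ?thesis using x pure[of x k n] unfolding infimum_subcomplex_eq[OF C G] by auto
qed

definition embedded_complex :: "'c chain_complex \<Rightarrow> (nat \<Rightarrow> 'c set) \<Rightarrow> 'c chain_complex" where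
  "embedded_complex C D = restrict_complex C (infimum_subcomplex C D)"

lemma embedded_complex_simps:
  "grp (embedded_complex C D) k = (grp C k)\<lparr>carrier := infimum_subcomplex C D k\<rparr>" "bnd (embedded_complex C D) = bnd C"
  by (simp_all add: embedded_complex_def restrict_complex_simps)

text \<open>Pure graded subgroups: those whose quotients are torsion-free.\<close>

definition pure_in :: "(nat \<Rightarrow> 'c set) \<Rightarrow> 'c chain_complex \<Rightarrow> bool" where
  "pure_in G C \<longleftrightarrow> (\<forall>k. \<forall>x\<in>carrier (grp C k). \<forall>n>(0::nat). x [^]\<^bsub>grp C k\<^esub> n \<in> G k \<longrightarrow> x \<in> G k)"

context
  fixes C :: "'c chain_complex" and C' :: "'d chain_complex" and i D D'
  assumes C: "valid_complex C" and C': "valid_complex C'" and i: "chain_map C C' i"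
    and inj: "\<And>k. inj_on (i k) (carrier (grp C k))"
    and D: "\<And>k. subgroup (D k) (grp C k)" and D': "\<And>k. subgroup (D' k) (grp C' k)"
    and iD: "\<And>k. i k ` D k \<subseteq> D' k"
begin

private lemma valid_source: "valid_complex (embedded_complex C D)"
  unfolding embedded_complex_def by (rule valid_restrict_complex[OF C subcomplex_infimum[OF C D]])

private lemma valid_target: "valid_complex (embedded_complex C' D')"
  unfolding embedded_complex_def by (rule valid_restrict_complex[OF C' subcomplex_infimum[OF C' D']])

private lemma subgroup_image: "subgroup (G k) (grp C k) \<Longrightarrow> subgroup (i k ` G k) (grp C' k)" for G
  by (rule group_hom.subgroup_img_is_subgroup[OF chain_map_group_hom[OF C C' i]])

private lemma source_carrier: "x \<in> infimum_subcomplex C D k \<Longrightarrow> x \<in> carrier (grp C k)"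
  using subcomplexD(3)[OF subcomplex_infimum[OF C D]] .

lemma chain_map_embedded: "chain_map (embedded_complex C D) (embedded_complex C' D') i"
proof -
  have "i k ` infimum_subcomplex C D k \<subseteq> infimum_subcomplex C' D' k" for k
    using infimum_mono[OF C' subgroup_image[where G = D, OF D] D' iD, of k] unfolding infimum_image[OF C C' i inj D] .
  then show ?thesis unfolding embedded_complex_def
    by (rule chain_map_restrict[OF i subcomplex_infimum[OF C D] subcomplex_infimum[OF C' D']])
qed

lemma inj_embedded: "inj_on (i k) (carrier (grp (embedded_complex C D) k))"
  using inj_on_subset[OF inj] source_carrier by (auto simp: embedded_complex_simps)

private abbreviation "K \<equiv> cokernel_complex (embedded_complex C D) (embedded_complex C' D') i"

lemma cokernel_embedded_eq:
  "K = quotient_complex (embedded_complex C' D') (infimum_subcomplex C' (\<lambda>k. i k ` D k))"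
  unfolding cokernel_complex_def infimum_image[OF C C' i inj D] by (simp add: embedded_complex_simps)

text \<open>Divisibility passes to boundaries: if a multiple of \<open>x\<close> and of \<open>\<partial>x\<close> lie in the pure
  subgroup \<open>i(D)\<close>, then so do \<open>x\<close> and \<open>\<partial>x\<close>.\<close>

lemma torsion_free_cokernel_embedded:
  assumes pure: "pure_in (\<lambda>k. i k ` D k) C'"
  shows "torsion_free (grp K k)"
  unfolding cokernel_embedded_eq quotient_complex_simps
proof (rule comm_group.torsion_free_FactGroup[OF valid_complexD(1)[OF valid_target]])
  show "subgroup (infimum_subcomplex C' (\<lambda>k. i k ` D k) k) (grp (embedded_complex C' D') k)"
    using subcomplexD(1)[OF subcomplex_chain_map_image[OF valid_source valid_target chain_map_embedded], of k]
    unfolding infimum_image[OF C C' i inj D] by (simp add: embedded_complex_simps)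
  fix x and n :: nat assume x: "x \<in> carrier (grp (embedded_complex C' D') k)" "0 < n"
    "x [^]\<^bsub>grp (embedded_complex C' D') k\<^esub> n \<in> infimum_subcomplex C' (\<lambda>k. i k ` D k) k"
  have "x \<in> carrier (grp C' k)"
    using x(1) subcomplexD(3)[OF subcomplex_infimum[OF C' D']] by (simp add: embedded_complex_simps)
  moreover have "x [^]\<^bsub>grp C' k\<^esub> n \<in> infimum_subcomplex C' (\<lambda>k. i k ` D k) k"
    using x(3) by (simp add: embedded_complex_simps nat_pow_def)
  ultimately show "x \<in> infimum_subcomplex C' (\<lambda>k. i k ` D k) k"
    using infimum_pure[OF C' subgroup_image[where G = D, OF D] _ _ x(2)] pure unfolding pure_in_def by blast
qed

lemma homology_iso_embedded:
  "homology_iso (embedded_complex C D) (embedded_complex C' D') i \<longleftrightarrow> acyclic_complex K"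
  by (rule homology_iso_iff_acyclic_cokernel[OF valid_source valid_target
    valid_cokernel_complex[OF valid_source valid_target chain_map_embedded]
    short_exact_cokernel[OF valid_source valid_target chain_map_embedded inj_embedded]])

lemma homology_iso_over_embedded:
  assumes pure: "pure_in (\<lambda>k. i k ` D k) C'"
  shows "homology_iso_over TYPE('f::field) (embedded_complex C D) (embedded_complex C' D') i \<longleftrightarrow>
    acyclic_complex (tensor_complex K :: ('d set, 'f) tensor chain_complex)"
  by (rule homology_iso_over_iff_acyclic_cokernel[OF valid_source valid_target
    valid_cokernel_complex[OF valid_source valid_target chain_map_embedded]
    short_exact_cokernel[OF valid_source valid_target chain_map_embedded inj_embedded]
    torsion_free_cokernel_embedded[OF pure]])

lemma homology_iso_over_if_homology_iso_embedded:
  assumes pure: "pure_in (\<lambda>k. i k ` D k) C'"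
    and "homology_iso (embedded_complex C D) (embedded_complex C' D') i"
  shows "homology_iso_over TYPE('f::field) (embedded_complex C D) (embedded_complex C' D') i"
  using assms(2) unfolding homology_iso_embedded homology_iso_over_embedded[OF pure]
  by (rule acyclic_tensor[OF valid_cokernel_complex[OF valid_source valid_target chain_map_embedded]
    torsion_free_cokernel_embedded[OF pure]])

context
  fixes G
  assumes G: "\<And>k. subgroup (G k) (grp C k)" and GD: "\<And>k. G k \<subseteq> D k"
begin

private lemma subcomplex_relative: "subcomplex (embedded_complex C D) (infimum_subcomplex C G)"
  unfolding embedded_complex_def
  by (rule subcomplex_restrict[OF C subcomplex_infimum[OF C D] subcomplex_infimum[OF C G] infimum_mono[OF C G D GD]])

private lemma subcomplex_relative_image: "subcomplex (embedded_complex C' D') (\<lambda>k. i k ` infimum_subcomplex C G k)"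
  by (rule subcomplex_image[OF valid_source valid_target chain_map_embedded subcomplex_relative])

private lemmas rel_valid = valid_quotient_complex[OF valid_source subcomplex_relative]
  valid_quotient_complex[OF valid_target subcomplex_relative_image]
  valid_cokernel_complex[OF valid_source valid_target chain_map_embedded]
  short_exact_quotients[OF valid_source valid_target chain_map_embedded inj_embedded subcomplex_relative]

text \<open>The right-hand side is the same as in \<open>homology_iso_embedded\<close>, whatever \<open>G\<close> is.\<close>

lemma homology_iso_embedded_relative:
  "homology_iso (quotient_complex (embedded_complex C D) (infimum_subcomplex C G))
     (quotient_complex (embedded_complex C' D') (infimum_subcomplex C' (\<lambda>k. i k ` G k)))
     (\<lambda>k. coset_map (grp (embedded_complex C' D') k) (infimum_subcomplex C' (\<lambda>k. i k ` G k) k) (i k))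
   \<longleftrightarrow> acyclic_complex K"
  unfolding infimum_image[OF C C' i inj G] by (rule homology_iso_iff_acyclic_cokernel[OF rel_valid])

text \<open>The quotients by the infimum of \<open>G\<close> may have torsion; their common cokernel is torsion-free by the purity of
  \<open>i(D)\<close>, and this keeps the sequence of \<open>short_exact_quotients\<close> exact after tensoring.\<close>

lemma homology_iso_over_embedded_relative:
  assumes pure: "pure_in (\<lambda>k. i k ` D k) C'"
  shows "homology_iso_over TYPE('f::field) (quotient_complex (embedded_complex C D) (infimum_subcomplex C G))
     (quotient_complex (embedded_complex C' D') (infimum_subcomplex C' (\<lambda>k. i k ` G k)))
     (\<lambda>k. coset_map (grp (embedded_complex C' D') k) (infimum_subcomplex C' (\<lambda>k. i k ` G k) k) (i k))
   \<longleftrightarrow> acyclic_complex (tensor_complex K :: ('d set, 'f) tensor chain_complex)"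
  unfolding infimum_image[OF C C' i inj G]
  by (rule homology_iso_over_iff_acyclic_cokernel[OF rel_valid torsion_free_cokernel_embedded[OF pure]])

end

end

text \<open>The five lemma for the sequences \<open>0 \<rightarrow> A \<rightarrow> B \<rightarrow> B/i(A) \<rightarrow> 0\<close> and \<open>0 \<rightarrow> A' \<rightarrow> B' \<rightarrow> B'/i'(A') \<rightarrow> 0\<close> of a
  commutative square of chain maps, with the induced map of cokernels.\<close>

lemma
  fixes A :: "'a chain_complex" and B :: "'b chain_complex" and A' :: "'c chain_complex" and B' :: "'d chain_complex"
  assumes A: "valid_complex A" and B: "valid_complex B" and A': "valid_complex A'" and B': "valid_complex B'"
    and i: "chain_map A B i" and inj: "\<And>k. inj_on (i k) (carrier (grp A k))"
    and i': "chain_map A' B' i'" and inj': "\<And>k. inj_on (i' k) (carrier (grp A' k))"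
    and \<alpha>: "chain_map A A' \<alpha>" and \<beta>: "chain_map B B' \<beta>"
    and sq: "\<And>k x. x \<in> carrier (grp A k) \<Longrightarrow> \<beta> k (i k x) = i' k (\<alpha> k x)"
  defines "\<gamma> \<equiv> \<lambda>k. coset_map (grp B' k) (i' k ` carrier (grp A' k)) (\<beta> k)"
  shows cokernel_homology_iso_left: "homology_iso B B' \<beta> \<Longrightarrow>
      homology_iso (cokernel_complex A B i) (cokernel_complex A' B' i') \<gamma> \<Longrightarrow> homology_iso A A' \<alpha>"
    and cokernel_homology_iso_over_left: "(\<And>k. torsion_free (grp (cokernel_complex A B i) k)) \<Longrightarrow>
      (\<And>k. torsion_free (grp (cokernel_complex A' B' i') k)) \<Longrightarrow> homology_iso_over TYPE('f::field) B B' \<beta> \<Longrightarrow>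
      homology_iso_over TYPE('f) (cokernel_complex A B i) (cokernel_complex A' B' i') \<gamma> \<Longrightarrow> homology_iso_over TYPE('f) A A' \<alpha>"
    and cokernel_homology_iso_over_right: "(\<And>k. torsion_free (grp (cokernel_complex A B i) k)) \<Longrightarrow>
      (\<And>k. torsion_free (grp (cokernel_complex A' B' i') k)) \<Longrightarrow> homology_iso_over TYPE('f::field) A A' \<alpha> \<Longrightarrow>
      homology_iso_over TYPE('f) B B' \<beta> \<Longrightarrow>
      homology_iso_over TYPE('f) (cokernel_complex A B i) (cokernel_complex A' B' i') \<gamma>"
proof -
  note im = subcomplex_chain_map_image[OF A B i] and im' = subcomplex_chain_map_image[OF A' B' i']
  have sub: "\<beta> k ` i k ` carrier (grp A k) \<subseteq> i' k ` carrier (grp A' k)" for k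
    using sq chain_mapD(2)[OF \<alpha>] by auto
  have \<gamma>: "chain_map (cokernel_complex A B i) (cokernel_complex A' B' i') \<gamma>"
    unfolding cokernel_complex_def \<gamma>_def by (rule chain_map_quotient[OF B B' \<beta> im im' sub])
  have sq2: "\<gamma> k (i k ` carrier (grp A k) #>\<^bsub>grp B k\<^esub> x) = i' k ` carrier (grp A' k) #>\<^bsub>grp B' k\<^esub> \<beta> k x"
    if "x \<in> carrier (grp B k)" for k x
    unfolding \<gamma>_def
    by (rule coset_map_coset[OF valid_complexD(1)[OF B] valid_complexD(1)[OF B'] chain_mapD(1)[OF \<beta>]
      subcomplexD(1)[OF im] subcomplexD(1)[OF im'] sub that])
  note c = valid_cokernel_complex[OF A B i] valid_cokernel_complex[OF A' B' i']
    short_exact_cokernel[OF A B i inj] short_exact_cokernel[OF A' B' i' inj']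
  show "homology_iso B B' \<beta> \<Longrightarrow>
      homology_iso (cokernel_complex A B i) (cokernel_complex A' B' i') \<gamma> \<Longrightarrow> homology_iso A A' \<alpha>"
    by (rule homology_iso_left[OF A A' B B' c \<alpha> \<beta> \<gamma> sq sq2])
  show "homology_iso_over TYPE('f::field) B B' \<beta> \<Longrightarrow>
      homology_iso_over TYPE('f) (cokernel_complex A B i) (cokernel_complex A' B' i') \<gamma> \<Longrightarrow> homology_iso_over TYPE('f) A A' \<alpha>"
    if "\<And>k. torsion_free (grp (cokernel_complex A B i) k)" "\<And>k. torsion_free (grp (cokernel_complex A' B' i') k)"
    by (rule homology_iso_over_left[OF A A' B B' c that \<alpha> \<beta> \<gamma> sq sq2])
  show "homology_iso_over TYPE('f::field) A A' \<alpha> \<Longrightarrow> homology_iso_over TYPE('f) B B' \<beta> \<Longrightarrow>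
      homology_iso_over TYPE('f) (cokernel_complex A B i) (cokernel_complex A' B' i') \<gamma>"
    if "\<And>k. torsion_free (grp (cokernel_complex A B i) k)" "\<And>k. torsion_free (grp (cokernel_complex A' B' i') k)"
    by (rule homology_iso_over_right[OF A A' B B' c that \<alpha> \<beta> \<gamma> sq sq2])
qed

section \<open>Complexes spanned by cells\<close>

text \<open>The common structure of directed simplicial complexes (cells are lists) and ordered simplicial
  complexes (cells are sets): \<open>n\<close> counts the vertices of a cell and \<open>d\<close> is the boundary of a cell.\<close>

definition cellular :: "('c \<Rightarrow> nat) \<Rightarrow> ('c \<Rightarrow> ('c \<Rightarrow>\<^sub>0 int)) \<Rightarrow> 'c set \<Rightarrow> bool" where
  "cellular n d K \<longleftrightarrow>
     (\<forall>\<sigma>\<in>K. \<forall>k. n \<sigma> = Suc (Suc k) \<longrightarrow> Poly_Mapping.keys (d \<sigma>) \<subseteq> {\<tau>\<in>K. n \<tau> = Suc k}) \<and>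
     (\<forall>\<sigma>\<in>K. frag_extend d (d \<sigma>) = 0)"

text \<open>The signs are needed for maps of hypergraphs that do not respect the orders of the vertices.\<close>

definition signed_push :: "('c \<Rightarrow> int) \<Rightarrow> ('c \<Rightarrow> 'd) \<Rightarrow> ('c \<Rightarrow>\<^sub>0 int) \<Rightarrow> ('d \<Rightarrow>\<^sub>0 int)" where
  "signed_push \<epsilon> m = frag_extend (\<lambda>\<sigma>. frag_cmul (\<epsilon> \<sigma>) (frag_of (m \<sigma>)))"

definition cellular_embedding ::
  "('c \<Rightarrow> nat) \<Rightarrow> ('c \<Rightarrow> ('c \<Rightarrow>\<^sub>0 int)) \<Rightarrow> 'c set \<Rightarrow> ('d \<Rightarrow> nat) \<Rightarrow> ('d \<Rightarrow> ('d \<Rightarrow>\<^sub>0 int)) \<Rightarrow> 'd set \<Rightarrow>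
   ('c \<Rightarrow> int) \<Rightarrow> ('c \<Rightarrow> 'd) \<Rightarrow> bool" where
  "cellular_embedding n d K n' d' K' \<epsilon> m \<longleftrightarrow> inj_on m K \<and>
     (\<forall>\<sigma>\<in>K. m \<sigma> \<in> K' \<and> n' (m \<sigma>) = n \<sigma> \<and> \<bar>\<epsilon> \<sigma>\<bar> = 1 \<and>
        frag_cmul (\<epsilon> \<sigma>) (d' (m \<sigma>)) = signed_push \<epsilon> m (d \<sigma>))"

lemma frag_extend_frag_extend:
  "frag_extend g (frag_extend f x) = frag_extend (\<lambda>\<sigma>. frag_extend g (f \<sigma>)) x"
proof -
  have "Poly_Mapping.keys x \<subseteq> UNIV" by simp
  then show ?thesis
    by (rule free_Abelian_group_induct) (auto simp: frag_extend_diff)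
qed

lemma cell_complex_simps:
  "grp (cell_complex n d K) k = graded_span n K k" "bnd (cell_complex n d K) k = frag_extend d"
  by (simp_all add: cell_complex_def)

lemma carrier_graded_span: "x \<in> carrier (graded_span n A k) \<longleftrightarrow> Poly_Mapping.keys x \<subseteq> {\<sigma>\<in>A. n \<sigma> = Suc k}"
  by (simp add: graded_span_def)

lemma keys_frag_extend_subset:
  "(\<And>\<sigma>. \<sigma> \<in> Poly_Mapping.keys x \<Longrightarrow> Poly_Mapping.keys (f \<sigma>) \<subseteq> S) \<Longrightarrow> Poly_Mapping.keys (frag_extend f x) \<subseteq> S"
  using keys_frag_extend[of f x] by blast

lemma valid_cell_complex:
  assumes "cellular n d K" shows "valid_complex (cell_complex n d K)"
  unfolding valid_complex_def cell_complex_simps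
proof (intro conjI allI ballI)
  show "comm_group (graded_span n K k)" for k by (simp add: graded_span_def abelian_free_Abelian_group)
  show "frag_extend d \<in> hom (graded_span n K (Suc k)) (graded_span n K k)" for k
  proof (rule homI)
    fix x assume x: "x \<in> carrier (graded_span n K (Suc k))"
    then show "frag_extend d x \<in> carrier (graded_span n K k)"
      unfolding carrier_graded_span using assms unfolding cellular_def
      by (intro keys_frag_extend_subset) blast
  qed (simp add: graded_span_def frag_extend_add)
  show "frag_extend d (frag_extend d x) = \<one>\<^bsub>graded_span n K k\<^esub>" if "x \<in> carrier (graded_span n K (Suc (Suc k)))" for x k
  proof -
    have "frag_extend d (frag_extend d x) = 0"
      unfolding frag_extend_frag_extend
      by (rule frag_extend_eq_0) (use that assms in \<open>auto simp: carrier_graded_span cellular_def\<close>)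
    then show ?thesis by (simp add: graded_span_def)
  qed
qed

lemma signed_push_diff: "signed_push \<epsilon> m (x - y) = signed_push \<epsilon> m x - signed_push \<epsilon> m y"
  by (simp add: signed_push_def frag_extend_diff)

lemma signed_push_keys:
  "Poly_Mapping.keys (signed_push \<epsilon> m x) \<subseteq> m ` Poly_Mapping.keys x"
  unfolding signed_push_def by (rule keys_frag_extend_subset) (auto dest: subsetD[OF keys_cmul])

lemma chain_map_signed_push:
  assumes "cellular_embedding n d K n' d' K' \<epsilon> m"
  shows "chain_map (cell_complex n d K) (cell_complex n' d' K') (\<lambda>k. signed_push \<epsilon> m)"
  unfolding chain_map_def cell_complex_simps
proof (intro conjI allI ballI)
  show "signed_push \<epsilon> m \<in> hom (graded_span n K k) (graded_span n' K' k)" for k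
  proof (rule homI)
    fix x assume x: "x \<in> carrier (graded_span n K k)"
    then show "signed_push \<epsilon> m x \<in> carrier (graded_span n' K' k)"
      using signed_push_keys[of \<epsilon> m x] assms unfolding carrier_graded_span cellular_embedding_def by fastforce
  qed (simp add: graded_span_def signed_push_def frag_extend_add)
  fix k x assume x: "x \<in> carrier (graded_span n K (Suc k))"
  show "signed_push \<epsilon> m (frag_extend d x) = frag_extend d' (signed_push \<epsilon> m x)"
    unfolding signed_push_def frag_extend_frag_extend frag_extend_cmul frag_extend_of
    by (rule frag_extend_eq)
      (use x assms in \<open>auto simp: carrier_graded_span cellular_embedding_def signed_push_def\<close>)
qed

text \<open>As the signs square to one, pulling back along \<open>m\<close> with the same signs is a left inverse.\<close>

lemma inj_signed_push:
  fixes K :: "'c set"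
  assumes "cellular_embedding n d K n' d' K' \<epsilon> m"
  shows "inj_on (signed_push \<epsilon> m) {x :: 'c \<Rightarrow>\<^sub>0 int. Poly_Mapping.keys x \<subseteq> K}"
proof (rule inj_on_inverseI)
  fix x :: "'c \<Rightarrow>\<^sub>0 int" assume x: "x \<in> {x. Poly_Mapping.keys x \<subseteq> K}"
  let ?g = "frag_extend (\<lambda>\<tau>. frag_cmul (\<epsilon> (inv_into K m \<tau>)) (frag_of (inv_into K m \<tau>)))"
  have e: "\<epsilon> \<sigma> * \<epsilon> \<sigma> = 1" if "\<sigma> \<in> K" for \<sigma>
    using assms that unfolding cellular_embedding_def by (metis abs_mult_self_eq mult_1)
  have "?g (signed_push \<epsilon> m x) = frag_extend frag_of x"
    unfolding signed_push_def frag_extend_frag_extend frag_extend_cmul frag_extend_of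
    by (rule frag_extend_eq)
      (use x assms e in \<open>auto simp: cellular_embedding_def subset_iff\<close>)
  then show "?g (signed_push \<epsilon> m x) = x" using frag_expansion[of x] by simp
qed

lemma signed_push_graded_span:
  assumes "cellular_embedding n d K n' d' K' \<epsilon> m" and A: "A \<subseteq> K"
  shows "signed_push \<epsilon> m ` carrier (graded_span n A k) = carrier (graded_span n' (m ` A) k)"
proof
  note ce = assms(1)[unfolded cellular_embedding_def]
  show "signed_push \<epsilon> m ` carrier (graded_span n A k) \<subseteq> carrier (graded_span n' (m ` A) k)"
  proof
    fix y assume "y \<in> signed_push \<epsilon> m ` carrier (graded_span n A k)"
    then obtain x where "Poly_Mapping.keys x \<subseteq> {\<sigma>\<in>A. n \<sigma> = Suc k}" "y = signed_push \<epsilon> m x"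
      by (auto simp: carrier_graded_span)
    then show "y \<in> carrier (graded_span n' (m ` A) k)"
      using signed_push_keys[of \<epsilon> m x] ce A unfolding carrier_graded_span by fastforce
  qed
  show "carrier (graded_span n' (m ` A) k) \<subseteq> signed_push \<epsilon> m ` carrier (graded_span n A k)"
  proof
    fix y assume "y \<in> carrier (graded_span n' (m ` A) k)"
    then have "Poly_Mapping.keys y \<subseteq> {\<tau>\<in>m ` A. n' \<tau> = Suc k}" by (simp add: carrier_graded_span)
    then show "y \<in> signed_push \<epsilon> m ` carrier (graded_span n A k)"
    proof (rule free_Abelian_group_induct)
      show "0 \<in> signed_push \<epsilon> m ` carrier (graded_span n A k)"
        by (intro image_eqI[of _ _ 0]) (auto simp: signed_push_def carrier_graded_span)
    next
      fix x y assume "x \<in> signed_push \<epsilon> m ` carrier (graded_span n A k)" "y \<in> signed_push \<epsilon> m ` carrier (graded_span n A k)"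
      then obtain u v where "u \<in> carrier (graded_span n A k)" "v \<in> carrier (graded_span n A k)"
        "x = signed_push \<epsilon> m u" "y = signed_push \<epsilon> m v" by blast
      then show "x - y \<in> signed_push \<epsilon> m ` carrier (graded_span n A k)"
        using keys_diff[of u v] by (intro image_eqI[of _ _ "u - v"]) (auto simp: signed_push_diff carrier_graded_span)
    next
      fix \<tau> assume "\<tau> \<in> {\<tau> \<in> m ` A. n' \<tau> = Suc k}"
      then obtain \<sigma> where s: "\<sigma> \<in> A" "\<tau> = m \<sigma>" "n \<sigma> = Suc k" "\<bar>\<epsilon> \<sigma>\<bar> = 1" using ce A by auto
      then have "\<epsilon> \<sigma> * \<epsilon> \<sigma> = 1" by (metis abs_mult_self_eq mult_1)
      then have "frag_of \<tau> = signed_push \<epsilon> m (frag_cmul (\<epsilon> \<sigma>) (frag_of \<sigma>))"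
        using s by (simp add: signed_push_def frag_extend_cmul)
      moreover have "frag_cmul (\<epsilon> \<sigma>) (frag_of \<sigma>) \<in> carrier (graded_span n A k)"
        using s by (auto simp: carrier_graded_span)
      ultimately show "frag_of \<tau> \<in> signed_push \<epsilon> m ` carrier (graded_span n A k)" by blast
    qed
  qed
qed

lemma subgroup_graded_span:
  "A \<subseteq> K \<Longrightarrow> subgroup (carrier (graded_span n A k)) (graded_span n K k)"
  by (rule group.group_incl_imp_subgroup)
    (auto simp: graded_span_def free_Abelian_group_def intro: group_free_Abelian_group[unfolded free_Abelian_group_def])

text \<open>A nonzero multiple of a chain has the same support as the chain.\<close>

lemma pure_in_graded_span: "pure_in (\<lambda>k. carrier (graded_span n A k)) (cell_complex n d K)"
  unfolding pure_in_def cell_complex_simps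
  by (auto simp: graded_span_def subset_iff)

section \<open>Persistent families of cells\<close>

text \<open>What a persistence hyperdigraph and a persistence hypergraph with an embedding into the reals
  have in common: the structure maps embed the simplicial complexes generated by the hyperedges, and
  the induced chain maps are free of signs.\<close>

locale persistent_cells =
  fixes \<Omega> :: "'i::{ord, topological_space} set" and M :: "('i, 'c) pers_hyper"
    and d :: "'i \<Rightarrow> 'c \<Rightarrow> ('c \<Rightarrow>\<^sub>0 int)" and K :: "'i \<Rightarrow> 'c set"
  assumes chains_eq: "t \<in> \<Omega> \<Longrightarrow> chains M t = cell_complex (nverts M) (d t) (K t)"
    and cellular: "t \<in> \<Omega> \<Longrightarrow> cellular (nverts M) (d t) (K t)"
    and edges_subset: "t \<in> \<Omega> \<Longrightarrow> edges M t \<subseteq> K t"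
    and embedding: "s \<in> \<Omega> \<Longrightarrow> t \<in> \<Omega> \<Longrightarrow> s \<le> t \<Longrightarrow>
      cellular_embedding (nverts M) (d s) (K s) (nverts M) (d t) (K t) (\<lambda>_. 1) (trans_map M s t)"
    and trans_edges: "s \<in> \<Omega> \<Longrightarrow> t \<in> \<Omega> \<Longrightarrow> s \<le> t \<Longrightarrow> trans_map M s t ` edges M s \<subseteq> edges M t"
begin

lemma chain_push_eq: "chain_push M s t = signed_push (\<lambda>_. 1) (trans_map M s t)"
  by (simp add: chain_push_def signed_push_def)

lemma Inf_complex_eq: "Inf_complex M t = embedded_complex (chains M t) (span_of M (edges M t))"
  by (simp add: Inf_complex_def embedded_complex_def)

lemma valid_chains: "t \<in> \<Omega> \<Longrightarrow> valid_complex (chains M t)"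
  by (simp add: chains_eq valid_cell_complex cellular)

lemma subgroup_span: "t \<in> \<Omega> \<Longrightarrow> A \<subseteq> edges M t \<Longrightarrow> subgroup (span_of M A k) (grp (chains M t) k)"
  unfolding span_of_def chains_eq cell_complex_simps using edges_subset by (intro subgroup_graded_span) blast

lemma pure_in_span: "t \<in> \<Omega> \<Longrightarrow> pure_in (span_of M A) (chains M t)"
  using pure_in_graded_span unfolding span_of_def chains_eq .

lemma valid_Inf_complex: "t \<in> \<Omega> \<Longrightarrow> valid_complex (Inf_complex M t)"
  unfolding Inf_complex_def
  by (intro valid_restrict_complex valid_chains subcomplex_infimum subgroup_span order_refl)

text \<open>The complex \<open>Inf(P(s)) / \<phi>(r,s)(Inf(P(r)))\<close>, on which every notion of regularity at \<open>r \<le> s\<close>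
  depends.\<close>

definition transition_cokernel :: "'i \<Rightarrow> 'i \<Rightarrow> ('c \<Rightarrow>\<^sub>0 int) set chain_complex" where
  "transition_cokernel r s = cokernel_complex (Inf_complex M r) (Inf_complex M s) (\<lambda>k. chain_push M r s)"

context
  fixes r s assumes rs: "r \<in> \<Omega>" "s \<in> \<Omega>" "r \<le> s"
begin

lemma chain_map_push: "chain_map (chains M r) (chains M s) (\<lambda>k. chain_push M r s)"
  unfolding chain_push_eq chains_eq[OF rs(1)] chains_eq[OF rs(2)] by (rule chain_map_signed_push[OF embedding[OF rs]])

lemma inj_push: "inj_on (chain_push M r s) (carrier (grp (chains M r) k))"
  unfolding chain_push_eq chains_eq[OF rs(1)] cell_complex_simps
  by (rule inj_on_subset[OF inj_signed_push[OF embedding[OF rs]]]) (auto simp: carrier_graded_span)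

lemma push_span: "A \<subseteq> edges M r \<Longrightarrow> chain_push M r s ` span_of M A k = span_of M (trans_map M r s ` A) k"
  unfolding span_of_def chain_push_eq
  using edges_subset[OF rs(1)] by (intro signed_push_graded_span[OF embedding[OF rs]]) blast

lemma push_span_edges: "chain_push M r s ` span_of M (edges M r) k \<subseteq> span_of M (edges M s) k"
  unfolding push_span[OF order_refl] using trans_edges[OF rs] unfolding span_of_def
  by (intro subsetI) (simp add: carrier_graded_span, blast)

private lemmas emb = valid_chains[OF rs(1)] valid_chains[OF rs(2)] chain_map_push inj_push
  subgroup_span[OF rs(1) order_refl] subgroup_span[OF rs(2) order_refl] push_span_edges

lemma pure_in_push: "pure_in (\<lambda>k. chain_push M r s ` span_of M (edges M r) k) (chains M s)"
  unfolding push_span[OF order_refl] by (rule pure_in_span[OF rs(2)])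

lemma chain_map_Inf: "chain_map (Inf_complex M r) (Inf_complex M s) (\<lambda>k. chain_push M r s)"
  unfolding Inf_complex_eq by (rule chain_map_embedded[OF emb])

lemma homology_iso_Inf:
  "homology_iso (Inf_complex M r) (Inf_complex M s) (\<lambda>k. chain_push M r s) \<longleftrightarrow> acyclic_complex (transition_cokernel r s)"
  unfolding transition_cokernel_def Inf_complex_eq by (rule homology_iso_embedded[OF emb])

lemma homology_iso_over_Inf:
  "homology_iso_over TYPE('f::field) (Inf_complex M r) (Inf_complex M s) (\<lambda>k. chain_push M r s) \<longleftrightarrow>
    acyclic_complex (tensor_complex (transition_cokernel r s) :: (('c \<Rightarrow>\<^sub>0 int) set, 'f) tensor chain_complex)"
  unfolding transition_cokernel_def Inf_complex_eq by (rule homology_iso_over_embedded[OF emb pure_in_push])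

lemma acyclic_tensor_transition_cokernel:
  "acyclic_complex (transition_cokernel r s) \<Longrightarrow>
   acyclic_complex (tensor_complex (transition_cokernel r s) :: (('c \<Rightarrow>\<^sub>0 int) set, 'f::field) tensor chain_complex)"
  using homology_iso_over_if_homology_iso_embedded[OF emb pure_in_push, where 'f='f]
  unfolding homology_iso_Inf[symmetric] homology_iso_over_Inf[symmetric] Inf_complex_eq .

lemma
  assumes G: "\<And>k. subgroup (G k) (graded_span (nverts M) (edges M r) k)"
  defines "G' \<equiv> \<lambda>k. chain_push M r s ` G k"
  shows homology_iso_relative: "homology_iso (relative_complex M r G) (relative_complex M s G') (relative_push M r s G')
      \<longleftrightarrow> acyclic_complex (transition_cokernel r s)"
    and homology_iso_over_relative: "homology_iso_over TYPE('f::field) (relative_complex M r G) (relative_complex M s G') (relative_push M r s G')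
      \<longleftrightarrow> acyclic_complex (tensor_complex (transition_cokernel r s) :: (('c \<Rightarrow>\<^sub>0 int) set, 'f) tensor chain_complex)"
proof -
  have sub: "G k \<subseteq> span_of M (edges M r) k" for k
    using subgroup.subset[OF G] unfolding span_of_def .
  have sg: "subgroup (G k) (grp (chains M r) k)" for k
  proof -
    have "grp (chains M r) k\<lparr>carrier := span_of M (edges M r) k\<rparr> = graded_span (nverts M) (edges M r) k"
      unfolding chains_eq[OF rs(1)] cell_complex_simps span_of_def by (simp add: graded_span_def free_Abelian_group_def)
    then show ?thesis
      using group.incl_subgroup[OF valid_complexD(2)[OF valid_chains[OF rs(1)]] subgroup_span[OF rs(1) order_refl], of "G k" k] G
      by simp
  qed
  have push: "relative_push M r s G' = (\<lambda>k. coset_map (grp (embedded_complex (chains M s) (span_of M (edges M s))) k)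
      (infimum_subcomplex (chains M s) (\<lambda>k. chain_push M r s ` G k) k) (chain_push M r s))"
    by (rule ext) (simp add: relative_push_def[abs_def] G'_def Inf_complex_eq)
  show "homology_iso (relative_complex M r G) (relative_complex M s G') (relative_push M r s G')
      \<longleftrightarrow> acyclic_complex (transition_cokernel r s)"
    unfolding push unfolding G'_def transition_cokernel_def relative_complex_def Inf_complex_eq
    by (rule homology_iso_embedded_relative[OF emb sg sub])
  show "homology_iso_over TYPE('f::field) (relative_complex M r G) (relative_complex M s G') (relative_push M r s G')
      \<longleftrightarrow> acyclic_complex (tensor_complex (transition_cokernel r s) :: (('c \<Rightarrow>\<^sub>0 int) set, 'f) tensor chain_complex)"
    unfolding push unfolding G'_def transition_cokernel_def relative_complex_def Inf_complex_eq
    by (rule homology_iso_over_embedded_relative[OF emb sg sub pure_in_push])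
qed

lemma
  assumes A: "A \<subseteq> edges M r"
  defines "G' \<equiv> span_of M (trans_map M r s ` A)"
  shows homology_iso_relative_span: "homology_iso (relative_complex M r (span_of M A)) (relative_complex M s G') (relative_push M r s G')
      \<longleftrightarrow> acyclic_complex (transition_cokernel r s)"
    and homology_iso_over_relative_span:
      "homology_iso_over TYPE('f::field) (relative_complex M r (span_of M A)) (relative_complex M s G') (relative_push M r s G')
      \<longleftrightarrow> acyclic_complex (tensor_complex (transition_cokernel r s) :: (('c \<Rightarrow>\<^sub>0 int) set, 'f) tensor chain_complex)"
proof -
  have sg: "subgroup (span_of M A k) (graded_span (nverts M) (edges M r) k)" for k
    unfolding span_of_def by (rule subgroup_graded_span[OF A])
  have G': "G' = (\<lambda>k. chain_push M r s ` span_of M A k)"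
    unfolding G'_def push_span[OF A] ..
  show "homology_iso (relative_complex M r (span_of M A)) (relative_complex M s G') (relative_push M r s G')
      \<longleftrightarrow> acyclic_complex (transition_cokernel r s)"
    unfolding G' by (rule homology_iso_relative[OF sg])
  show "homology_iso_over TYPE('f::field) (relative_complex M r (span_of M A)) (relative_complex M s G') (relative_push M r s G')
      \<longleftrightarrow> acyclic_complex (tensor_complex (transition_cokernel r s) :: (('c \<Rightarrow>\<^sub>0 int) set, 'f) tensor chain_complex)"
    unfolding G' by (rule homology_iso_over_relative[OF sg])
qed

end

end

section \<open>Critical points\<close>

text \<open>The pattern common to all sets of critical points. Inclusions between such
  sets come from implications between the conditions \<open>R\<close>, and unions from intersecting neighborhoods.\<close>

definition critical :: "('i \<Rightarrow> 'i \<Rightarrow> bool) \<Rightarrow> 'i::{ord, topological_space} set \<Rightarrow> 'i set" where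
  "critical R \<Omega> = {t\<in>\<Omega>. \<not> (\<exists>U. openin (top_of_set \<Omega>) U \<and> t \<in> U \<and> (\<forall>r\<in>U. \<forall>s\<in>U. r \<le> s \<longrightarrow> R r s))}"

lemma critical_Un:
  assumes "\<And>r s. r \<in> \<Omega> \<Longrightarrow> s \<in> \<Omega> \<Longrightarrow> r \<le> s \<Longrightarrow> R1 r s \<Longrightarrow> R2 r s \<Longrightarrow> R r s"
  shows "critical R \<Omega> \<subseteq> critical R1 \<Omega> \<union> critical R2 \<Omega>"
proof
  fix t assume t: "t \<in> critical R \<Omega>"
  then have t\<Omega>: "t \<in> \<Omega>" by (simp add: critical_def)
  show "t \<in> critical R1 \<Omega> \<union> critical R2 \<Omega>"
  proof (rule ccontr)
    assume "t \<notin> critical R1 \<Omega> \<union> critical R2 \<Omega>"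
    then have "t \<notin> critical R1 \<Omega>" "t \<notin> critical R2 \<Omega>" by auto
    with t\<Omega> obtain U V where U: "openin (top_of_set \<Omega>) U" "t \<in> U" "\<forall>r\<in>U. \<forall>s\<in>U. r \<le> s \<longrightarrow> R1 r s"
      and V: "openin (top_of_set \<Omega>) V" "t \<in> V" "\<forall>r\<in>V. \<forall>s\<in>V. r \<le> s \<longrightarrow> R2 r s"
      unfolding critical_def mem_Collect_eq by metis
    have "\<forall>r\<in>U \<inter> V. \<forall>s\<in>U \<inter> V. r \<le> s \<longrightarrow> R r s"
    proof (intro ballI impI)
      fix r s assume "r \<in> U \<inter> V" "s \<in> U \<inter> V" "r \<le> s"
      then show "R r s" using U(3) V(3) assms[of r s] openin_imp_subset[OF U(1)] by (auto simp: subset_iff)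
    qed
    moreover have "openin (top_of_set \<Omega>) (U \<inter> V)" by (rule openin_Int[OF U(1) V(1)])
    moreover have "t \<in> U \<inter> V" using U(2) V(2) by simp
    ultimately have "t \<notin> critical R \<Omega>" unfolding critical_def mem_Collect_eq by metis
    then show False using t by simp
  qed
qed

lemma critical_mono:
  assumes "\<And>r s. r \<in> \<Omega> \<Longrightarrow> s \<in> \<Omega> \<Longrightarrow> r \<le> s \<Longrightarrow> R' r s \<Longrightarrow> R r s"
  shows "critical R \<Omega> \<subseteq> critical R' \<Omega>"
  using critical_Un[of \<Omega> R' R' R, OF assms] unfolding Un_absorb .

lemma critical_cong:
  assumes "\<And>r s. r \<in> \<Omega> \<Longrightarrow> s \<in> \<Omega> \<Longrightarrow> r \<le> s \<Longrightarrow> R r s \<longleftrightarrow> R' r s"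
  shows "critical R \<Omega> = critical R' \<Omega>"
proof
  show "critical R \<Omega> \<subseteq> critical R' \<Omega>" by (rule critical_mono) (use assms in auto)
  show "critical R' \<Omega> \<subseteq> critical R \<Omega>" by (rule critical_mono) (use assms in auto)
qed

context persistent_cells
begin

text \<open>All conditions for \<open>r \<le> s\<close> amount to the acyclicity of the transition cokernel, or of its tensor
  product with the field, so the sets of critical points of the three kinds are equal. In the lemmas
  below a universally quantified subhypergraph or graded subgroup is instantiated once to get this
  acyclicity back.\<close>

lemma Cr_eq: "CrH \<Omega> M = critical (\<lambda>r s. acyclic_complex (transition_cokernel r s)) \<Omega>"
  unfolding Cr_def critical_def[symmetric] by (rule critical_cong) (rule homology_iso_Inf)

lemma CrHF_eq: "CrHF TYPE('f::field) \<Omega> M = critical (\<lambda>r s. acyclic_complex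
    (tensor_complex (transition_cokernel r s) :: (('c \<Rightarrow>\<^sub>0 int) set, 'f) tensor chain_complex)) \<Omega>"
  unfolding Cr_def critical_def[symmetric] by (rule critical_cong) (rule homology_iso_over_Inf)

lemma CACr_eq: "CACrH \<Omega> M = CrH \<Omega> M"
  unfolding Cr_eq unfolding CACr_def critical_def[symmetric] Let_def
proof (rule critical_cong)
  fix r s assume rs: "r \<in> \<Omega>" "s \<in> \<Omega>" "r \<le> s"
  show "(\<forall>A. A \<subseteq> edges M r \<longrightarrow> homology_iso (relative_complex M r (span_of M A))
      (relative_complex M s (span_of M (trans_map M r s ` A))) (relative_push M r s (span_of M (trans_map M r s ` A))))
    \<longleftrightarrow> acyclic_complex (transition_cokernel r s)"
    using homology_iso_relative_span[OF rs] by (metis order_refl)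
qed

lemma CACrHF_eq: "CACrHF TYPE('f::field) \<Omega> M = CrHF TYPE('f) \<Omega> M"
  unfolding CrHF_eq unfolding CACr_def critical_def[symmetric] Let_def
proof (rule critical_cong)
  fix r s assume rs: "r \<in> \<Omega>" "s \<in> \<Omega>" "r \<le> s"
  show "(\<forall>A. A \<subseteq> edges M r \<longrightarrow> homology_iso_over TYPE('f) (relative_complex M r (span_of M A))
      (relative_complex M s (span_of M (trans_map M r s ` A))) (relative_push M r s (span_of M (trans_map M r s ` A))))
    \<longleftrightarrow> acyclic_complex (tensor_complex (transition_cokernel r s) :: (('c \<Rightarrow>\<^sub>0 int) set, 'f) tensor chain_complex)"
    using homology_iso_over_relative_span[OF rs] by (metis order_refl)
qed

lemma AACr_eq: "AACrH \<Omega> M = CrH \<Omega> M"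
  unfolding Cr_eq unfolding AACr_def critical_def[symmetric] Let_def
proof (rule critical_cong)
  fix r s assume rs: "r \<in> \<Omega>" "s \<in> \<Omega>" "r \<le> s"
  have "\<forall>k. subgroup (span_of M (edges M r) k) (graded_span (nverts M) (edges M r) k)"
    unfolding span_of_def by (intro allI subgroup_graded_span order_refl)
  then show "(\<forall>G. (\<forall>k. subgroup (G k) (graded_span (nverts M) (edges M r) k)) \<longrightarrow>
      homology_iso (relative_complex M r G) (relative_complex M s (\<lambda>k. chain_push M r s ` G k))
       (relative_push M r s (\<lambda>k. chain_push M r s ` G k))) \<longleftrightarrow> acyclic_complex (transition_cokernel r s)"
    using homology_iso_relative[OF rs] by blast
qed

lemma AACrHF_eq: "AACrHF TYPE('f::field) \<Omega> M = CrHF TYPE('f) \<Omega> M"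
  unfolding CrHF_eq unfolding AACr_def critical_def[symmetric] Let_def
proof (rule critical_cong)
  fix r s assume rs: "r \<in> \<Omega>" "s \<in> \<Omega>" "r \<le> s"
  have "\<forall>k. subgroup (span_of M (edges M r) k) (graded_span (nverts M) (edges M r) k)"
    unfolding span_of_def by (intro allI subgroup_graded_span order_refl)
  then show "(\<forall>G. (\<forall>k. subgroup (G k) (graded_span (nverts M) (edges M r) k)) \<longrightarrow>
      homology_iso_over TYPE('f) (relative_complex M r G) (relative_complex M s (\<lambda>k. chain_push M r s ` G k))
       (relative_push M r s (\<lambda>k. chain_push M r s ` G k))) \<longleftrightarrow>
      acyclic_complex (tensor_complex (transition_cokernel r s) :: (('c \<Rightarrow>\<^sub>0 int) set, 'f) tensor chain_complex)"
    using homology_iso_over_relative[OF rs] by blast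
qed

lemma CrHF_subset_CrH: "CrHF TYPE('f::field) \<Omega> M \<subseteq> CrH \<Omega> M"
  unfolding CrHF_eq Cr_eq by (rule critical_mono) (rule acyclic_tensor_transition_cokernel)

end

lemma (in persistent_cells) critical_point_inclusions:
  "CrHF TYPE('f::field) \<Omega> M \<subseteq> CACrHF TYPE('f) \<Omega> M \<and> CACrHF TYPE('f) \<Omega> M \<subseteq> AACrHF TYPE('f) \<Omega> M \<and>
   CrH \<Omega> M \<subseteq> CACrH \<Omega> M \<and> CACrH \<Omega> M \<subseteq> AACrH \<Omega> M \<and>
   CrHF TYPE('f) \<Omega> M \<subseteq> CrH \<Omega> M \<and>
   CACrHF TYPE('f) \<Omega> M \<subseteq> CACrH \<Omega> M \<and>
   AACrHF TYPE('f) \<Omega> M \<subseteq> AACrH \<Omega> M"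
  unfolding CACr_eq AACr_eq CACrHF_eq AACrHF_eq
  by (intro conjI order_refl CrHF_subset_CrH)

section \<open>Morphisms of persistent families of cells\<close>

text \<open>The chain maps \<open>f(t)\<^sub>#\<close> of an injective morphism \<open>f\<close>: each is an embedding of cells with signs
  \<open>\<epsilon> t\<close>, and both the cells and the signs are compatible with the structure maps.\<close>

locale persistent_cell_embedding =
  P: persistent_cells \<Omega> M d K + P': persistent_cells \<Omega> M' d' K'
  for \<Omega> :: "'i::{ord, topological_space} set" and M :: "('i, 'c) pers_hyper" and d K
    and M' :: "('i, 'e) pers_hyper" and d' K' +
  fixes \<epsilon> :: "'i \<Rightarrow> 'c \<Rightarrow> int" and m :: "'i \<Rightarrow> 'c \<Rightarrow> 'e"
  assumes embedding: "t \<in> \<Omega> \<Longrightarrow>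
      cellular_embedding (nverts M) (d t) (K t) (nverts M') (d' t) (K' t) (\<epsilon> t) (m t)"
    and map_edges: "t \<in> \<Omega> \<Longrightarrow> m t ` edges M t \<subseteq> edges M' t"
    and natural: "s \<in> \<Omega> \<Longrightarrow> t \<in> \<Omega> \<Longrightarrow> s \<le> t \<Longrightarrow> \<sigma> \<in> K s \<Longrightarrow>
      trans_map M' s t (m s \<sigma>) = m t (trans_map M s t \<sigma>) \<and> \<epsilon> t (trans_map M s t \<sigma>) = \<epsilon> s \<sigma>"
begin

abbreviation "im t \<equiv> m t ` edges M t"
abbreviation "push t \<equiv> signed_push (\<epsilon> t) (m t)"

lemma chain_map_push: "t \<in> \<Omega> \<Longrightarrow> chain_map (chains M t) (chains M' t) (\<lambda>k. push t)"
  unfolding P.chains_eq P'.chains_eq by (rule chain_map_signed_push[OF embedding])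

lemma inj_push: "t \<in> \<Omega> \<Longrightarrow> inj_on (push t) (carrier (grp (chains M t) k))"
  unfolding P.chains_eq cell_complex_simps
  by (rule inj_on_subset[OF inj_signed_push[OF embedding]]) (auto simp: carrier_graded_span)

lemma push_span: "t \<in> \<Omega> \<Longrightarrow> push t ` span_of M (edges M t) k = span_of M' (im t) k"
  unfolding span_of_def by (rule signed_push_graded_span[OF embedding P.edges_subset])

lemma push_span_edges: "t \<in> \<Omega> \<Longrightarrow> push t ` span_of M (edges M t) k \<subseteq> span_of M' (edges M' t) k"
  unfolding push_span using map_edges[of t] unfolding span_of_def
  by (intro subsetI) (simp add: carrier_graded_span, blast)

lemma chain_push_natural:
  assumes "r \<in> \<Omega>" "s \<in> \<Omega>" "r \<le> s" "Poly_Mapping.keys x \<subseteq> K r"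
  shows "chain_push M' r s (push r x) = push s (chain_push M r s x)"
  unfolding signed_push_def chain_push_def frag_extend_frag_extend frag_extend_cmul frag_extend_of
  by (rule frag_extend_eq) (use natural[OF assms(1-3)] assms(4) in auto)

context
  fixes t assumes t: "t \<in> \<Omega>"
begin

private lemmas emb = P.valid_chains[OF t] P'.valid_chains[OF t] chain_map_push[OF t] inj_push[OF t]
  P.subgroup_span[OF t order_refl] P'.subgroup_span[OF t order_refl] push_span_edges[OF t]

lemma chain_map_Inf: "chain_map (Inf_complex M t) (Inf_complex M' t) (\<lambda>k. push t)"
  unfolding P.Inf_complex_eq P'.Inf_complex_eq by (rule chain_map_embedded[OF emb])

lemma inj_Inf: "inj_on (push t) (carrier (grp (Inf_complex M t) k))"
  unfolding P.Inf_complex_eq by (rule inj_embedded[OF emb])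

text \<open>The relative complex of \<open>f\<close> is a cokernel because \<open>f(t)\<^sub>#\<close> identifies \<open>Inf(P(t))\<close> with the infimum
  of its image.\<close>

lemma cokernel_eq:
  "cokernel_complex (Inf_complex M t) (Inf_complex M' t) (\<lambda>k. push t) = relative_complex M' t (span_of M' (im t))"
  unfolding P.Inf_complex_eq P'.Inf_complex_eq cokernel_embedded_eq[OF emb] relative_complex_def push_span[OF t] ..

lemma push_Inf: "push t ` carrier (grp (Inf_complex M t) k) = infimum_subcomplex (chains M' t) (span_of M' (im t)) k"
  using fun_cong[OF infimum_image[OF emb(1-5)], of k] unfolding push_span[OF t] P.Inf_complex_eq embedded_complex_simps by simp

lemma torsion_free_cokernel:
  "torsion_free (grp (cokernel_complex (Inf_complex M t) (Inf_complex M' t) (\<lambda>k. push t)) k)"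
  unfolding P.Inf_complex_eq P'.Inf_complex_eq
  by (rule torsion_free_cokernel_embedded[OF emb]) (unfold push_span[OF t], rule P'.pure_in_span[OF t])

end

context
  fixes r s assumes rs: "r \<in> \<Omega>" "s \<in> \<Omega>" "r \<le> s"
begin

private lemma square:
  "x \<in> carrier (grp (Inf_complex M r) k) \<Longrightarrow> chain_push M' r s (push r x) = push s (chain_push M r s x)"
  using subcomplexD(3)[OF subcomplex_infimum[OF P.valid_chains[OF rs(1)] P.subgroup_span[OF rs(1) order_refl]], of x k]
  by (intro chain_push_natural[OF rs])
    (auto simp: P.Inf_complex_eq embedded_complex_simps P.chains_eq[OF rs(1)] cell_complex_simps carrier_graded_span)

private lemmas five = P.valid_Inf_complex[OF rs(1)] P'.valid_Inf_complex[OF rs(1)]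
  P.valid_Inf_complex[OF rs(2)] P'.valid_Inf_complex[OF rs(2)]
  chain_map_Inf[OF rs(1)] inj_Inf[OF rs(1)] chain_map_Inf[OF rs(2)] inj_Inf[OF rs(2)]
  P.chain_map_Inf[OF rs] P'.chain_map_Inf[OF rs] square

private lemma relative_push_eq:
  "relative_push M' r s (span_of M' (im s)) =
    (\<lambda>k. coset_map (grp (Inf_complex M' s) k) (push s ` carrier (grp (Inf_complex M s) k)) (chain_push M' r s))"
  by (rule ext) (simp add: relative_push_def[abs_def] push_Inf[OF rs(2)])

lemma homology_iso_source:
  "homology_iso (Inf_complex M' r) (Inf_complex M' s) (\<lambda>k. chain_push M' r s) \<Longrightarrow>
   homology_iso (relative_complex M' r (span_of M' (im r))) (relative_complex M' s (span_of M' (im s)))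
     (relative_push M' r s (span_of M' (im s))) \<Longrightarrow>
   homology_iso (Inf_complex M r) (Inf_complex M s) (\<lambda>k. chain_push M r s)"
  unfolding relative_push_eq cokernel_eq[OF rs(1), symmetric] cokernel_eq[OF rs(2), symmetric]
  by (rule cokernel_homology_iso_left[OF five])

lemma homology_iso_over_source:
  "homology_iso_over TYPE('f::field) (Inf_complex M' r) (Inf_complex M' s) (\<lambda>k. chain_push M' r s) \<Longrightarrow>
   homology_iso_over TYPE('f) (relative_complex M' r (span_of M' (im r))) (relative_complex M' s (span_of M' (im s)))
     (relative_push M' r s (span_of M' (im s))) \<Longrightarrow>
   homology_iso_over TYPE('f) (Inf_complex M r) (Inf_complex M s) (\<lambda>k. chain_push M r s)"
  unfolding relative_push_eq cokernel_eq[OF rs(1), symmetric] cokernel_eq[OF rs(2), symmetric]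
  by (rule cokernel_homology_iso_over_left[OF five torsion_free_cokernel[OF rs(1)] torsion_free_cokernel[OF rs(2)]])

lemma homology_iso_over_relative:
  "homology_iso_over TYPE('f::field) (Inf_complex M r) (Inf_complex M s) (\<lambda>k. chain_push M r s) \<Longrightarrow>
   homology_iso_over TYPE('f) (Inf_complex M' r) (Inf_complex M' s) (\<lambda>k. chain_push M' r s) \<Longrightarrow>
   homology_iso_over TYPE('f) (relative_complex M' r (span_of M' (im r))) (relative_complex M' s (span_of M' (im s)))
     (relative_push M' r s (span_of M' (im s)))"
  unfolding relative_push_eq cokernel_eq[OF rs(1), symmetric] cokernel_eq[OF rs(2), symmetric]
  by (rule cokernel_homology_iso_over_right[OF five torsion_free_cokernel[OF rs(1)] torsion_free_cokernel[OF rs(2)]])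

end

lemma CrH_subset: "CrH \<Omega> M \<subseteq> CrH \<Omega> M' \<union> CrH_morphism \<Omega> M' im"
  unfolding Cr_def Cr_morphism_def critical_def[symmetric] Let_def
  by (rule critical_Un) (rule homology_iso_source)

lemma CrHF_subset: "CrHF TYPE('f::field) \<Omega> M \<subseteq> CrHF TYPE('f) \<Omega> M' \<union> CrHF_morphism TYPE('f) \<Omega> M' im"
  unfolding Cr_def Cr_morphism_def critical_def[symmetric] Let_def
  by (rule critical_Un) (rule homology_iso_over_source)

text \<open>The map between the relative complexes of \<open>f\<close> need not be injective, since a hyperedge of
  \<open>P'(r)\<close> outside the image of \<open>f(r)\<close> may be sent into the image of \<open>f(s)\<close>. The passage from integers to
  the field therefore goes through \<open>P\<close>: regularity of \<open>P'\<close> and of \<open>f\<close> over the integers makes \<open>P\<close> regular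
  over the integers, then \<open>P\<close> and \<open>P'\<close> are regular over the field, and so is \<open>f\<close> by the five lemma.\<close>

lemma CrHF_morphism_subset:
  "CrHF_morphism TYPE('f::field) \<Omega> M' im \<subseteq> CrH \<Omega> M' \<union> CrH_morphism \<Omega> M' im"
  unfolding Cr_def Cr_morphism_def critical_def[symmetric] Let_def
proof (rule critical_Un)
  fix r s assume rs: "r \<in> \<Omega>" "s \<in> \<Omega>" "r \<le> s"
    and H': "homology_iso (Inf_complex M' r) (Inf_complex M' s) (\<lambda>k. chain_push M' r s)"
    and Hf: "homology_iso (relative_complex M' r (span_of M' (im r))) (relative_complex M' s (span_of M' (im s)))
      (relative_push M' r s (span_of M' (im s)))"
  have "homology_iso (Inf_complex M r) (Inf_complex M s) (\<lambda>k. chain_push M r s)"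
    by (rule homology_iso_source[OF rs H' Hf])
  then have "homology_iso_over TYPE('f) (Inf_complex M r) (Inf_complex M s) (\<lambda>k. chain_push M r s)"
    unfolding P.homology_iso_Inf[OF rs] P.homology_iso_over_Inf[OF rs]
    by (rule P.acyclic_tensor_transition_cokernel[OF rs])
  moreover have "homology_iso_over TYPE('f) (Inf_complex M' r) (Inf_complex M' s) (\<lambda>k. chain_push M' r s)"
    using H' unfolding P'.homology_iso_Inf[OF rs] P'.homology_iso_over_Inf[OF rs]
    by (rule P'.acyclic_tensor_transition_cokernel[OF rs])
  ultimately show "homology_iso_over TYPE('f) (relative_complex M' r (span_of M' (im r)))
      (relative_complex M' s (span_of M' (im s))) (relative_push M' r s (span_of M' (im s)))"
    by (rule homology_iso_over_relative[OF rs])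
qed

lemma critical_point_inclusions:
  "CACrHF TYPE('f::field) \<Omega> M \<subseteq> CACrH \<Omega> M \<and>
   CACrHF TYPE('f) \<Omega> M' \<union> CrHF_morphism TYPE('f) \<Omega> M' im \<subseteq> CACrH \<Omega> M' \<union> CrH_morphism \<Omega> M' im \<and>
   CACrHF TYPE('f) \<Omega> M \<subseteq> CACrHF TYPE('f) \<Omega> M' \<union> CrHF_morphism TYPE('f) \<Omega> M' im \<and>
   CACrH \<Omega> M \<subseteq> CACrH \<Omega> M' \<union> CrH_morphism \<Omega> M' im"
  unfolding P.CACr_eq P'.CACr_eq P.CACrHF_eq P'.CACrHF_eq
  by (intro conjI Un_least P.CrHF_subset_CrH le_supI1[OF P'.CrHF_subset_CrH] CrHF_morphism_subset
    CrH_subset CrHF_subset)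

end

section \<open>Directed simplicial complexes\<close>

lemma subseq_set: "subseq \<tau> \<sigma> \<Longrightarrow> set \<tau> \<subseteq> set \<sigma>"
  unfolding subseq_conv_nths using set_nths_subset by metis

lemma subseq_distinct: "subseq \<tau> \<sigma> \<Longrightarrow> distinct \<sigma> \<Longrightarrow> distinct \<tau>"
  unfolding subseq_conv_nths using distinct_nthsI by metis

lemma directed_simplicial_cx_hull:
  assumes P: "hyperdigraph S P"
  shows "directed_simplicial_cx S hull P = {\<tau>. \<tau> \<noteq> [] \<and> (\<exists>\<sigma>\<in>P. subseq \<tau> \<sigma>)}" (is "_ = ?K")
proof (rule hull_unique)
  show "P \<subseteq> ?K" using P by (auto simp: hyperdigraph_def)
  show "directed_simplicial_cx S ?K"
    unfolding directed_simplicial_cx_def hyperdigraph_def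
  proof (intro conjI ballI allI impI)
    fix \<tau> assume "\<tau> \<in> ?K"
    then obtain \<sigma> where s: "\<tau> \<noteq> []" "\<sigma> \<in> P" "subseq \<tau> \<sigma>" by blast
    show "\<tau> \<noteq> []" by (rule s)
    show "distinct \<tau>" using s P subseq_distinct[of \<tau> \<sigma>] by (auto simp: hyperdigraph_def)
    show "set \<tau> \<subseteq> S" using s P subseq_set[OF s(3)] by (auto simp: hyperdigraph_def)
    fix \<rho> assume "\<rho> \<noteq> [] \<and> subseq \<rho> \<tau>"
    then show "\<rho> \<in> ?K" using s(2,3) subseq_order.trans by blast
  qed
  fix K assume "P \<subseteq> K" "directed_simplicial_cx S K"
  then show "?K \<subseteq> K" unfolding directed_simplicial_cx_def by blast
qed

definition del_nth :: "nat \<Rightarrow> 'a list \<Rightarrow> 'a list" where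
  "del_nth i \<sigma> = take i \<sigma> @ drop (Suc i) \<sigma>"

lemma length_del_nth: "i < length \<sigma> \<Longrightarrow> length (del_nth i \<sigma>) = length \<sigma> - 1"
  by (simp add: del_nth_def)

lemma subseq_del_nth: "subseq (del_nth i \<sigma>) \<sigma>"
proof -
  have "suffix (drop 1 (drop i \<sigma>)) (drop i \<sigma>)" by (rule suffix_drop)
  then have "subseq (take i \<sigma> @ drop (Suc i) \<sigma>) (take i \<sigma> @ drop i \<sigma>)"
    unfolding subseq_append' by (simp add: suffix_imp_subseq)
  then show ?thesis by (simp add: del_nth_def)
qed

lemma del_nth_del_nth:
  assumes "j < i" "i < length \<sigma>"
  shows "del_nth j (del_nth i \<sigma>) = del_nth (i - 1) (del_nth j \<sigma>)"
proof -
  have "drop (Suc j) (take i \<sigma>) = take (i - 1 - j) (drop (Suc j) \<sigma>)" by (simp add: drop_take)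
  moreover have "min j (i - 1) = j" "min (i - 1) j = j" "min i j = j" "min j i = j" using assms by auto
  ultimately show ?thesis using assms by (simp add: del_nth_def)
qed

lemma directed_boundary_eq:
  "length \<sigma> \<ge> 2 \<Longrightarrow> directed_boundary \<sigma> = (\<Sum>i<length \<sigma>. frag_cmul ((-1) ^ i) (frag_of (del_nth i \<sigma>)))"
  by (simp add: directed_boundary_def del_nth_def)

text \<open>The faces obtained by deleting two entries occur twice in the double sum, once with the larger
  index deleted first and once with the smaller one, and with opposite signs.\<close>

lemma directed_boundary_boundary: "frag_extend directed_boundary (directed_boundary \<sigma>) = 0"
proof (cases "length \<sigma> \<le> 2")
  case True
  show ?thesis
  proof (rule frag_extend_eq_0)
    fix \<tau> assume "\<tau> \<in> Poly_Mapping.keys (directed_boundary \<sigma>)"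
    then have "length \<tau> \<le> 1"
      using True keys_sum[of "\<lambda>i. frag_cmul ((-1) ^ i) (frag_of (take i \<sigma> @ drop (Suc i) \<sigma>))" "{..<length \<sigma>}"]
      by (auto simp: directed_boundary_def split: if_splits)
    then show "directed_boundary \<tau> = 0" by (simp add: directed_boundary_def)
  qed
next
  case False
  define n where "n = length \<sigma>"
  define f where "f = (\<lambda>(i,j). frag_cmul ((-1) ^ (i + j)) (frag_of (del_nth j (del_nth i \<sigma>))) :: 'a list \<Rightarrow>\<^sub>0 int)"
  have "frag_extend directed_boundary (directed_boundary \<sigma>)
    = (\<Sum>i<n. frag_cmul ((-1) ^ i) (directed_boundary (del_nth i \<sigma>)))"
    using False by (simp add: directed_boundary_eq frag_extend_sum o_def frag_extend_cmul n_def)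
  also have "\<dots> = (\<Sum>i<n. \<Sum>j<n-1. f (i,j))"
  proof (rule sum.cong[OF refl])
    fix i assume "i \<in> {..<n}"
    then have l: "length (del_nth i \<sigma>) = n - 1" by (simp add: length_del_nth n_def)
    moreover have "n - 1 \<ge> 2" using False by (simp add: n_def)
    ultimately show "frag_cmul ((-1) ^ i) (directed_boundary (del_nth i \<sigma>)) = (\<Sum>j<n-1. f (i,j))"
      by (simp add: directed_boundary_eq frag_cmul_sum f_def power_add o_def)
  qed
  also have "\<dots> = sum f ({..<n} \<times> {..<n-1})"
    by (simp add: sum.cartesian_product)
  also have "{..<n} \<times> {..<n-1} = {(i,j). j < i \<and> i < n} \<union> {(i,j). i \<le> j \<and> j < n - 1}"
    by auto
  also have "sum f \<dots> = sum f {(i,j). j < i \<and> i < n} + sum f {(i,j). i \<le> j \<and> j < n - 1}"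
  proof (rule sum.union_disjoint)
    show "finite {(i,j). j < i \<and> i < n}" by (rule finite_subset[of _ "{..<n} \<times> {..<n}"]) auto
    show "finite {(i,j). i \<le> j \<and> j < n - 1}" by (rule finite_subset[of _ "{..<n} \<times> {..<n}"]) auto
  qed auto
  also have "sum f {(i,j). j < i \<and> i < n} = (\<Sum>p\<in>{(i,j). i \<le> j \<and> j < n - 1}. - f p)"
  proof (rule sum.reindex_bij_witness[of _ "\<lambda>(i,j). (Suc j, i)" "\<lambda>(i,j). (j, i - 1)"])
    fix p assume "p \<in> {(i,j). j < i \<and> i < n}"
    then obtain i j where p: "p = (i,j)" "j < i" "i < n" by blast
    then obtain l where l: "i = Suc l" by (cases i) auto
    show "- f ((\<lambda>(i,j). (j, i - 1)) p) = f p"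
      using p del_nth_del_nth[of j i \<sigma>] unfolding l by (simp add: f_def n_def add.commute)
  qed (auto)
  finally show ?thesis by (simp add: sum_negf)
qed

lemma keys_directed_boundary:
  assumes "\<tau> \<in> Poly_Mapping.keys (directed_boundary \<sigma>)"
  shows "subseq \<tau> \<sigma>" "Suc (length \<tau>) = length \<sigma>" "\<tau> \<noteq> []"
proof -
  have 2: "length \<sigma> \<ge> 2" using assms by (auto simp: directed_boundary_def split: if_splits)
  then obtain i where "i < length \<sigma>" "\<tau> = del_nth i \<sigma>"
    using assms keys_sum[of "\<lambda>i. frag_cmul ((-1) ^ i) (frag_of (del_nth i \<sigma>))" "{..<length \<sigma>}"]
    unfolding directed_boundary_eq[OF 2] by (auto simp: subset_iff)
  then show "subseq \<tau> \<sigma>" "Suc (length \<tau>) = length \<sigma>" "\<tau> \<noteq> []"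
    using 2 length_del_nth[of i \<sigma>] subseq_del_nth by auto
qed

lemma cellular_directed:
  assumes P: "hyperdigraph S P"
  shows "cellular length directed_boundary (directed_simplicial_cx S hull P)"
  unfolding cellular_def
proof (intro conjI ballI allI impI subsetI)
  fix \<sigma> k \<tau> assume s: "\<sigma> \<in> directed_simplicial_cx S hull P" "length \<sigma> = Suc (Suc k)"
    "\<tau> \<in> Poly_Mapping.keys (directed_boundary \<sigma>)"
  then show "\<tau> \<in> {\<tau> \<in> directed_simplicial_cx S hull P. length \<tau> = Suc k}"
    using keys_directed_boundary[OF s(3)] unfolding directed_simplicial_cx_hull[OF P]
    by (auto intro: subseq_order.trans)
qed (rule directed_boundary_boundary)

lemma signed_push_sum: "finite I \<Longrightarrow> signed_push \<epsilon> m (sum f I) = (\<Sum>i\<in>I. signed_push \<epsilon> m (f i))"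
  by (simp add: signed_push_def frag_extend_sum o_def)

lemma signed_push_cmul: "signed_push \<epsilon> m (frag_cmul c x) = frag_cmul c (signed_push \<epsilon> m x)"
  by (simp add: signed_push_def frag_extend_cmul)

lemma signed_push_of: "signed_push \<epsilon> m (frag_of \<sigma>) = frag_cmul (\<epsilon> \<sigma>) (frag_of (m \<sigma>))"
  by (simp add: signed_push_def)

lemma directed_boundary_map:
  "directed_boundary (map f \<sigma>) = signed_push (\<lambda>_. 1) (map f) (directed_boundary \<sigma>)"
  by (simp add: directed_boundary_def signed_push_sum signed_push_cmul signed_push_of take_map drop_map)
    (simp add: signed_push_def)

lemma cellular_embedding_directed:
  assumes P: "hyperdigraph S P" and P': "hyperdigraph S' P'" and f: "hyperdigraph_morphism S S' f P P'"
  shows "cellular_embedding length directed_boundary (directed_simplicial_cx S hull P)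
    length directed_boundary (directed_simplicial_cx S' hull P') (\<lambda>_. 1) (map f)"
  unfolding cellular_embedding_def directed_simplicial_cx_hull[OF P] directed_simplicial_cx_hull[OF P']
proof (intro conjI ballI)
  let ?K = "{\<tau>. \<tau> \<noteq> [] \<and> (\<exists>\<sigma>\<in>P. subseq \<tau> \<sigma>)}"
  have sub: "set \<tau> \<subseteq> \<Union>(set ` P)" if "\<tau> \<in> ?K" for \<tau> using that subseq_set by blast
  show "inj_on (map f) ?K"
  proof (rule inj_onI)
    fix \<sigma> \<tau> assume st: "\<sigma> \<in> ?K" "\<tau> \<in> ?K" and eq: "map f \<sigma> = map f \<tau>"
    have "inj_on f (\<Union>(set ` P))" using f unfolding hyperdigraph_morphism_def by blast
    then have "inj_on f (set \<sigma> \<union> set \<tau>)"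
      by (rule inj_on_subset) (use sub[OF st(1)] sub[OF st(2)] in blast)
    then show "\<sigma> = \<tau>" by (rule map_inj_on[OF eq])
  qed
  fix \<sigma> assume "\<sigma> \<in> ?K"
  then show "map f \<sigma> \<in> {\<tau>. \<tau> \<noteq> [] \<and> (\<exists>\<sigma>\<in>P'. subseq \<tau> \<sigma>)}"
    using f subseq_map[of \<sigma> _ f] unfolding hyperdigraph_morphism_def by blast
qed (simp_all add: directed_boundary_map)

section \<open>Ordered simplicial complexes\<close>

lemma simplicial_cx_hull:
  assumes P: "hypergraph S P"
  shows "simplicial_cx S hull P = {\<tau>. \<tau> \<noteq> {} \<and> (\<exists>\<sigma>\<in>P. \<tau> \<subseteq> \<sigma>)}" (is "_ = ?K")
proof (rule hull_unique)
  show "P \<subseteq> ?K" using P by (auto simp: hypergraph_def)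
  show "simplicial_cx S ?K"
    unfolding simplicial_cx_def hypergraph_def
  proof (intro conjI ballI allI impI)
    fix \<tau> assume "\<tau> \<in> ?K"
    then obtain \<sigma> where s: "\<tau> \<noteq> {}" "\<sigma> \<in> P" "\<tau> \<subseteq> \<sigma>" by blast
    then have "finite \<sigma>" "\<sigma> \<subseteq> S" using P by (auto simp: hypergraph_def)
    then show "finite \<tau>" "\<tau> \<noteq> {}" "\<tau> \<subseteq> S" using s finite_subset by auto
    fix \<rho> assume "\<rho> \<noteq> {} \<and> \<rho> \<subseteq> \<tau>"
    then show "\<rho> \<in> ?K" using s by blast
  qed
  fix K assume "P \<subseteq> K" "simplicial_cx S K"
  then show "?K \<subseteq> K" unfolding simplicial_cx_def by blast
qed

definition rank :: "('a \<Rightarrow> real) \<Rightarrow> 'a set \<Rightarrow> 'a \<Rightarrow> nat" where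
  "rank e \<sigma> v = card {w\<in>\<sigma>. e w < e v}"

lemma ordered_boundary_eq:
  "card \<sigma> \<ge> 2 \<Longrightarrow> ordered_boundary e \<sigma> = (\<Sum>v\<in>\<sigma>. frag_cmul ((-1) ^ rank e \<sigma> v) (frag_of (\<sigma> - {v})))"
  by (simp add: ordered_boundary_def rank_def)

lemma rank_remove:
  assumes "finite \<sigma>" "v \<in> \<sigma>"
  shows "rank e \<sigma> w = rank e (\<sigma> - {v}) w + (if e v < e w then 1 else 0)"
proof -
  have "{u\<in>\<sigma>. e u < e w} = {u\<in>\<sigma> - {v}. e u < e w} \<union> (if e v < e w then {v} else {})" using assms by auto
  then have "rank e \<sigma> w = card ({u\<in>\<sigma> - {v}. e u < e w} \<union> (if e v < e w then {v} else {}))"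
    by (simp add: rank_def)
  also have "\<dots> = rank e (\<sigma> - {v}) w + card (if e v < e w then {v} else {})"
    unfolding rank_def by (rule card_Un_disjoint) (use assms in auto)
  finally show ?thesis by simp
qed

lemma sum_antisymmetric:
  fixes f :: "'a \<Rightarrow> 'a \<Rightarrow> ('b \<Rightarrow>\<^sub>0 int)"
  assumes "finite V" "\<And>v w. v \<in> V \<Longrightarrow> w \<in> V \<Longrightarrow> v \<noteq> w \<Longrightarrow> f v w = - f w v"
  shows "(\<Sum>v\<in>V. \<Sum>w\<in>V - {v}. f v w) = 0"
proof -
  define g where "g v w = (if v = w then 0 else f v w)" for v w
  have "(\<Sum>v\<in>V. \<Sum>w\<in>V - {v}. f v w) = (\<Sum>v\<in>V. \<Sum>w\<in>V. g v w)"
    using assms(1) by (intro sum.cong refl sum.mono_neutral_cong_left) (auto simp: g_def)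
  moreover have "(\<Sum>v\<in>V. \<Sum>w\<in>V. g v w) = - (\<Sum>v\<in>V. \<Sum>w\<in>V. g v w)"
  proof -
    have "(\<Sum>v\<in>V. \<Sum>w\<in>V. g v w) = (\<Sum>v\<in>V. \<Sum>w\<in>V. - g w v)"
    proof (intro sum.cong refl)
      fix v w assume "v \<in> V" "w \<in> V"
      then show "g v w = - g w v" using assms(2)[of v w] by (cases "v = w") (simp_all add: g_def)
    qed
    also have "\<dots> = - (\<Sum>w\<in>V. \<Sum>v\<in>V. g w v)" by (subst sum.swap) (simp add: sum_negf)
    finally show ?thesis .
  qed
  moreover have "x = 0" if "x = - x" for x :: "'b \<Rightarrow>\<^sub>0 int"
  proof (rule poly_mapping_eqI)
    fix k show "Poly_Mapping.lookup x k = Poly_Mapping.lookup 0 k"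
      using arg_cong[OF that, of "\<lambda>y. Poly_Mapping.lookup y k"] by simp
  qed
  ultimately show ?thesis by metis
qed

text \<open>Deleting \<open>v\<close> lowers the position of \<open>w\<close> by one exactly if \<open>v\<close> precedes \<open>w\<close>, which happens for one of
  the orders of \<open>v\<close> and \<open>w\<close>. So the double sum is antisymmetric in the two deleted vertices.\<close>

lemma ordered_boundary_boundary:
  assumes fin: "finite \<sigma>" and inj: "inj_on e \<sigma>"
  shows "frag_extend (ordered_boundary e) (ordered_boundary e \<sigma>) = 0"
proof (cases "card \<sigma> \<le> 2")
  case True
  show ?thesis
  proof (rule frag_extend_eq_0)
    fix \<tau> assume "\<tau> \<in> Poly_Mapping.keys (ordered_boundary e \<sigma>)"
    then obtain v where "v \<in> \<sigma>" "\<tau> = \<sigma> - {v}"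
      using keys_sum[of "\<lambda>v. frag_cmul ((-1) ^ card {w \<in> \<sigma>. e w < e v}) (frag_of (\<sigma> - {v}))" \<sigma>]
      by (auto simp: ordered_boundary_def split: if_splits)
    then have "card \<tau> \<le> 1" using True fin by simp
    then show "ordered_boundary e \<tau> = 0" by (simp add: ordered_boundary_def)
  qed
next
  case False
  define f where "f v w = (frag_cmul ((-1) ^ (rank e \<sigma> v + rank e (\<sigma> - {v}) w)) (frag_of (\<sigma> - {v} - {w})) :: 'a set \<Rightarrow>\<^sub>0 int)" for v w
  have "frag_extend (ordered_boundary e) (ordered_boundary e \<sigma>)
    = (\<Sum>v\<in>\<sigma>. frag_cmul ((-1) ^ rank e \<sigma> v) (ordered_boundary e (\<sigma> - {v})))"
    using False fin by (simp add: ordered_boundary_eq frag_extend_sum o_def frag_extend_cmul)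
  also have "\<dots> = (\<Sum>v\<in>\<sigma>. \<Sum>w\<in>\<sigma> - {v}. f v w)"
  proof (rule sum.cong[OF refl])
    fix v assume "v \<in> \<sigma>"
    then have "card (\<sigma> - {v}) \<ge> 2" using False fin by simp
    then show "frag_cmul ((-1) ^ rank e \<sigma> v) (ordered_boundary e (\<sigma> - {v})) = (\<Sum>w\<in>\<sigma> - {v}. f v w)"
      by (simp add: ordered_boundary_eq frag_cmul_sum f_def power_add o_def)
  qed
  also have "\<dots> = 0"
  proof (rule sum_antisymmetric[OF fin])
    fix v w assume vw: "v \<in> \<sigma>" "w \<in> \<sigma>" "v \<noteq> w"
    then have "e v \<noteq> e w" using inj_onD[OF inj, of v w] by blast
    then have "e v < e w \<and> \<not> e w < e v \<or> e w < e v \<and> \<not> e v < e w" by linarith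
    then have "(-1 :: int) ^ (rank e \<sigma> v + rank e (\<sigma> - {v}) w) = - ((-1) ^ (rank e \<sigma> w + rank e (\<sigma> - {w}) v))"
      using rank_remove[OF fin vw(1), of e w] rank_remove[OF fin vw(2), of e v] by (auto simp: power_add)
    moreover have "\<sigma> - {v} - {w} = \<sigma> - {w} - {v}" by auto
    ultimately show "f v w = - f w v" by (simp add: f_def)
  qed
  finally show ?thesis .
qed

lemma keys_ordered_boundary:
  assumes "\<tau> \<in> Poly_Mapping.keys (ordered_boundary e \<sigma>)"
  shows "\<exists>v\<in>\<sigma>. \<tau> = \<sigma> - {v}" "card \<sigma> \<ge> 2"
  using assms keys_sum[of "\<lambda>v. frag_cmul ((-1) ^ card {w \<in> \<sigma>. e w < e v}) (frag_of (\<sigma> - {v}))" \<sigma>]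
  by (auto simp: ordered_boundary_def subset_iff split: if_splits)

lemma cellular_ordered:
  assumes P: "hypergraph S P" and e: "inj_on e S"
  shows "cellular card (ordered_boundary e) (simplicial_cx S hull P)"
  unfolding cellular_def
proof (intro conjI ballI allI impI subsetI)
  fix \<sigma> assume s: "\<sigma> \<in> simplicial_cx S hull P"
  then have fs: "finite \<sigma>" "\<sigma> \<subseteq> S" using P finite_subset unfolding simplicial_cx_hull[OF P] hypergraph_def by blast+
  then show "frag_extend (ordered_boundary e) (ordered_boundary e \<sigma>) = 0"
    using ordered_boundary_boundary inj_on_subset[OF e] by blast
  fix k \<tau> assume k: "card \<sigma> = Suc (Suc k)" and t: "\<tau> \<in> Poly_Mapping.keys (ordered_boundary e \<sigma>)"
  obtain v where v: "v \<in> \<sigma>" "\<tau> = \<sigma> - {v}" using keys_ordered_boundary(1)[OF t] by blast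
  then have c: "card \<tau> = Suc k" using k fs by simp
  then have "\<tau> \<noteq> {}" by auto
  then show "\<tau> \<in> {\<tau> \<in> simplicial_cx S hull P. card \<tau> = Suc k}"
    using s v c unfolding simplicial_cx_hull[OF P] by blast
qed

text \<open>The parity of this number is the sign of the permutation that sorts \<open>\<sigma>\<close> by \<open>g\<close> instead of \<open>e\<close>.\<close>

definition inversions :: "('a \<Rightarrow> real) \<Rightarrow> ('a \<Rightarrow> real) \<Rightarrow> 'a set \<Rightarrow> nat" where
  "inversions e g \<sigma> = card {(u, w). u \<in> \<sigma> \<and> w \<in> \<sigma> \<and> e u < e w \<and> g w < g u}"

text \<open>Let \<open>A\<close> be the vertices that precede \<open>v\<close> in both orders, \<open>B\<close> those that precede it only for \<open>e\<close>, and
  \<open>C\<close> those that precede it only for \<open>g\<close>. The inversions that involve \<open>v\<close> are counted by \<open>|B| + |C|\<close>, and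
  the positions of \<open>v\<close> are \<open>|A| + |B|\<close> and \<open>|A| + |C|\<close>; so the exponents differ by \<open>2|C|\<close>.\<close>

lemma inversions_remove:
  assumes fin: "finite \<sigma>" and v: "v \<in> \<sigma>" and e: "inj_on e \<sigma>" and g: "inj_on g \<sigma>"
  shows "(-1 :: int) ^ (inversions e g \<sigma> + rank g \<sigma> v) = (-1) ^ (rank e \<sigma> v + inversions e g (\<sigma> - {v}))"
proof -
  let ?I = "\<lambda>\<sigma>. {(u, w). u \<in> \<sigma> \<and> w \<in> \<sigma> \<and> e u < e w \<and> g w < g u}"
  define A where "A = {w\<in>\<sigma>. e w < e v \<and> g w < g v}"
  define B where "B = {w\<in>\<sigma>. e w < e v \<and> g v < g w}"
  define C where "C = {w\<in>\<sigma>. e v < e w \<and> g w < g v}"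
  have finI: "finite (?I (\<sigma> - {v}))" by (rule finite_subset[of _ "\<sigma> \<times> \<sigma>"]) (use fin in auto)
  have finABC: "finite A" "finite B" "finite C" using fin by (auto simp: A_def B_def C_def)
  have ne: "e w < e v \<or> e v < e w" "g w < g v \<or> g v < g w" if "w \<in> \<sigma>" "w \<noteq> v" for w
  proof -
    have "e w \<noteq> e v" "g w \<noteq> g v" using inj_onD[OF e, of w v] inj_onD[OF g, of w v] that v by blast+
    then show "e w < e v \<or> e v < e w" "g w < g v \<or> g v < g w" by linarith+
  qed
  let ?B = "(\<lambda>u. (u, v)) ` B" and ?C = "(\<lambda>w. (v, w)) ` C"
  have "?I \<sigma> = ?I (\<sigma> - {v}) \<union> (?B \<union> ?C)"
    using v by (auto simp: B_def C_def)
  then have "inversions e g \<sigma> = card (?I (\<sigma> - {v}) \<union> (?B \<union> ?C))" by (simp add: inversions_def)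
  also have "\<dots> = card (?I (\<sigma> - {v})) + card (?B \<union> ?C)"
    by (rule card_Un_disjoint[OF finI]) (use finABC in auto)
  also have "card (?B \<union> ?C) = card ?B + card ?C"
    by (rule card_Un_disjoint) (use finABC in \<open>auto simp: B_def\<close>)
  also have "card ?B = card B" by (rule card_image) (simp add: inj_on_def)
  also have "card ?C = card C" by (rule card_image) (simp add: inj_on_def)
  finally have I: "inversions e g \<sigma> = inversions e g (\<sigma> - {v}) + card B + card C"
    by (simp add: inversions_def)
  have "w \<in> A \<union> B" if "w \<in> \<sigma>" "e w < e v" for w
    using ne(2)[of w] that by (auto simp: A_def B_def)
  then have "{w\<in>\<sigma>. e w < e v} = A \<union> B" by (auto simp: A_def B_def)
  moreover have "card (A \<union> B) = card A + card B"
    by (rule card_Un_disjoint[OF finABC(1,2)]) (auto simp: A_def B_def)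
  ultimately have r: "rank e \<sigma> v = card A + card B" unfolding rank_def by simp
  have "w \<in> A \<union> C" if "w \<in> \<sigma>" "g w < g v" for w
    using ne(1)[of w] that by (auto simp: A_def C_def)
  then have "{w\<in>\<sigma>. g w < g v} = A \<union> C" by (auto simp: A_def C_def)
  moreover have "card (A \<union> C) = card A + card C"
    by (rule card_Un_disjoint[OF finABC(1,3)]) (auto simp: A_def C_def)
  ultimately have r': "rank g \<sigma> v = card A + card C" unfolding rank_def by simp
  have "(-1 :: int) ^ (inversions e g \<sigma> + rank g \<sigma> v)
    = (-1) ^ (rank e \<sigma> v + inversions e g (\<sigma> - {v})) * ((-1) ^ card C * (-1) ^ card C)"
    unfolding I r r' by (simp add: power_add)
  also have "(-1 :: int) ^ card C * (-1) ^ card C = 1" by (simp flip: power_add mult_2)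
  finally show ?thesis by simp
qed

text \<open>A map that does not respect the orders commutes with the boundary after each simplex is given
  the sign of the permutation by which its vertices are reordered.\<close>

lemma ordered_boundary_image:
  assumes fin: "finite \<sigma>" and f: "inj_on f \<sigma>" and e: "inj_on e \<sigma>" and e': "inj_on e' (f ` \<sigma>)"
    and \<epsilon>: "\<And>\<tau>. \<tau> \<subseteq> \<sigma> \<Longrightarrow> \<epsilon> \<tau> = (-1) ^ inversions e (e' \<circ> f) \<tau>"
  shows "frag_cmul (\<epsilon> \<sigma>) (ordered_boundary e' (f ` \<sigma>)) = signed_push \<epsilon> (image f) (ordered_boundary e \<sigma>)"
proof (cases "card \<sigma> \<le> 1")
  case True
  then show ?thesis using card_image[OF f] by (simp add: ordered_boundary_def signed_push_def)
next
  case False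
  then have 2: "card \<sigma> \<ge> 2" "card (f ` \<sigma>) \<ge> 2" using card_image[OF f] by simp_all
  have g: "inj_on (e' \<circ> f) \<sigma>" by (rule comp_inj_on[OF f e'])
  have rk: "rank e' (f ` \<sigma>) (f v) = rank (e' \<circ> f) \<sigma> v" for v
  proof -
    have "{w\<in>f ` \<sigma>. e' w < e' (f v)} = f ` {w\<in>\<sigma>. (e' \<circ> f) w < (e' \<circ> f) v}" by auto
    then show ?thesis unfolding rank_def using card_image[OF inj_on_subset[OF f]] by (metis (no_types, lifting) mem_Collect_eq subsetI)
  qed
  have "frag_cmul (\<epsilon> \<sigma>) (ordered_boundary e' (f ` \<sigma>))
    = (\<Sum>v\<in>\<sigma>. frag_cmul (\<epsilon> \<sigma> * (-1) ^ rank (e' \<circ> f) \<sigma> v) (frag_of (f ` \<sigma> - {f v})))"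
    unfolding ordered_boundary_eq[OF 2(2)] sum.reindex[OF f] by (simp add: frag_cmul_sum o_def rk)
  also have "\<dots> = (\<Sum>v\<in>\<sigma>. frag_cmul ((-1) ^ rank e \<sigma> v * \<epsilon> (\<sigma> - {v})) (frag_of (f ` (\<sigma> - {v}))))"
  proof (rule sum.cong[OF refl])
    fix v assume v: "v \<in> \<sigma>"
    have "f ` (\<sigma> - {v}) = f ` \<sigma> - {f v}" using f v by (auto simp: inj_on_def)
    moreover have "\<epsilon> \<sigma> * (-1) ^ rank (e' \<circ> f) \<sigma> v = (-1) ^ rank e \<sigma> v * \<epsilon> (\<sigma> - {v})"
      using inversions_remove[OF fin v e g] \<epsilon>[of \<sigma>] \<epsilon>[of "\<sigma> - {v}"] by (simp add: power_add Diff_subset)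
    ultimately show "frag_cmul (\<epsilon> \<sigma> * (-1) ^ rank (e' \<circ> f) \<sigma> v) (frag_of (f ` \<sigma> - {f v}))
       = frag_cmul ((-1) ^ rank e \<sigma> v * \<epsilon> (\<sigma> - {v})) (frag_of (f ` (\<sigma> - {v})))" by simp
  qed
  also have "\<dots> = signed_push \<epsilon> (image f) (ordered_boundary e \<sigma>)"
    unfolding ordered_boundary_eq[OF 2(1)] by (simp add: signed_push_sum[OF fin] signed_push_cmul signed_push_of)
  finally show ?thesis .
qed

lemma cellular_embedding_ordered:
  assumes P: "hypergraph S P" and P': "hypergraph S' P'" and f: "injective_hypergraph_morphism S S' f P P'"
    and e: "inj_on e S" and e': "inj_on e' S'"
    and \<epsilon>: "\<And>\<tau>. \<tau> \<subseteq> S \<Longrightarrow> \<epsilon> \<tau> = (-1) ^ inversions e (e' \<circ> f) \<tau>"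
  shows "cellular_embedding card (ordered_boundary e) (simplicial_cx S hull P)
    card (ordered_boundary e') (simplicial_cx S' hull P') \<epsilon> (image f)"
  unfolding cellular_embedding_def simplicial_cx_hull[OF P] simplicial_cx_hull[OF P']
proof (intro conjI ballI)
  let ?K = "{\<tau>. \<tau> \<noteq> {} \<and> (\<exists>\<sigma>\<in>P. \<tau> \<subseteq> \<sigma>)}"
  have f': "f \<in> S \<rightarrow> S'" "\<And>\<sigma>. \<sigma> \<in> P \<Longrightarrow> f ` \<sigma> \<in> P'" "inj_on f (\<Union>P)"
    using f by (auto simp: injective_hypergraph_morphism_def hypergraph_morphism_def)
  show "inj_on (image f) ?K"
    by (rule inj_on_subset[OF inj_on_image_Pow[OF f'(3)]]) blast
  fix \<sigma> assume s: "\<sigma> \<in> ?K"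
  then have sub: "\<sigma> \<subseteq> \<Union>P" "\<sigma> \<subseteq> S" "finite \<sigma>" using P finite_subset unfolding hypergraph_def by blast+
  note inj = inj_on_subset[OF f'(3) sub(1)]
  show "f ` \<sigma> \<in> {\<tau>. \<tau> \<noteq> {} \<and> (\<exists>\<sigma>\<in>P'. \<tau> \<subseteq> \<sigma>)}" using s f'(2) by blast
  show "card (f ` \<sigma>) = card \<sigma>" by (rule card_image[OF inj])
  show "\<bar>\<epsilon> \<sigma>\<bar> = 1" using \<epsilon>[OF sub(2)] by simp
  show "frag_cmul (\<epsilon> \<sigma>) (ordered_boundary e' (f ` \<sigma>)) = signed_push \<epsilon> (image f) (ordered_boundary e \<sigma>)"
  proof (rule ordered_boundary_image[OF sub(3) inj inj_on_subset[OF e sub(2)]])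
    show "inj_on e' (f ` \<sigma>)" by (rule inj_on_subset[OF e']) (use f'(1) sub(2) in auto)
    show "\<epsilon> \<tau> = (-1) ^ inversions e (e' \<circ> f) \<tau>" if "\<tau> \<subseteq> \<sigma>" for \<tau> using \<epsilon> that sub(2) by blast
  qed
qed

section \<open>Persistence hyperdigraphs and hypergraphs\<close>

lemma persistent_cells_directed:
  assumes "persistence_hyperdigraph \<Omega> X \<phi> P"
  shows "persistent_cells \<Omega> (directed_hyper X \<phi> P) (\<lambda>_. directed_boundary)
    (\<lambda>t. directed_simplicial_cx (topspace (X t)) hull P t)"
proof
  note P = assms[unfolded persistence_hyperdigraph_def]
  have hg: "hyperdigraph (topspace (X t)) (P t)" if "t \<in> \<Omega>" for t using P that by blast
  have mor: "hyperdigraph_morphism (topspace (X s)) (topspace (X t)) (\<phi> s t) (P s) (P t)"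
    if "s \<in> \<Omega>" "t \<in> \<Omega>" "s \<le> t" for s t using P that by blast
  show "chains (directed_hyper X \<phi> P) t = cell_complex (nverts (directed_hyper X \<phi> P)) directed_boundary
      (directed_simplicial_cx (topspace (X t)) hull P t)" for t
    by (simp add: directed_hyper_def)
  show "cellular (nverts (directed_hyper X \<phi> P)) directed_boundary (directed_simplicial_cx (topspace (X t)) hull P t)"
    if "t \<in> \<Omega>" for t
    using cellular_directed[OF hg[OF that]] by (simp add: directed_hyper_def)
  show "edges (directed_hyper X \<phi> P) t \<subseteq> directed_simplicial_cx (topspace (X t)) hull P t" for t
    by (simp add: directed_hyper_def hull_subset)
  fix s t assume st: "s \<in> \<Omega>" "t \<in> \<Omega>" "s \<le> t"
  show "cellular_embedding (nverts (directed_hyper X \<phi> P)) directed_boundary (directed_simplicial_cx (topspace (X s)) hull P s)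
      (nverts (directed_hyper X \<phi> P)) directed_boundary (directed_simplicial_cx (topspace (X t)) hull P t)
      (\<lambda>_. 1) (trans_map (directed_hyper X \<phi> P) s t)"
    using cellular_embedding_directed[OF hg[OF st(1)] hg[OF st(2)] mor[OF st]] by (simp add: directed_hyper_def)
  show "trans_map (directed_hyper X \<phi> P) s t ` edges (directed_hyper X \<phi> P) s \<subseteq> edges (directed_hyper X \<phi> P) t"
    using mor[OF st] by (auto simp: directed_hyper_def hyperdigraph_morphism_def)
qed

lemma persistent_cell_embedding_directed:
  assumes P: "persistence_hyperdigraph \<Omega> X \<phi> P" and P': "persistence_hyperdigraph \<Omega> X' \<phi>' P'"
    and f: "persistence_hyperdigraph_morphism \<Omega> X \<phi> P X' \<phi>' P' f"
  shows "persistent_cell_embedding \<Omega> (directed_hyper X \<phi> P) (\<lambda>_. directed_boundary)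
    (\<lambda>t. directed_simplicial_cx (topspace (X t)) hull P t) (directed_hyper X' \<phi>' P') (\<lambda>_. directed_boundary)
    (\<lambda>t. directed_simplicial_cx (topspace (X' t)) hull P' t) (\<lambda>_ _. 1) (\<lambda>t. map (f t))"
proof (intro persistent_cell_embedding.intro persistent_cell_embedding_axioms.intro
    persistent_cells_directed[OF P] persistent_cells_directed[OF P'])
  have hg: "hyperdigraph (topspace (X t)) (P t)" "hyperdigraph (topspace (X' t)) (P' t)"
    "hyperdigraph_morphism (topspace (X t)) (topspace (X' t)) (f t) (P t) (P' t)" if "t \<in> \<Omega>" for t
    using P P' f that by (simp_all add: persistence_hyperdigraph_def persistence_hyperdigraph_morphism_def)
  fix t assume t: "t \<in> \<Omega>"
  show "cellular_embedding (nverts (directed_hyper X \<phi> P)) directed_boundary (directed_simplicial_cx (topspace (X t)) hull P t)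
      (nverts (directed_hyper X' \<phi>' P')) directed_boundary (directed_simplicial_cx (topspace (X' t)) hull P' t)
      (\<lambda>_. 1) (map (f t))"
    using cellular_embedding_directed[OF hg[OF t]] by (simp add: directed_hyper_def)
  show "map (f t) ` edges (directed_hyper X \<phi> P) t \<subseteq> edges (directed_hyper X' \<phi>' P') t"
    using hg(3)[OF t] by (auto simp: directed_hyper_def hyperdigraph_morphism_def)
  fix s \<sigma> assume s: "s \<in> \<Omega>" "s \<le> t" "\<sigma> \<in> directed_simplicial_cx (topspace (X s)) hull P s"
  then obtain \<rho> where "\<rho> \<in> P s" "subseq \<sigma> \<rho>" unfolding directed_simplicial_cx_hull[OF hg(1)[OF s(1)]] by blast
  then have sub: "set \<sigma> \<subseteq> topspace (X s)"
    using hg(1)[OF s(1)] subseq_set[of \<sigma> \<rho>] unfolding hyperdigraph_def by blast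
  have "\<phi>' s t (f s x) = f t (\<phi> s t x)" if "x \<in> set \<sigma>" for x
    using f s t sub that unfolding persistence_hyperdigraph_morphism_def persistence_map_def by blast
  then show "trans_map (directed_hyper X' \<phi>' P') s t (map (f s) \<sigma>) = map (f t) (trans_map (directed_hyper X \<phi> P) s t \<sigma>)
      \<and> (1 :: int) = 1"
    by (simp add: directed_hyper_def)
qed

lemma inj_on_embedding_map: "embedding_map X Y g \<Longrightarrow> inj_on g (topspace X)"
  unfolding embedding_map_def by (rule homeomorphic_imp_injective_map)

text \<open>The embeddings factor through the structure maps, which forces the latter to be injective.\<close>

lemma persistence_embedding_inj:
  assumes "persistence_embedding \<Omega> X \<phi> e" "persistence_hypergraph \<Omega> X \<phi> P" "s \<in> \<Omega>" "t \<in> \<Omega>" "s \<le> t"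
  shows "inj_on (\<phi> s t) (topspace (X s))"
proof (rule inj_onI)
  fix x y assume "x \<in> topspace (X s)" "y \<in> topspace (X s)" "\<phi> s t x = \<phi> s t y"
  moreover have "inj_on (e s) (topspace (X s))"
    using assms inj_on_embedding_map unfolding persistence_embedding_def by blast
  ultimately show "x = y"
    using assms inj_onD unfolding persistence_embedding_def by metis
qed

text \<open>This makes the signs of a morphism compatible with the structure maps: passing along \<open>\<phi>(s,t)\<close>
  changes neither of the two orders that are compared.\<close>

lemma inversions_image:
  assumes h: "inj_on h \<tau>" and "\<And>x. x \<in> \<tau> \<Longrightarrow> e' (h x) = e x" "\<And>x. x \<in> \<tau> \<Longrightarrow> g' (h x) = g x"
  shows "inversions e' g' (h ` \<tau>) = inversions e g \<tau>"
proof -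
  let ?I = "{(u, w). u \<in> \<tau> \<and> w \<in> \<tau> \<and> e u < e w \<and> g w < g u}"
  have "{(u, w). u \<in> h ` \<tau> \<and> w \<in> h ` \<tau> \<and> e' u < e' w \<and> g' w < g' u} = map_prod h h ` ?I"
    using assms(2,3) by (auto simp: image_iff)
  moreover have "inj_on (map_prod h h) ?I"
    by (rule inj_on_subset[OF map_prod_inj_on[OF h h]]) auto
  ultimately show ?thesis unfolding inversions_def by (simp add: card_image)
qed

text \<open>Compatibility with the embeddings makes the structure maps increasing, so there are no
  inversions and all signs are one.\<close>

lemma persistent_cells_ordered:
  assumes e: "persistence_embedding \<Omega> X \<phi> e" and P: "persistence_hypergraph \<Omega> X \<phi> P"
  shows "persistent_cells \<Omega> (ordered_hyper X \<phi> e P) (\<lambda>t. ordered_boundary (e t))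
    (\<lambda>t. simplicial_cx (topspace (X t)) hull P t)"
proof
  have hg: "hypergraph (topspace (X t)) (P t)" if "t \<in> \<Omega>" for t using P that unfolding persistence_hypergraph_def by blast
  have inj: "inj_on (e t) (topspace (X t))" if "t \<in> \<Omega>" for t
    using e that inj_on_embedding_map unfolding persistence_embedding_def by blast
  show "chains (ordered_hyper X \<phi> e P) t = cell_complex (nverts (ordered_hyper X \<phi> e P)) (ordered_boundary (e t))
      (simplicial_cx (topspace (X t)) hull P t)" for t
    by (simp add: ordered_hyper_def)
  show "cellular (nverts (ordered_hyper X \<phi> e P)) (ordered_boundary (e t)) (simplicial_cx (topspace (X t)) hull P t)"
    if "t \<in> \<Omega>" for t
    using cellular_ordered[OF hg[OF that] inj[OF that]] by (simp add: ordered_hyper_def)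
  show "edges (ordered_hyper X \<phi> e P) t \<subseteq> simplicial_cx (topspace (X t)) hull P t" for t
    by (simp add: ordered_hyper_def hull_subset)
  fix s t assume st: "s \<in> \<Omega>" "t \<in> \<Omega>" "s \<le> t"
  have mor: "hypergraph_morphism (topspace (X s)) (topspace (X t)) (\<phi> s t) (P s) (P t)"
    using P st unfolding persistence_hypergraph_def by blast
  have "\<Union>(P s) \<subseteq> topspace (X s)" using hg[OF st(1)] unfolding hypergraph_def by blast
  then have "inj_on (\<phi> s t) (\<Union>(P s))" by (rule inj_on_subset[OF persistence_embedding_inj[OF e P st]])
  then have imor: "injective_hypergraph_morphism (topspace (X s)) (topspace (X t)) (\<phi> s t) (P s) (P t)"
    unfolding injective_hypergraph_morphism_def using mor by simp
  have "inversions (e s) (e t \<circ> \<phi> s t) \<tau> = 0" if "\<tau> \<subseteq> topspace (X s)" for \<tau>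
  proof -
    have "e t (\<phi> s t x) = e s x" if "x \<in> \<tau>" for x
      using e st that \<open>\<tau> \<subseteq> topspace (X s)\<close> unfolding persistence_embedding_def by blast
    then have "{(u, w). u \<in> \<tau> \<and> w \<in> \<tau> \<and> e s u < e s w \<and> (e t \<circ> \<phi> s t) w < (e t \<circ> \<phi> s t) u} = {}" by force
    then show ?thesis unfolding inversions_def by (metis card.empty)
  qed
  then show "cellular_embedding (nverts (ordered_hyper X \<phi> e P)) (ordered_boundary (e s)) (simplicial_cx (topspace (X s)) hull P s)
      (nverts (ordered_hyper X \<phi> e P)) (ordered_boundary (e t)) (simplicial_cx (topspace (X t)) hull P t)
      (\<lambda>_. 1) (trans_map (ordered_hyper X \<phi> e P) s t)"
    using cellular_embedding_ordered[OF hg[OF st(1)] hg[OF st(2)] imor inj[OF st(1)] inj[OF st(2)], of "\<lambda>_. 1"]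
    by (simp add: ordered_hyper_def)
  show "trans_map (ordered_hyper X \<phi> e P) s t ` edges (ordered_hyper X \<phi> e P) s \<subseteq> edges (ordered_hyper X \<phi> e P) t"
    using mor by (auto simp: ordered_hyper_def hypergraph_morphism_def)
qed

lemma persistent_cell_embedding_ordered:
  assumes e: "persistence_embedding \<Omega> X \<phi> e" and e': "persistence_embedding \<Omega> X' \<phi>' e'"
    and P: "persistence_hypergraph \<Omega> X \<phi> P" and P': "persistence_hypergraph \<Omega> X' \<phi>' P'"
    and f: "persistence_injective_hypergraph_morphism \<Omega> X \<phi> P X' \<phi>' P' f"
  shows "persistent_cell_embedding \<Omega> (ordered_hyper X \<phi> e P) (\<lambda>t. ordered_boundary (e t))
    (\<lambda>t. simplicial_cx (topspace (X t)) hull P t) (ordered_hyper X' \<phi>' e' P') (\<lambda>t. ordered_boundary (e' t))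
    (\<lambda>t. simplicial_cx (topspace (X' t)) hull P' t)
    (\<lambda>t \<sigma>. (-1) ^ inversions (e t) (e' t \<circ> f t) \<sigma>) (\<lambda>t. image (f t))"
proof (intro persistent_cell_embedding.intro persistent_cell_embedding_axioms.intro
    persistent_cells_ordered[OF e P] persistent_cells_ordered[OF e' P'])
  have hg: "hypergraph (topspace (X t)) (P t)" "hypergraph (topspace (X' t)) (P' t)"
    "injective_hypergraph_morphism (topspace (X t)) (topspace (X' t)) (f t) (P t) (P' t)" if "t \<in> \<Omega>" for t
    using P P' f that by (simp_all add: persistence_hypergraph_def persistence_injective_hypergraph_morphism_def)
  have inj: "inj_on (e t) (topspace (X t))" "inj_on (e' t) (topspace (X' t))" if "t \<in> \<Omega>" for t
    using e e' that by (simp_all add: persistence_embedding_def inj_on_embedding_map[where Y = euclideanreal])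
  fix t assume t: "t \<in> \<Omega>"
  show "cellular_embedding (nverts (ordered_hyper X \<phi> e P)) (ordered_boundary (e t)) (simplicial_cx (topspace (X t)) hull P t)
      (nverts (ordered_hyper X' \<phi>' e' P')) (ordered_boundary (e' t)) (simplicial_cx (topspace (X' t)) hull P' t)
      (\<lambda>\<sigma>. (-1) ^ inversions (e t) (e' t \<circ> f t) \<sigma>) (image (f t))"
    using cellular_embedding_ordered[OF hg[OF t] inj[OF t], of "\<lambda>\<sigma>. (-1) ^ inversions (e t) (e' t \<circ> f t) \<sigma>"]
    by (simp add: ordered_hyper_def)
  show "image (f t) ` edges (ordered_hyper X \<phi> e P) t \<subseteq> edges (ordered_hyper X' \<phi>' e' P') t"
    using hg(3)[OF t] by (auto simp: ordered_hyper_def injective_hypergraph_morphism_def hypergraph_morphism_def)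
  fix s \<sigma> assume s: "s \<in> \<Omega>" "s \<le> t" "\<sigma> \<in> simplicial_cx (topspace (X s)) hull P s"
  then have sub: "\<sigma> \<subseteq> topspace (X s)"
    using hg(1)[OF s(1)] unfolding simplicial_cx_hull[OF hg(1)[OF s(1)]] hypergraph_def by blast
  have fs: "f s x \<in> topspace (X' s)" if "x \<in> \<sigma>" for x
    using hg(3)[OF s(1)] sub that unfolding injective_hypergraph_morphism_def hypergraph_morphism_def by auto
  have nat: "\<phi>' s t (f s x) = f t (\<phi> s t x)" if "x \<in> \<sigma>" for x
    using f s t sub that unfolding persistence_injective_hypergraph_morphism_def persistence_map_def by blast
  have "e t (\<phi> s t x) = e s x" if "x \<in> \<sigma>" for x
    using e s t sub that unfolding persistence_embedding_def by blast
  moreover have "(e' t \<circ> f t) (\<phi> s t x) = (e' s \<circ> f s) x" if "x \<in> \<sigma>" for x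
    using e' s t nat[OF that] fs[OF that] unfolding persistence_embedding_def by (metis comp_apply)
  ultimately have "inversions (e t) (e' t \<circ> f t) (\<phi> s t ` \<sigma>) = inversions (e s) (e' s \<circ> f s) \<sigma>"
    by (intro inversions_image inj_on_subset[OF persistence_embedding_inj[OF e P s(1) t s(2)] sub])
  then show "trans_map (ordered_hyper X' \<phi>' e' P') s t (f s ` \<sigma>) = f t ` trans_map (ordered_hyper X \<phi> e P) s t \<sigma> \<and>
      (-1 :: int) ^ inversions (e t) (e' t \<circ> f t) (trans_map (ordered_hyper X \<phi> e P) s t \<sigma>) =
      (-1) ^ inversions (e s) (e' s \<circ> f s) \<sigma>"
    using nat by (simp add: ordered_hyper_def image_image)
qed

theorem theorem1p1:
  fixes \<Omega> :: "(ereal ^ 'n) set"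
    and X :: "ereal ^ 'n \<Rightarrow> 'a topology" and \<phi> :: "ereal ^ 'n \<Rightarrow> ereal ^ 'n \<Rightarrow> 'a \<Rightarrow> 'a"
    and X' :: "ereal ^ 'n \<Rightarrow> 'b topology" and \<phi>' :: "ereal ^ 'n \<Rightarrow> ereal ^ 'n \<Rightarrow> 'b \<Rightarrow> 'b"
  assumes "persistence_space \<Omega> X \<phi>" and "persistence_space \<Omega> X' \<phi>'"
  shows
    "(\<forall>P. persistence_hyperdigraph \<Omega> X \<phi> P \<longrightarrow>
        (let M = directed_hyper X \<phi> P in
         CrHF TYPE('f::field) \<Omega> M \<subseteq> CACrHF TYPE('f) \<Omega> M \<and> CACrHF TYPE('f) \<Omega> M \<subseteq> AACrHF TYPE('f) \<Omega> M \<and>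
         CrH \<Omega> M \<subseteq> CACrH \<Omega> M \<and> CACrH \<Omega> M \<subseteq> AACrH \<Omega> M \<and>
         CrHF TYPE('f) \<Omega> M \<subseteq> CrH \<Omega> M \<and>
         CACrHF TYPE('f) \<Omega> M \<subseteq> CACrH \<Omega> M \<and>
         AACrHF TYPE('f) \<Omega> M \<subseteq> AACrH \<Omega> M))
     \<and> (\<forall>P e. persistence_embedding \<Omega> X \<phi> e \<and> persistence_hypergraph \<Omega> X \<phi> P \<longrightarrow>
        (let M = ordered_hyper X \<phi> e P in
         CrHF TYPE('f) \<Omega> M \<subseteq> CACrHF TYPE('f) \<Omega> M \<and> CACrHF TYPE('f) \<Omega> M \<subseteq> AACrHF TYPE('f) \<Omega> M \<and>
         CrH \<Omega> M \<subseteq> CACrH \<Omega> M \<and> CACrH \<Omega> M \<subseteq> AACrH \<Omega> M \<and>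
         CrHF TYPE('f) \<Omega> M \<subseteq> CrH \<Omega> M \<and>
         CACrHF TYPE('f) \<Omega> M \<subseteq> CACrH \<Omega> M \<and>
         AACrHF TYPE('f) \<Omega> M \<subseteq> AACrH \<Omega> M))
     \<and> (\<forall>P P' f. persistence_hyperdigraph \<Omega> X \<phi> P \<and> persistence_hyperdigraph \<Omega> X' \<phi>' P' \<and>
          persistence_hyperdigraph_morphism \<Omega> X \<phi> P X' \<phi>' P' f \<longrightarrow>
        (let M = directed_hyper X \<phi> P; M' = directed_hyper X' \<phi>' P';
             B = (\<lambda>t. map (f t) ` P t) in
         CACrHF TYPE('f) \<Omega> M \<subseteq> CACrH \<Omega> M \<and>
         CACrHF TYPE('f) \<Omega> M' \<union> CrHF_morphism TYPE('f) \<Omega> M' B \<subseteq> CACrH \<Omega> M' \<union> CrH_morphism \<Omega> M' B \<and>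
         CACrHF TYPE('f) \<Omega> M \<subseteq> CACrHF TYPE('f) \<Omega> M' \<union> CrHF_morphism TYPE('f) \<Omega> M' B \<and>
         CACrH \<Omega> M \<subseteq> CACrH \<Omega> M' \<union> CrH_morphism \<Omega> M' B))
     \<and> (\<forall>P P' e e' f. persistence_embedding \<Omega> X \<phi> e \<and> persistence_embedding \<Omega> X' \<phi>' e' \<and>
          persistence_hypergraph \<Omega> X \<phi> P \<and> persistence_hypergraph \<Omega> X' \<phi>' P' \<and>
          persistence_injective_hypergraph_morphism \<Omega> X \<phi> P X' \<phi>' P' f \<longrightarrow>
        (let M = ordered_hyper X \<phi> e P; M' = ordered_hyper X' \<phi>' e' P';
             B = (\<lambda>t. image (f t) ` P t) in
         CACrHF TYPE('f) \<Omega> M \<subseteq> CACrH \<Omega> M \<and>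
         CACrHF TYPE('f) \<Omega> M' \<union> CrHF_morphism TYPE('f) \<Omega> M' B \<subseteq> CACrH \<Omega> M' \<union> CrH_morphism \<Omega> M' B \<and>
         CACrHF TYPE('f) \<Omega> M \<subseteq> CACrHF TYPE('f) \<Omega> M' \<union> CrHF_morphism TYPE('f) \<Omega> M' B \<and>
         CACrH \<Omega> M \<subseteq> CACrH \<Omega> M' \<union> CrH_morphism \<Omega> M' B))"
proof (intro conjI allI impI, unfold Let_def, goal_cases)
  case (1 P)
  then show ?case
    by (rule persistent_cells.critical_point_inclusions[OF persistent_cells_directed])
next
  case (2 P e)
  then have "persistent_cells \<Omega> (ordered_hyper X \<phi> e P) (\<lambda>t. ordered_boundary (e t))
    (\<lambda>t. simplicial_cx (topspace (X t)) hull P t)" by (intro persistent_cells_ordered) auto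
  then show ?case by (rule persistent_cells.critical_point_inclusions)
next
  case (3 P P' f)
  then have emb: "persistent_cell_embedding \<Omega> (directed_hyper X \<phi> P) (\<lambda>_. directed_boundary)
    (\<lambda>t. directed_simplicial_cx (topspace (X t)) hull P t) (directed_hyper X' \<phi>' P') (\<lambda>_. directed_boundary)
    (\<lambda>t. directed_simplicial_cx (topspace (X' t)) hull P' t) (\<lambda>_ _. 1) (\<lambda>t. map (f t))"
    by (intro persistent_cell_embedding_directed) auto
  have B: "(\<lambda>t. map (f t) ` edges (directed_hyper X \<phi> P) t) = (\<lambda>t. map (f t) ` P t)"
    by (simp add: directed_hyper_def)
  show ?case
    by (rule persistent_cell_embedding.critical_point_inclusions[OF emb, unfolded B])
next
  case (4 P P' e e' f)
  then have emb: "persistent_cell_embedding \<Omega> (ordered_hyper X \<phi> e P) (\<lambda>t. ordered_boundary (e t))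
    (\<lambda>t. simplicial_cx (topspace (X t)) hull P t) (ordered_hyper X' \<phi>' e' P') (\<lambda>t. ordered_boundary (e' t))
    (\<lambda>t. simplicial_cx (topspace (X' t)) hull P' t)
    (\<lambda>t \<sigma>. (-1) ^ inversions (e t) (e' t \<circ> f t) \<sigma>) (\<lambda>t. image (f t))"
    by (intro persistent_cell_embedding_ordered) auto
  have B: "(\<lambda>t. image (f t) ` edges (ordered_hyper X \<phi> e P) t) = (\<lambda>t. image (f t) ` P t)"
    by (simp add: ordered_hyper_def)
  show ?case
    by (rule persistent_cell_embedding.critical_point_inclusions[OF emb, unfolded B])
qed

end
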